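(* Let $A$ be a $C^*$-algebra and let $I \subseteq A$ be a (two-sided, not necessarily norm-closed) ideal, with Dixmier interior $\operatorname{int}_D(I)$ and Dixmier closure $\operatorname{cl}_D(I)$. Then $|x|^{1+\varepsilon} \in \operatorname{int}_D(I)$ for all $x \in I$ and $\varepsilon > 0$. Further, \[ \operatorname{cl}_D(I)^{1+\varepsilon} \subseteq \operatorname{int}_D(I) \subseteq I \subseteq \operatorname{cl}_D(I) \subseteq \operatorname{int}_D(I)^{1-\delta} \] for all $\varepsilon > 0$ and $\delta \in (0,1)$.
   Context: $C^*$-algebras are not assumed unital, $A_+$ denotes the set of positive elements of $A$, and $|x| := (x^*x)^{1/2}$. An ideal in $A$ is an additive subgroup $I \subseteq A$ with $aI \cup Ia \subseteq I$ for all $a \in A$; it is not assumed norm-closed, self-adjoint, or closed under complex scalars. Put $I_+ := I \cap A_+$. An order ideal in $A_+$ is an additive submonoid $M \subseteq A_+$ such that $a,b \in A_+$, $a \leq b$ and $b \in M$ imply $a \in M$; it is strongly invariant if for all $x \in A$, $x^*x \in M$ if and only if $xx^* \in M$. A Dixmier ideal in $A$ is a two-sided ideal $I$ (not necessarily norm-closed) that is positively spanned ($I$ is the complex linear span of $I_+$), hereditary ($I_+$ is an order ideal), and such that $I_+$ is strongly invariant. For a Dixmier ideal $I$ and $s \in (0,\infty)$, $I^s$ is the complex linear span of $\{a^s : a \in I_+\}$. Arbitrary sums (sets of finite sums of elements of the union) and intersections of Dixmier ideals are again Dixmier ideals. For any ideal $I \subseteq A$, the Dixmier interior $\operatorname{int}_D(I)$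 is the sum of all Dixmier ideals of $A$ contained in $I$ (the largest Dixmier ideal contained in $I$), and the Dixmier closure $\operatorname{cl}_D(I)$ is the intersection of all Dixmier ideals of $A$ containing $I$ (the smallest Dixmier ideal containing $I$). *)

theory Defs
  imports
    "HOL-Analysis.Analysis"
    "HOL-Computational_Algebra.Polynomial"
    "HOL-Library.Nonpos_Ints"
begin

text \<open>
  C*-algebras, not assumed unital. The superclasses already give a complete,
  submultiplicatively normed algebra over the reals; the zero algebra is allowed.
\<close>

class cstar_algebra = banach + real_normed_algebra +
  fixes scaleC :: "complex \<Rightarrow> 'a \<Rightarrow> 'a" (infixr "*\<^sub>C" 75)
    and star :: "'a \<Rightarrow> 'a" ("(_\<^sup>\<star>)" [1000] 1000)
  assumes scaleC_add_right: "c *\<^sub>C (x + y) = c *\<^sub>C x + c *\<^sub>C y"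
    and scaleC_add_left: "(c + d) *\<^sub>C x = c *\<^sub>C x + d *\<^sub>C x"
    and scaleC_scaleC: "c *\<^sub>C (d *\<^sub>C x) = (c * d) *\<^sub>C x"
    and scaleC_of_real: "complex_of_real r *\<^sub>C x = r *\<^sub>R x"
    and mult_scaleC_left: "(c *\<^sub>C x) * y = c *\<^sub>C (x * y)"
    and mult_scaleC_right: "x * (c *\<^sub>C y) = c *\<^sub>C (x * y)"
    and norm_scaleC: "norm (c *\<^sub>C x) = cmod c * norm x"
    and star_star: "(x\<^sup>\<star>)\<^sup>\<star> = x"
    and star_add: "(x + y)\<^sup>\<star> = x\<^sup>\<star> + y\<^sup>\<star>"
    and star_scaleC: "(c *\<^sub>C x)\<^sup>\<star> = cnj c *\<^sub>C x\<^sup>\<star>"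
    and star_mult: "(x * y)\<^sup>\<star> = y\<^sup>\<star> * x\<^sup>\<star>"
    and cstar_identity: "norm (x\<^sup>\<star> * x) = (norm x)\<^sup>2"

global_interpretation complex_space:
  vector_space "scaleC :: complex \<Rightarrow> 'a \<Rightarrow> 'a::cstar_algebra"
  defines cspan = complex_space.span
proof
  show "1 *\<^sub>C x = x" for x :: 'a
    using scaleC_of_real[of 1 x] by simp
qed (simp_all add: scaleC_add_right scaleC_add_left scaleC_scaleC)

subsection \<open>Spectrum and positive elements\<close>

text \<open>
  The unitization of A is \<^typ>\<open>'a \<times> complex\<close>, where (a, l) stands for a + l1.
  The spectrum of an element of A is always taken in the unitization, whether or not
  A is unital; in particular it contains 0.
\<close>

fun unitization_mult ::
    "'a::cstar_algebra \<times> complex \<Rightarrow> 'a \<times> complex \<Rightarrow> 'a \<times> complex" where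
  "unitization_mult (a, l) (b, m) = (a * b + l *\<^sub>C b + m *\<^sub>C a, l * m)"

definition unitization_invertible :: "'a::cstar_algebra \<times> complex \<Rightarrow> bool" where
  "unitization_invertible u \<longleftrightarrow>
     (\<exists>v. unitization_mult u v = (0, 1) \<and> unitization_mult v u = (0, 1))"

definition spectrum :: "'a::cstar_algebra \<Rightarrow> complex set" where
  "spectrum a = {l. \<not> unitization_invertible (- a, l)}"

definition positive_elements :: "'a::cstar_algebra set" where
  "positive_elements = {a. a\<^sup>\<star> = a \<and> spectrum a \<subseteq> \<real>\<^sub>\<ge>\<^sub>0}"

definition cstar_le :: "'a::cstar_algebra \<Rightarrow> 'a \<Rightarrow> bool" where
  "cstar_le a b \<longleftrightarrow> b - a \<in> positive_elements"

subsection \<open>Continuous functional calculus\<close>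

text \<open>
  In a non-unital algebra only polynomials without constant term can be evaluated.
  Such a polynomial is written t * q(t), and \<open>eval_mult_var q a\<close> is its value a q(a)
  at a, the (i+1)-st power of a being \<open>((*) a ^^ i) a\<close>.
\<close>

definition eval_mult_var :: "real poly \<Rightarrow> 'a::cstar_algebra \<Rightarrow> 'a" where
  "eval_mult_var q a = (\<Sum>i\<le>degree q. coeff q i *\<^sub>R ((*) a ^^ i) a)"

text \<open>
  For self-adjoint a and a real function f that is continuous on the spectrum of a with
  f(0) = 0, f(a) is the limit of p(a) for polynomials p without constant term that
  converge to f uniformly on the spectrum.
\<close>

definition functional_calculus :: "(real \<Rightarrow> real) \<Rightarrow> 'a::cstar_algebra \<Rightarrow> 'a" where
  "functional_calculus f a = (THE b. \<forall>q :: nat \<Rightarrow> real poly.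
     uniform_limit {t. complex_of_real t \<in> spectrum a}
       (\<lambda>n t. t * poly (q n) t) f sequentially
     \<longrightarrow> (\<lambda>n. eval_mult_var (q n) a) \<longlonglongrightarrow> b)"

text \<open>Used only for positive a and s > 0; note that \<open>0 powr s = 0\<close>.\<close>

definition cstar_powr :: "'a::cstar_algebra \<Rightarrow> real \<Rightarrow> 'a" where
  "cstar_powr a s = functional_calculus (\<lambda>t. t powr s) a"

definition cstar_abs :: "'a::cstar_algebra \<Rightarrow> 'a" where
  "cstar_abs x = cstar_powr (x\<^sup>\<star> * x) (1/2)"

subsection \<open>Ideals and Dixmier ideals\<close>

definition cstar_ideal :: "'a::cstar_algebra set \<Rightarrow> bool" where
  "cstar_ideal I \<longleftrightarrow>
     0 \<in> I \<and> (\<forall>x\<in>I. \<forall>y\<in>I. x + y \<in> I) \<and> (\<forall>x\<in>I. - x \<in> I) \<and>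
     (\<forall>a. \<forall>x\<in>I. a * x \<in> I \<and> x * a \<in> I)"

definition positive_part :: "'a::cstar_algebra set \<Rightarrow> 'a set" where
  "positive_part I = I \<inter> positive_elements"

definition order_ideal :: "'a::cstar_algebra set \<Rightarrow> bool" where
  "order_ideal M \<longleftrightarrow>
     M \<subseteq> positive_elements \<and> 0 \<in> M \<and> (\<forall>a\<in>M. \<forall>b\<in>M. a + b \<in> M) \<and>
     (\<forall>a\<in>positive_elements. \<forall>b\<in>positive_elements. cstar_le a b \<longrightarrow> b \<in> M \<longrightarrow> a \<in> M)"

definition strongly_invariant :: "'a::cstar_algebra set \<Rightarrow> bool" where
  "strongly_invariant M \<longleftrightarrow> (\<forall>x. x\<^sup>\<star> * x \<in> M \<longleftrightarrow> x * x\<^sup>\<star> \<in> M)"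

definition dixmier_ideal :: "'a::cstar_algebra set \<Rightarrow> bool" where
  "dixmier_ideal I \<longleftrightarrow>
     cstar_ideal I \<and> I = cspan (positive_part I) \<and>
     order_ideal (positive_part I) \<and> strongly_invariant (positive_part I)"

definition ideal_powr :: "'a::cstar_algebra set \<Rightarrow> real \<Rightarrow> 'a set" where
  "ideal_powr I s = cspan ((\<lambda>a. cstar_powr a s) ` positive_part I)"

definition family_sum :: "'a::cstar_algebra set set \<Rightarrow> 'a set" where
  "family_sum F = {sum_list xs | xs. set xs \<subseteq> \<Union>F}"

definition dixmier_interior :: "'a::cstar_algebra set \<Rightarrow> 'a set" where
  "dixmier_interior I = family_sum {J. dixmier_ideal J \<and> J \<subseteq> I}"

definition dixmier_closure :: "'a::cstar_algebra set \<Rightarrow> 'a set" where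
  "dixmier_closure I = \<Inter>{J. dixmier_ideal J \<and> I \<subseteq> J}"

end

theory Submission
  imports Defs "HOL-Computational_Algebra.Fundamental_Theorem_Algebra"
begin

text \<open>
  Let \<open>N\<close> consist of the positive \<open>a\<close> such that \<open>y\<^sup>* y \<le> a\<close> implies that \<open>I\<close> contains all
  complex multiples of \<open>y y\<^sup>*\<close>. Pedersen's Riesz
  decomposition (if \<open>y\<^sup>* y \<le> x\<^sub>1\<^sup>* x\<^sub>1 + x\<^sub>2\<^sup>* x\<^sub>2\<close>, then \<open>y y\<^sup>* = v\<^sub>1 v\<^sub>1\<^sup>* + v\<^sub>2 v\<^sub>2\<^sup>*\<close> with
  \<open>v\<^sub>k\<^sup>* v\<^sub>k \<le> x\<^sub>k x\<^sub>k\<^sup>*\<close>) makes \<open>N\<close> a strongly invariant order ideal, so its span is a Dixmier ideal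
  inside \<open>I\<close>. If \<open>x \<in> I\<close> and \<open>y\<^sup>* y \<le> |x|\<^sup>p\<close> with \<open>p > 1\<close>, then \<open>y = w |x|\<^sup>q\<^sup>/\<^sup>2\<close> for some \<open>1 < q < p\<close>,
  and \<open>|x|\<^sup>q \<in> A x\<close>; hence \<open>|x|\<^sup>p \<in> N\<close>.

  For \<open>r = 1 + 2\<^sup>-\<^sup>j\<close> the set \<open>K = {a. a\<^sup>r \<in> N}\<close> is again a strongly invariant order ideal:
  heredity uses the Loewner--Heinz inequality for the exponent \<open>2\<^sup>-\<^sup>j\<close>, additivity uses
  \<open>(a + b)\<^sup>r \<le> 2 (a\<^sup>r + b\<^sup>r)\<close>, which follows from Loewner--Heinz for \<open>1 - 2\<^sup>-\<^sup>j\<close>. The span of \<open>K\<close> contains \<open>I\<close>,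
  so it contains the Dixmier closure, and both outer inclusions follow by letting \<open>j \<rightarrow> \<infinity>\<close>.
\<close>

subsection \<open>Elementary facts on C*-algebras\<close>

text \<open>Two obstacles shape the proof. An ideal need not be closed, so membership in
  \<open>I\<close> can never come from a limit: each element shown to lie in \<open>I\<close> must
  contain an exact factor \<open>x\<close> from \<open>I\<close>, and limits are confined to the
  cofactors. Moreover \<open>a \<le> b\<close> does not put \<open>a^r\<close> below
  \<open>b^r\<close> for \<open>r > 1\<close>, so heredity of \<open>K\<close> has no direct proof.
  There is, however, some \<open>z\<close> with \<open>a^r\<close> below
  \<open>z\<^sup>\<star> * z\<close> and \<open>z * z\<^sup>\<star>\<close> below
  \<open>b^r\<close>, and strong invariance of \<open>N\<close> crosses the gap. The dyadic
  exponents come from the proof of Loewner--Heinz: for a given pair of invertible positive elements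
  the order-preserving exponents are closed under midpoints, starting from 0 and 1. Dyadic ones
  suffice, since a larger power lies below a multiple of a smaller one. Negative powers demand
  invertibility. Spectral theory is therefore developed in unital algebras, with
  \<open>a + e\<close> in place of \<open>a\<close>, and applied to the unitization;
  \<open>A\<close> is the closed set of scalar part 0 in it, so the limits come back to
  \<open>A\<close>.\<close>

lemma star_zero [simp]: "(0::'a::cstar_algebra)\<^sup>\<star> = 0"
  using star_add[of "0::'a" 0] by simp

lemma star_minus [simp]: "(- x::'a::cstar_algebra)\<^sup>\<star> = - (x\<^sup>\<star>)"
  using star_add[of x "- x"] by (simp add: eq_neg_iff_add_eq_0 add.commute)

lemma star_diff: "(x - y::'a::cstar_algebra)\<^sup>\<star> = x\<^sup>\<star> - y\<^sup>\<star>"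
  using star_add[of x "- y"] by simp

lemma star_scaleR: "(r *\<^sub>R x::'a::cstar_algebra)\<^sup>\<star> = r *\<^sub>R (x\<^sup>\<star>)"
  using star_scaleC[of "complex_of_real r" x] by (simp add: scaleC_of_real)

lemma norm_star [simp]: "norm (x\<^sup>\<star>) = norm (x::'a::cstar_algebra)"
proof -
  have *: "norm y \<le> norm (y\<^sup>\<star>)" for y :: 'a
  proof (cases "y = 0")
    case False
    have "norm y * norm y \<le> norm (y\<^sup>\<star>) * norm y"
      using cstar_identity[of y] norm_mult_ineq[of "y\<^sup>\<star>" y] by (simp add: power2_eq_square)
    then show ?thesis using False by simp
  qed simp
  show ?thesis using *[of x] *[of "x\<^sup>\<star>"] by (simp add: star_star)
qed

lemma cstar_identity': "norm (x * x\<^sup>\<star>) = (norm (x::'a::cstar_algebra))\<^sup>2"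
  using cstar_identity[of "x\<^sup>\<star>"] by (simp add: star_star)

lemma bounded_linear_star: "bounded_linear (star :: 'a \<Rightarrow> 'a::cstar_algebra)"
  by (rule bounded_linear_intro[where K = 1]) (simp_all add: star_add star_scaleR)

lemmas tendsto_star [tendsto_intros] = bounded_linear.tendsto[OF bounded_linear_star]

lemma scaleC_one [simp]: "1 *\<^sub>C x = (x::'a::cstar_algebra)"
  using scaleC_of_real[of 1 x] by simp

lemma scaleC_diff_right: "c *\<^sub>C (x - y::'a::cstar_algebra) = c *\<^sub>C x - c *\<^sub>C y"
  by (rule complex_space.scale_right_diff_distrib)

lemma scaleC_diff_left: "(c - d) *\<^sub>C (x::'a::cstar_algebra) = c *\<^sub>C x - d *\<^sub>C x"
  by (rule complex_space.scale_left_diff_distrib)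

lemma star_mult_self_eq_0_iff [simp]: "x\<^sup>\<star> * x = 0 \<longleftrightarrow> x = (0::'a::cstar_algebra)"
  using cstar_identity[of x] by auto

subsection \<open>Inverses in unital C*-algebras\<close>

text \<open>\<open>norm 1 = 1\<close> excludes the zero algebra here. The theorem still covers it,
  because results reach \<open>'a\<close> through its unitization, which is never zero.\<close>

class cstar_algebra_1 = cstar_algebra + real_normed_algebra_1

lemma star_one [simp]: "(1::'a::cstar_algebra_1)\<^sup>\<star> = 1"
  by (metis mult.left_neutral mult.right_neutral star_mult star_star)

definition inverse_of :: "'a::cstar_algebra_1 \<Rightarrow> 'a \<Rightarrow> bool" where
  "inverse_of x y \<longleftrightarrow> x * y = 1 \<and> y * x = 1"

lemma inverse_of_unique: "inverse_of x y \<Longrightarrow> inverse_of x z \<Longrightarrow> y = z"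
  unfolding inverse_of_def by (metis mult.assoc mult.left_neutral mult.right_neutral)

lemma inverse_of_mult: "inverse_of x x' \<Longrightarrow> inverse_of y y' \<Longrightarrow> inverse_of (x * y) (y' * x')"
  unfolding inverse_of_def by (metis mult.assoc mult.left_neutral)

lemma inverse_of_scaleC:
  assumes "inverse_of x y" "c \<noteq> 0" shows "inverse_of (c *\<^sub>C x) (inverse c *\<^sub>C y)"
  using assms unfolding inverse_of_def
  by (simp add: mult_scaleC_left mult_scaleC_right scaleC_scaleC)

lemma neumann_inverse:
  fixes x :: "'a::cstar_algebra_1"
  assumes "norm x < 1"
  shows "\<exists>y. inverse_of (1 - x) y \<and> norm (y - 1) \<le> norm x / (1 - norm x)"
proof -
  have g: "summable (\<lambda>n. norm x ^ n)" using assms by (simp add: summable_geometric)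
  have n: "summable (\<lambda>n. norm (x ^ n))"
    by (rule summable_comparison_test'[OF g, of 0]) (simp add: norm_power_ineq)
  then have s: "summable (\<lambda>n. x ^ n)" by (rule summable_norm_cancel)
  define y where "y = (\<Sum>n. x ^ n)"
  have xy: "x * y = y - 1"
    using suminf_mult[OF s, of x] suminf_split_head[OF s] by (simp add: y_def)
  have yx: "y * x = y - 1"
    using suminf_mult2[OF s, of x] suminf_split_head[OF s] by (simp add: y_def power_commutes)
  have "norm y \<le> (\<Sum>n. norm (x ^ n))" unfolding y_def by (rule summable_norm[OF n])
  also have "\<dots> \<le> (\<Sum>n. norm x ^ n)" by (rule suminf_le[OF _ n g]) (simp add: norm_power_ineq)
  also have "\<dots> = 1 / (1 - norm x)" using assms by (simp add: suminf_geometric)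
  finally have "norm y \<le> 1 / (1 - norm x)" .
  then have "norm x * norm y \<le> norm x * (1 / (1 - norm x))" by (rule mult_left_mono) simp
  then have "norm (y - 1) \<le> norm x / (1 - norm x)"
    using norm_mult_ineq[of x y] xy by simp
  moreover have "inverse_of (1 - x) y"
    using xy yx by (simp add: inverse_of_def left_diff_distrib right_diff_distrib)
  ultimately show ?thesis by blast
qed

text \<open>Since \<open>x - h = x * (1 - x' * h)\<close>, a Neumann series inverts the second
  factor. The bound 1/2 keeps the denominator \<open>1 - norm (x' * h)\<close> at least 1/2, whence
  the factor 2.\<close>

lemma inverse_perturb:
  fixes x :: "'a::cstar_algebra_1"
  assumes x: "inverse_of x x'" and h: "norm x' * norm h \<le> 1/2"
  shows "\<exists>y. inverse_of (x - h) y \<and> norm (y - x') \<le> 2 * (norm x')\<^sup>2 * norm h"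
proof -
  have u: "norm (x' * h) \<le> norm x' * norm h" by (rule norm_mult_ineq)
  then obtain z where z: "inverse_of (1 - x' * h) z"
      "norm (z - 1) \<le> norm (x' * h) / (1 - norm (x' * h))"
    using neumann_inverse[of "x' * h"] h by auto
  have "norm (x' * h) / (1 - norm (x' * h)) \<le> norm (x' * h) / (1/2)"
    using u h by (intro divide_left_mono) auto
  then have z1: "norm (z - 1) \<le> 2 * (norm x' * norm h)" using z(2) u by simp
  have xh: "x - h = x * (1 - x' * h)"
    using x by (simp add: inverse_of_def right_diff_distrib flip: mult.assoc)
  have "inverse_of (x - h) (z * x')"
    unfolding xh by (rule inverse_of_mult[OF x z(1)])
  moreover have "norm (z * x' - x') \<le> 2 * (norm x')\<^sup>2 * norm h"
  proof -
    have "norm ((z - 1) * x') \<le> norm (z - 1) * norm x'" by (rule norm_mult_ineq)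
    also have "\<dots> \<le> 2 * (norm x' * norm h) * norm x'" by (rule mult_right_mono[OF z1]) simp
    finally show ?thesis by (simp add: left_diff_distrib power2_eq_square mult_ac)
  qed
  ultimately show ?thesis by blast
qed

subsection \<open>The spectrum in a unital C*-algebra\<close>

definition uspec :: "'a::cstar_algebra_1 \<Rightarrow> complex set" where
  "uspec a = {l. \<not> (\<exists>y. inverse_of (l *\<^sub>C 1 - a) y)}"

definition rspec :: "'a::cstar_algebra_1 \<Rightarrow> real set" where
  "rspec a = {t. complex_of_real t \<in> uspec a}"

lemma uspec_norm_le: "l \<in> uspec a \<Longrightarrow> cmod l \<le> norm a"
proof (rule ccontr)
  assume l: "l \<in> uspec a" and "\<not> cmod l \<le> norm a"
  then have lt: "norm a < cmod l" and l0: "l \<noteq> 0" by auto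
  have "norm (inverse l *\<^sub>C a) < 1"
    using lt l0 by (simp add: norm_scaleC norm_inverse norm_divide divide_simps)
  from neumann_inverse[OF this] obtain y where "inverse_of (1 - inverse l *\<^sub>C a) y" by blast
  from inverse_of_scaleC[OF this l0] have "inverse_of (l *\<^sub>C 1 - a) (inverse l *\<^sub>C y)"
    using l0 by (simp add: scaleC_diff_right scaleC_scaleC)
  with l show False by (auto simp: uspec_def)
qed

lemma closed_uspec: "closed (uspec (a::'a::cstar_algebra_1))"
proof -
  have "open (- uspec a)"
    unfolding open_dist
  proof
    fix l assume "l \<in> - uspec a"
    then obtain y where y: "inverse_of (l *\<^sub>C 1 - a) y" by (auto simp: uspec_def)
    show "\<exists>e>0. \<forall>m. dist m l < e \<longrightarrow> m \<in> - uspec a"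
    proof (intro exI[of _ "1 / (2 * (norm y + 1))"] conjI allI impI)
      show "0 < 1 / (2 * (norm y + 1))" by (simp add: add_nonneg_pos)
      fix m assume "dist m l < 1 / (2 * (norm y + 1))"
      then have "norm y * cmod (l - m) \<le> norm y * (1 / (2 * (norm y + 1)))"
        by (intro mult_left_mono) (auto simp: dist_norm norm_minus_commute)
      also have "\<dots> \<le> 1/2" using norm_ge_zero[of y] by (auto simp add: divide_simps simp del: norm_ge_zero)
      finally have "norm y * norm ((l - m) *\<^sub>C (1::'a)) \<le> 1/2" by (simp add: norm_scaleC)
      from inverse_perturb[OF y this] show "m \<in> - uspec a"
        by (auto simp: uspec_def scaleC_diff_left algebra_simps)
    qed
  qed
  then show ?thesis by (simp add: closed_def)
qed

lemma compact_rspec: "compact (rspec a)"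
proof -
  have "rspec a = complex_of_real -` uspec a" by (auto simp: rspec_def)
  then have "closed (rspec a)"
    using closed_vimage[OF closed_uspec, of complex_of_real a] by (simp add: continuous_intros)
  moreover have "bounded (rspec a)"
    using uspec_norm_le[of _ a]
    by (auto simp: bounded_iff rspec_def intro!: exI[of _ "norm a"] dest: uspec_norm_le)
  ultimately show ?thesis by (simp add: compact_eq_bounded_closed)
qed

lemma scaleC_power: "(c *\<^sub>C (a::'a::cstar_algebra_1)) ^ n = c ^ n *\<^sub>C a ^ n"
  by (induction n) (simp_all add: mult_scaleC_left mult_scaleC_right scaleC_scaleC mult.commute)

lemma star_power: "(a ^ n)\<^sup>\<star> = (a\<^sup>\<star>) ^ n" for a :: "'a::cstar_algebra_1"
  by (induction n) (simp_all add: star_mult power_commutes)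

text \<open>The C*-identity squares the norm at each doubling, so the powers of a self-adjoint
  element of norm 1 cannot tend to 0.\<close>

lemma norm_power_pow2:
  fixes a :: "'a::cstar_algebra_1"
  assumes "a\<^sup>\<star> = a" shows "norm (a ^ 2 ^ k) = norm a ^ 2 ^ k"
proof (induction k)
  case (Suc k)
  have "norm (a ^ 2 ^ Suc k) = norm ((a ^ 2 ^ k)\<^sup>\<star> * a ^ 2 ^ k)"
    by (simp add: star_power assms flip: power_add mult_2)
  also have "\<dots> = norm a ^ 2 ^ Suc k"
    by (simp add: cstar_identity Suc power_even_eq)
  finally show ?case .
qed simp

text \<open>\<open>G\<close> is an arbitrary choice of inverses; \<open>inverse_perturb\<close>
  yields some inverse near \<open>G w\<close>, and uniqueness identifies it with
  \<open>G v\<close>.\<close>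

lemma continuous_resolvent:
  fixes a :: "'a::cstar_algebra_1"
  assumes G: "\<And>w. cmod w \<le> 1 \<Longrightarrow> inverse_of (1 - w *\<^sub>C a) (G w)"
  shows "continuous_on (cball 0 1) G"
  unfolding continuous_on_iff
proof (intro ballI allI impI)
  fix w e assume w: "w \<in> cball (0::complex) 1" and e: "(0::real) < e"
  define K where "K = norm (G w)"
  have K: "0 \<le> K" by (simp add: K_def)
  define d where "d = min (1 / (2 * (K * norm a + 1))) (e / (2 * K\<^sup>2 * norm a + 1))"
  have p: "0 < K * norm a + 1" "0 < 2 * K\<^sup>2 * norm a + 1"
    using K by (simp_all add: add_nonneg_pos)
  have "0 < d" using p e by (simp add: d_def)
  moreover have "dist (G v) (G w) < e" if v: "v \<in> cball 0 1" "dist v w < d" for v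
  proof -
    let ?t = "cmod (v - w)"
    have t: "?t < 1 / (2 * (K * norm a + 1))" "?t < e / (2 * K\<^sup>2 * norm a + 1)"
      using v(2) by (auto simp: d_def dist_norm)
    have t1: "K * norm a * ?t \<le> K * norm a * (1 / (2 * (K * norm a + 1)))"
      using t K by (intro mult_left_mono) auto
    also have "\<dots> \<le> 1/2" using p by (simp add: field_simps)
    finally have "norm (G w) * norm ((v - w) *\<^sub>C a) \<le> 1/2"
      by (simp add: norm_scaleC K_def mult_ac)
    moreover have "inverse_of (1 - w *\<^sub>C a) (G w)" using G w by simp
    ultimately obtain y where y: "inverse_of (1 - w *\<^sub>C a - (v - w) *\<^sub>C a) y"
      "norm (y - G w) \<le> 2 * (norm (G w))\<^sup>2 * norm ((v - w) *\<^sub>C a)"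
      using inverse_perturb by blast
    have "1 - w *\<^sub>C a - (v - w) *\<^sub>C a = 1 - v *\<^sub>C a" by (simp add: scaleC_diff_left)
    then have "inverse_of (1 - v *\<^sub>C a) y" using y(1) by argo
    then have "y = G v" by (rule inverse_of_unique) (use G[of v] v in simp)
    then have "dist (G v) (G w) \<le> 2 * K\<^sup>2 * norm a * ?t"
      using y(2) by (simp add: dist_norm norm_scaleC K_def mult_ac)
    also have "\<dots> \<le> (2 * K\<^sup>2 * norm a + 1) * ?t" by (simp add: distrib_right)
    also have "\<dots> < e" using t(2) p(2) by (simp add: field_simps)
    finally show ?thesis .
  qed
  ultimately show "\<exists>d>0. \<forall>v\<in>cball 0 1. dist v w < d \<longrightarrow> dist (G v) (G w) < e" by blast
qed

text \<open>The inverse of \<open>1 - x * x\<close> is the mean of the inverses of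
  \<open>1 - x\<close> and \<open>1 + x\<close>. Iteration expresses the inverse of
  \<open>1 - (w *\<^sub>C a) ^ 2 ^ k\<close> as a mean of resolvents on the unit circle, and means
  inherit the bound \<open>e\<close>.\<close>

lemma resolvent_doubling:
  fixes a :: "'a::cstar_algebra_1"
  assumes base: "\<And>w. cmod w = 1 \<Longrightarrow> \<exists>T S. inverse_of (1 - w *\<^sub>C a) T \<and>
      inverse_of (1 - (r * w) *\<^sub>C a) S \<and> norm (T - S) \<le> e"
  shows "cmod w = 1 \<Longrightarrow> \<exists>T S. inverse_of (1 - (w *\<^sub>C a) ^ 2 ^ k) T \<and>
      inverse_of (1 - ((r * w) *\<^sub>C a) ^ 2 ^ k) S \<and> norm (T - S) \<le> e"
proof (induction k arbitrary: w)
  case 0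
  then show ?case using base[of w] by simp
next
  case (Suc k)
  \<comment> \<open>Rotation by this root of -1 flips the sign of the \<open>2 ^ k\<close>-th power
    and keeps the modulus of \<open>w\<close>.\<close>
  define z where "z = cis (pi / 2 ^ k)"
  have z: "cmod z = 1" "z ^ 2 ^ k = -1" by (simp_all add: z_def Complex.DeMoivre cis_pi)
  obtain T1 S1 where 1: "inverse_of (1 - (w *\<^sub>C a) ^ 2 ^ k) T1"
      "inverse_of (1 - ((r * w) *\<^sub>C a) ^ 2 ^ k) S1" "norm (T1 - S1) \<le> e"
    using Suc.IH[OF Suc.prems] by blast
  have "cmod (w * z) = 1" using z Suc.prems by (simp add: norm_mult)
  then obtain T2 S2 where 2: "inverse_of (1 - ((w * z) *\<^sub>C a) ^ 2 ^ k) T2"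
      "inverse_of (1 - ((r * (w * z)) *\<^sub>C a) ^ 2 ^ k) S2" "norm (T2 - S2) \<le> e"
    using Suc.IH by blast
  have neg: "((w * z) *\<^sub>C a) ^ 2 ^ k = - ((w *\<^sub>C a) ^ 2 ^ k)"
      "((r * (w * z)) *\<^sub>C a) ^ 2 ^ k = - (((r * w) *\<^sub>C a) ^ 2 ^ k)"
    using z by (simp_all add: scaleC_power power_mult_distrib)
  have avg: "inverse_of (1 - x * x) ((1/2) *\<^sub>R (U + V))"
    if U: "inverse_of (1 - x) U" and V: "inverse_of (1 + x) V" for x U V :: 'a
  proof -
    have f: "1 - x * x = (1 + x) * (1 - x)" "1 - x * x = (1 - x) * (1 + x)"
      by (simp_all add: distrib_left distrib_right left_diff_distrib right_diff_distrib)
    have U1: "(1 - x) * U = 1" "U * (1 - x) = 1" and V1: "(1 + x) * V = 1" "V * (1 + x) = 1"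
      using U V by (simp_all only: inverse_of_def)
    have "(1 - x * x) * U = (1 + x) * ((1 - x) * U)" "U * (1 - x * x) = U * (1 - x) * (1 + x)"
      by (simp_all only: f(1) mult.assoc) (simp only: f(2) flip: f(1))
    then have "(1 - x * x) * U = 1 + x" "U * (1 - x * x) = 1 + x" by (simp_all add: U1)
    moreover have "(1 - x * x) * V = (1 - x) * ((1 + x) * V)" "V * (1 - x * x) = V * (1 + x) * (1 - x)"
      by (simp_all only: f(2) mult.assoc) (simp only: f(1) flip: f(2))
    then have "(1 - x * x) * V = 1 - x" "V * (1 - x * x) = 1 - x" by (simp_all add: V1)
    moreover have "1 + x + (1 - x) = 2 *\<^sub>R 1" "1 - x + (1 + x) = 2 *\<^sub>R 1"
      by (simp_all add: scaleR_2)
    then have "(1/2) *\<^sub>R (1 + x + (1 - x)) = 1" by (simp only: scaleR_scaleR) simp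
    ultimately show ?thesis
      unfolding inverse_of_def mult_scaleR_left mult_scaleR_right distrib_left distrib_right by simp
  qed
  have sq: "x ^ 2 ^ Suc k = x ^ 2 ^ k * x ^ 2 ^ k" for x :: 'a
    by (simp add: mult_2 power_add)
  have "norm ((1/2) *\<^sub>R (T1 + T2) - (1/2) *\<^sub>R (S1 + S2)) \<le> e"
  proof -
    have "norm ((1/2) *\<^sub>R ((T1 - S1) + (T2 - S2))) \<le> (1/2) * (norm (T1 - S1) + norm (T2 - S2))"
      unfolding norm_scaleR by (simp add: norm_triangle_ineq)
    also have "\<dots> \<le> e" using 1 2 by simp
    finally show ?thesis by (simp add: algebra_simps)
  qed
  with avg[OF 1(1), of T2] avg[OF 1(2), of S2] 2(1,2) show ?case
    unfolding neg sq by auto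
qed

text \<open>Rickart's elementary proof of the spectral radius formula, specialised to
  self-adjoint elements: if the resolvent existed on the whole closed unit disc, its
  averages over roots of unity would force the powers of a to 0.\<close>

lemma selfadjoint_norm_1_spec:
  fixes a :: "'a::cstar_algebra_1"
  assumes a: "a\<^sup>\<star> = a" "norm a = 1"
  shows "\<exists>w. cmod w \<le> 1 \<and> \<not> (\<exists>y. inverse_of (1 - w *\<^sub>C a) y)"
proof (rule ccontr)
  assume "\<not> ?thesis"
  then obtain G where G: "\<And>w. cmod w \<le> 1 \<Longrightarrow> inverse_of (1 - w *\<^sub>C a) (G w)" by metis
  have "uniformly_continuous_on (cball 0 1) G"
    by (rule compact_uniformly_continuous[OF continuous_resolvent[OF G]]) auto
  then obtain d where d: "d > 0"
      "\<And>v w. v \<in> cball 0 1 \<Longrightarrow> w \<in> cball 0 1 \<Longrightarrow> dist v w < d \<Longrightarrow> dist (G v) (G w) < 1/8"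
    unfolding uniformly_continuous_on_def by (metis zero_less_divide_1_iff zero_less_numeral)
  \<comment> \<open>Strictly below 1, so that high powers of \<open>r a\<close> tend to 0, yet
    within \<open>d\<close> of 1, so that the resolvents at \<open>w\<close> and
    \<open>r * w\<close> differ by less than 1/8.\<close>
  define r where "r = 1 - min (d/2) (1/2)"
  have r: "0 < r" "r < 1" "1 - r < d" using d(1) by (auto simp: r_def)
  have base: "\<exists>T S. inverse_of (1 - w *\<^sub>C a) T \<and>
      inverse_of (1 - (complex_of_real r * w) *\<^sub>C a) S \<and> norm (T - S) \<le> 1/8"
    if w: "cmod w = 1" for w
  proof -
    have rw: "cmod (complex_of_real r * w) \<le> 1" using r w by (simp add: norm_mult)
    have "w - complex_of_real r * w = complex_of_real (1 - r) * w" by (simp add: algebra_simps)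
    then have "dist w (complex_of_real r * w) < d"
      using r w unfolding dist_norm by (simp add: norm_mult del: of_real_diff)
    then have "norm (G w - G (complex_of_real r * w)) < 1/8"
      using d(2)[of w "complex_of_real r * w"] w rw by (simp add: dist_norm)
    then show ?thesis using G[of w] G[OF rw] w by (intro exI conjI) auto
  qed
  obtain k where k: "r ^ k < 1/8" using real_arch_pow_inv[of "1/8" r] r by auto
  obtain T S where TS: "inverse_of (1 - (1 *\<^sub>C a) ^ 2 ^ k) T"
      "inverse_of (1 - ((complex_of_real r * 1) *\<^sub>C a) ^ 2 ^ k) S" "norm (T - S) \<le> 1/8"
    using resolvent_doubling[OF base, of 1 k] by auto
  define x where "x = a ^ 2 ^ k"
  have x1: "norm x = 1" using norm_power_pow2[OF a(1), of k] a(2) by (simp add: x_def)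
  define y where "y = ((complex_of_real r * 1) *\<^sub>C a) ^ 2 ^ k"
  have "norm y = r ^ 2 ^ k"
    using x1 r by (simp add: y_def scaleC_power norm_scaleC x_def norm_power)
  also have "\<dots> \<le> r ^ k" using r by (intro power_decreasing) (auto simp: less_imp_le)
  finally have y: "norm y < 1/8" using k by simp
  then obtain S' where S': "inverse_of (1 - y) S'" "norm (S' - 1) \<le> norm y / (1 - norm y)"
    using neumann_inverse[of y] by auto
  have "S' = S" using TS(2) S'(1) inverse_of_unique by (auto simp: y_def)
  moreover have "norm y / (1 - norm y) \<le> 1/7" using y by (simp add: field_simps)
  ultimately have "norm (S - 1) \<le> 1/7" using S'(2) order_trans by blast
  then have E: "norm (T - 1) < 1/2"
    using norm_triangle_ineq[of "T - S" "S - 1"] TS(3) by simp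
  \<comment> \<open>\<open>T\<close> inverts \<open>1 - x\<close> but lies within 1/8 + 1/7 of 1.
    Solving for \<open>x\<close> gives \<open>norm x \<le> 2 * norm (T - 1) < 1\<close>, against
    \<open>norm x = 1\<close>.\<close>
  have "x = (T - 1) - x * (T - 1)"
    using TS(1) by (simp add: inverse_of_def x_def algebra_simps)
  then have "norm x \<le> norm (T - 1) + norm (x * (T - 1))"
    by (metis norm_triangle_ineq4)
  also have "norm (x * (T - 1)) \<le> 1 * norm (T - 1)"
    using norm_mult_ineq[of x "T - 1"] x1 by simp
  finally show False using E x1 by simp
qed

lemma selfadjoint_spec_norm:
  fixes a :: "'a::cstar_algebra_1"
  assumes a: "a\<^sup>\<star> = a"
  shows "\<exists>l\<in>uspec a. cmod l = norm a"
proof (cases "a = 0")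
  case True
  then show ?thesis by (auto simp: uspec_def inverse_of_def)
next
  case False
  define b where "b = (1 / norm a) *\<^sub>R a"
  have "b\<^sup>\<star> = b" "norm b = 1" using a False by (simp_all add: b_def star_scaleR)
  from selfadjoint_norm_1_spec[OF this] obtain w
    where w: "cmod w \<le> 1" "\<not> (\<exists>y. inverse_of (1 - w *\<^sub>C b) y)" by blast
  have w0: "w \<noteq> 0" using w(2) by (auto simp: inverse_of_def)
  \<comment> \<open>Singularity of \<open>1 - w *\<^sub>C b\<close> with
    \<open>cmod w \<le> 1\<close> turns into a spectral value of \<open>a\<close> of modulus at
    least \<open>norm a\<close>.\<close>
  define l where "l = complex_of_real (norm a) / w"
  have l0: "l \<noteq> 0" using w0 False by (simp add: l_def)
  have b: "b = complex_of_real (1 / norm a) *\<^sub>C a" by (simp only: b_def scaleC_of_real)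
  have "l \<in> uspec a"
  proof (rule ccontr)
    assume "l \<notin> uspec a"
    then obtain y where y: "inverse_of (l *\<^sub>C 1 - a) y" by (auto simp: uspec_def)
    have "inverse l *\<^sub>C (l *\<^sub>C 1 - a) = 1 - w *\<^sub>C b"
      using l0 w0 False unfolding b l_def
      by (simp add: scaleC_diff_right scaleC_scaleC field_simps)
    then show False using inverse_of_scaleC[OF y, of "inverse l"] l0 w(2) by auto
  qed
  moreover have "norm a \<le> cmod l"
    using w w0 by (simp add: l_def norm_divide field_simps mult_left_le)
  ultimately show ?thesis using uspec_norm_le[of l a] by (metis antisym)
qed

text \<open>Arens' trick: adding \<open>\<i> * n\<close> to \<open>a\<close> moves \<open>l\<close>
  by \<open>\<i> * n\<close>, while the C*-identity bounds the squared norm by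
  \<open>(norm a)\<^sup>2 + n\<^sup>2\<close>. The squares of \<open>n\<close> cancel, leaving a
  bound linear in \<open>n\<close>.\<close>

lemma selfadjoint_spec_real:
  fixes a :: "'a::cstar_algebra_1"
  assumes a: "a\<^sup>\<star> = a" and l: "l \<in> uspec a"
  shows "Im l = 0"
proof (rule ccontr)
  assume t: "Im l \<noteq> 0"
  have bound: "(cmod l)\<^sup>2 + 2 * Im l * n \<le> (norm a)\<^sup>2" for n :: real
  proof -
    define b where "b = a + (\<i> * complex_of_real n) *\<^sub>C 1"
    have "l + \<i> * n \<in> uspec b" using l by (simp add: uspec_def b_def scaleC_add_left)
    then have "cmod (l + \<i> * n) \<le> norm b" by (rule uspec_norm_le)
    then have "(cmod (l + \<i> * n))\<^sup>2 \<le> norm (b\<^sup>\<star> * b)" by (simp add: cstar_identity power_mono)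
    also have "b\<^sup>\<star> * b = a\<^sup>\<star> * a + n\<^sup>2 *\<^sub>R 1"
      by (simp add: b_def star_add star_scaleC a algebra_simps mult_scaleC_left mult_scaleC_right
          scaleC_scaleC power2_eq_square flip: scaleC_of_real)
    also have "norm \<dots> \<le> (norm a)\<^sup>2 + n\<^sup>2"
      using norm_triangle_ineq[of "a\<^sup>\<star> * a" "n\<^sup>2 *\<^sub>R 1"] by (simp add: cstar_identity)
    finally show ?thesis unfolding cmod_power2 by (simp add: power2_eq_square algebra_simps)
  qed
  have "2 * Im l * (((norm a)\<^sup>2 + 1) / (2 * Im l)) = (norm a)\<^sup>2 + 1" using t by simp
  with bound[of "((norm a)\<^sup>2 + 1) / (2 * Im l)"] show False
    by (smt (verit) zero_le_power2)
qed

lemma uspec_selfadjoint: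
  fixes a :: "'a::cstar_algebra_1"
  assumes "a\<^sup>\<star> = a"
  shows "uspec a = complex_of_real ` rspec a"
  using selfadjoint_spec_real[OF assms]
  by (auto simp: rspec_def image_iff complex_eq_iff) (metis complex_eq_iff Im_complex_of_real Re_complex_of_real)

lemma ex_inverse_of_minus [simp]:
  "(\<exists>y. inverse_of (- x) y) \<longleftrightarrow> (\<exists>y. inverse_of (x::'a::cstar_algebra_1) y)"
proof -
  have "inverse_of (- x) (- y) \<longleftrightarrow> inverse_of x y" for x y :: 'a
    by (simp add: inverse_of_def)
  then show ?thesis by (metis minus_minus)
qed

lemma star_of_real [simp]: "(of_real r :: 'a::cstar_algebra_1)\<^sup>\<star> = of_real r"
  by (simp add: of_real_def star_scaleR)

lemma scaleC_of_real_one [simp]: "complex_of_real r *\<^sub>C 1 = (of_real r :: 'a::cstar_algebra_1)"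
  by (simp only: of_real_def[where 'a='a] scaleC_of_real)

subsection \<open>Evaluation of polynomials\<close>

text \<open>Evaluation is developed for coefficients embedded by an arbitrary central ring
  homomorphism h, because both real and complex polynomials are needed.\<close>

definition peval :: "('k::zero \<Rightarrow> 'a::ring_1) \<Rightarrow> 'k poly \<Rightarrow> 'a \<Rightarrow> 'a" where
  "peval h p a = (\<Sum>i\<le>degree p. h (coeff p i) * a ^ i)"

locale central_hom =
  fixes h :: "'k::comm_ring_1 \<Rightarrow> 'a::ring_1"
  assumes add: "h (x + y) = h x + h y" and mult: "h (x * y) = h x * h y"
    and one: "h 1 = 1" and comm: "h x * a = a * h x"
begin

lemma zero: "h 0 = 0"
  using add[of 0 0] by simp

lemma minus: "h (- x) = - h x"
  using add[of x "- x"] zero by (simp add: eq_neg_iff_add_eq_0 add.commute)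

lemma peval_bound: "degree p \<le> n \<Longrightarrow> peval h p a = (\<Sum>i\<le>n. h (coeff p i) * a ^ i)"
  unfolding peval_def by (rule sum.mono_neutral_left) (auto simp: coeff_eq_0 zero)

lemma peval_0: "peval h 0 a = 0"
  by (simp add: peval_def zero)

lemma peval_pCons: "peval h (pCons c p) a = h c + a * peval h p a"
proof -
  have "degree (pCons c p) \<le> Suc (degree p)" by (rule degree_pCons_le)
  from peval_bound[OF this, of a]
  have "peval h (pCons c p) a = h c + (\<Sum>i\<le>degree p. h (coeff p i) * a ^ Suc i)"
    by (simp add: sum.atMost_Suc_shift del: sum.atMost_Suc)
  also have "(\<Sum>i\<le>degree p. h (coeff p i) * a ^ Suc i) = a * peval h p a"
    unfolding peval_def sum_distrib_left
    by (rule sum.cong) (simp, metis comm mult.assoc power_Suc)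
  finally show ?thesis .
qed

lemma peval_const: "peval h [:c:] a = h c"
  by (simp add: peval_pCons peval_0)

lemma peval_add: "peval h (p + q) a = peval h p a + peval h q a"
proof -
  define n where "n = max (degree p) (degree q)"
  have "degree (p + q) \<le> n" "degree p \<le> n" "degree q \<le> n"
    using degree_add_le_max[of p q] by (auto simp: n_def)
  from this[THEN peval_bound] show ?thesis
    by (simp add: add distrib_right sum.distrib)
qed

lemma peval_smult: "peval h (smult c p) a = h c * peval h p a"
proof -
  have "degree (smult c p) \<le> degree p" by (rule degree_smult_le)
  from peval_bound[OF this, of a] show ?thesis
    by (simp add: mult mult.assoc sum_distrib_left peval_def)
qed

lemma peval_diff: "peval h (p - q) a = peval h p a - peval h q a"
  using peval_add[of p "smult (- 1) q" a] by (simp only: peval_smult minus one) simp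

lemma peval_mult: "peval h (p * q) a = peval h p a * peval h q a"
  by (induction p)
    (simp_all add: peval_0 peval_pCons peval_add peval_smult zero distrib_right mult.assoc)

lemma peval_intertwine:
  assumes "x * a = b * x"
  shows "x * peval h p a = peval h p b * x"
proof (induction p)
  case (pCons c p)
  have "x * (a * peval h p a) = b * (x * peval h p a)"
    using assms by (simp flip: mult.assoc)
  then show ?case by (simp add: peval_pCons distrib_left distrib_right comm pCons mult.assoc)
qed (simp add: peval_0)

end

interpretation complex_eval: central_hom "\<lambda>c. c *\<^sub>C (1::'a::cstar_algebra_1)"
  by unfold_locales
    (simp_all add: scaleC_add_left mult_scaleC_left mult_scaleC_right scaleC_scaleC)

interpretation real_eval: central_hom "of_real :: real \<Rightarrow> 'a::cstar_algebra_1"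
  by unfold_locales (simp_all, metis mult_scaleR_left mult_scaleR_right mult_1_left mult_1_right of_real_def)

abbreviation "rpeval \<equiv> peval (of_real :: real \<Rightarrow> 'a::cstar_algebra_1)"

abbreviation "cpeval \<equiv> peval (\<lambda>c. c *\<^sub>C (1::'a::cstar_algebra_1))"

lemma cpeval_map_of_real: "cpeval (map_poly complex_of_real p) a = rpeval p a"
  by (simp add: peval_def degree_map_poly coeff_map_poly)

text \<open>The half of spectral mapping that norm bounds require. A root \<open>z\<close> of
  \<open>q\<close> splits off; either the cofactor of smaller degree is singular as well, or the
  linear factor is, and then \<open>z\<close> is a spectral value.\<close>

lemma cpeval_singular:
  fixes a :: "'a::cstar_algebra_1"
  assumes "uspec a \<noteq> {}" "\<not> (\<exists>y. inverse_of (cpeval q a) y)"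
  shows "\<exists>z\<in>uspec a. poly q z = 0"
  using assms(2)
proof (induction "degree q" arbitrary: q)
  case 0
  obtain c where c: "q = [:c:]" using 0(1) degree_eq_zeroE[of q] by metis
  have "c = 0"
  proof (rule ccontr)
    assume "c \<noteq> 0"
    moreover have "inverse_of (1::'a) 1" by (simp add: inverse_of_def)
    ultimately have "inverse_of (c *\<^sub>C (1::'a)) (inverse c *\<^sub>C 1)" using inverse_of_scaleC by blast
    with 0(2) show False by (auto simp: c complex_eval.peval_const)
  qed
  then show ?case using assms(1) c by auto
next
  case (Suc n)
  then have "\<not> constant (poly q)" by (simp add: constant_degree)
  then obtain z where z: "poly q z = 0" using fundamental_theorem_of_algebra by blast
  then obtain r where r: "q = [:- z, 1:] * r" by (auto simp: poly_eq_0_iff_dvd elim: dvdE)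
  have "q \<noteq> 0" using Suc(2) by auto
  then have "r \<noteq> 0" using r by auto
  then have n: "n = degree r" using Suc(2) unfolding r by (subst (asm) degree_mult_eq) auto
  have e: "cpeval q a = - (z *\<^sub>C 1 - a) * cpeval r a"
    unfolding r complex_eval.peval_mult
    by (simp add: complex_eval.peval_pCons complex_eval.peval_0)
  show ?case
  proof (cases "\<exists>y. inverse_of (cpeval r a) y")
    case False
    from Suc(1)[OF n this] show ?thesis unfolding r by auto
  next
    case True
    then obtain y where y: "inverse_of (cpeval r a) y" by blast
    have "z \<in> uspec a"
    proof (rule ccontr)
      assume "z \<notin> uspec a"
      then obtain w where "inverse_of (z *\<^sub>C 1 - a) w" by (auto simp: uspec_def)
      then obtain v where "inverse_of (- (z *\<^sub>C 1 - a)) v" using ex_inverse_of_minus by blast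
      from inverse_of_mult[OF this y] Suc.prems show False unfolding e by blast
    qed
    then show ?thesis using z by blast
  qed
qed

lemma star_rpeval: "a\<^sup>\<star> = a \<Longrightarrow> (rpeval p a)\<^sup>\<star> = rpeval p a"
proof (induction p)
  case (pCons c p)
  have "a * rpeval p a = rpeval p a * a" by (rule real_eval.peval_intertwine) simp
  with pCons show ?case
    by (simp add: real_eval.peval_pCons star_add star_mult)
qed (simp add: real_eval.peval_0)

text \<open>The norm of \<open>rpeval p a\<close> is the modulus of one of its spectral values, and
  spectral mapping makes that a value of \<open>p\<close> on \<open>rspec a\<close>. Uniform
  convergence on the spectrum thus forces convergence at \<open>a\<close>, on which the calculus
  rests.\<close>

lemma norm_rpeval_le:
  fixes a :: "'a::cstar_algebra_1"
  assumes a: "a\<^sup>\<star> = a" and B: "\<And>t. t \<in> rspec a \<Longrightarrow> \<bar>poly p t\<bar> \<le> B"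
  shows "norm (rpeval p a) \<le> B"
proof -
  obtain l where l: "l \<in> uspec (rpeval p a)" "cmod l = norm (rpeval p a)"
    using selfadjoint_spec_norm[OF star_rpeval[OF a]] by blast
  define q where "q = map_poly complex_of_real p - [:l:]"
  have "cpeval q a = - (l *\<^sub>C 1 - rpeval p a)"
    by (simp add: q_def complex_eval.peval_diff cpeval_map_of_real complex_eval.peval_const)
  then have "\<not> (\<exists>y. inverse_of (cpeval q a) y)"
    using l(1) by (simp only: uspec_def ex_inverse_of_minus mem_Collect_eq not_False_eq_True)
  moreover have "uspec a \<noteq> {}" using selfadjoint_spec_norm[OF a] by blast
  ultimately obtain z where z: "z \<in> uspec a" "poly q z = 0" using cpeval_singular by blast
  then obtain t where t: "t \<in> rspec a" "z = complex_of_real t"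
    using uspec_selfadjoint[OF a] by blast
  have "poly (map_poly complex_of_real p) (complex_of_real t) = complex_of_real (poly p t)"
    by (induction p) (simp_all add: map_poly_pCons)
  then have "l = complex_of_real (poly p t)" using z t by (simp add: q_def)
  then show ?thesis using l(2) B[OF t(1)] by simp
qed

subsection \<open>Continuous functional calculus\<close>

lemma polynomial_approximation:
  fixes f :: "real \<Rightarrow> real"
  assumes "compact K" "continuous_on K f"
  shows "\<exists>p. uniform_limit K (\<lambda>n. poly (p n)) f sequentially"
proof -
  have "\<exists>p. \<forall>t\<in>K. \<bar>f t - poly p t\<bar> < 1 / real (Suc n)" for n
  proof -
    obtain g where g: "real_polynomial_function g" "\<And>x. x \<in> K \<Longrightarrow> \<bar>f x - g x\<bar> < 1 / real (Suc n)"
      using Stone_Weierstrass_real_polynomial_function[OF assms, of "1 / real (Suc n)"] by auto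
    from g(1) obtain c m where "g = (\<lambda>x. \<Sum>i\<le>m. c i * x ^ i)"
      unfolding real_polynomial_function_iff_sum by blast
    then have "g = poly (\<Sum>i\<le>m. monom (c i) i)" by (simp add: poly_sum poly_monom fun_eq_iff)
    then show ?thesis using g(2) by metis
  qed
  then obtain p where p: "\<And>n t. t \<in> K \<Longrightarrow> \<bar>f t - poly (p n) t\<bar> < 1 / real (Suc n)" by metis
  have "uniform_limit K (\<lambda>n. poly (p n)) f sequentially"
    unfolding uniform_limit_sequentially_iff
  proof (intro allI impI)
    fix e :: real assume "e > 0"
    then obtain N where N: "1 / real (Suc N) < e" using nat_approx_posE by blast
    have "dist (poly (p n) t) (f t) < e" if "n \<ge> N" "t \<in> K" for n t
    proof -
      have "1 / real (Suc n) \<le> 1 / real (Suc N)" using that(1) by (simp add: frac_le)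
      then show ?thesis using p[OF that(2), of n] N by (simp add: dist_real_def)
    qed
    then show "\<exists>N. \<forall>n\<ge>N. \<forall>t\<in>K. dist (poly (p n) t) (f t) < e" by blast
  qed
  then show ?thesis by blast
qed

text \<open>For self-adjoint \<open>a\<close> the choice is immaterial: by
  \<open>cfc_tendsto\<close> every uniformly approximating sequence of polynomials has this
  limit.\<close>

definition cfc :: "(real \<Rightarrow> real) \<Rightarrow> 'a::cstar_algebra_1 \<Rightarrow> 'a" where
  "cfc f a = lim (\<lambda>n. rpeval
     ((SOME p. uniform_limit (rspec a) (\<lambda>n. poly (p n)) f sequentially) n) a)"

lemma cfc_tendsto:
  fixes a :: "'a::cstar_algebra_1"
  assumes a: "a\<^sup>\<star> = a" and p: "uniform_limit (rspec a) (\<lambda>n. poly (p n)) f sequentially"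
  shows "(\<lambda>n. rpeval (p n) a) \<longlonglongrightarrow> cfc f a"
proof -
  define q where "q = (SOME p. uniform_limit (rspec a) (\<lambda>n. poly (p n)) f sequentially)"
  have q: "uniform_limit (rspec a) (\<lambda>n. poly (q n)) f sequentially"
    unfolding q_def
    by (rule someI[where P = "\<lambda>p. uniform_limit (rspec a) (\<lambda>n. poly (p n)) f sequentially", OF p])
  have close: "\<exists>N. \<forall>m\<ge>N. \<forall>n\<ge>N. norm (rpeval (r m) a - rpeval (q n) a) < e"
    if r: "uniform_limit (rspec a) (\<lambda>n. poly (r n)) f sequentially" and e: "e > 0" for r e
  proof -
    have e3: "e / 3 > 0" using e by simp
    obtain N1 where N1: "\<And>n t. n \<ge> N1 \<Longrightarrow> t \<in> rspec a \<Longrightarrow> dist (poly (r n) t) (f t) < e / 3"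
      using r e3 unfolding uniform_limit_sequentially_iff by meson
    obtain N2 where N2: "\<And>n t. n \<ge> N2 \<Longrightarrow> t \<in> rspec a \<Longrightarrow> dist (poly (q n) t) (f t) < e / 3"
      using q e3 unfolding uniform_limit_sequentially_iff by meson
    have "norm (rpeval (r m) a - rpeval (q n) a) < e" if "m \<ge> max N1 N2" "n \<ge> max N1 N2" for m n
    proof -
      have "norm (rpeval (r m - q n) a) \<le> 2 * (e / 3)"
      proof (rule norm_rpeval_le[OF a])
        fix t assume t: "t \<in> rspec a"
        show "\<bar>poly (r m - q n) t\<bar> \<le> 2 * (e / 3)"
          using N1[OF _ t, of m] N2[OF _ t, of n] that
          unfolding dist_real_def poly_diff by linarith
      qed
      then show ?thesis using e by (simp add: real_eval.peval_diff)
    qed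
    then show ?thesis by blast
  qed
  have "Cauchy (\<lambda>n. rpeval (q n) a)"
    unfolding Cauchy_iff using close[OF q] by blast
  then have l: "(\<lambda>n. rpeval (q n) a) \<longlonglongrightarrow> cfc f a"
    unfolding cfc_def q_def[symmetric] by (simp add: Cauchy_convergent_iff convergent_LIMSEQ_iff)
  have "(\<lambda>n. rpeval (p n) a - rpeval (q n) a) \<longlonglongrightarrow> 0"
    unfolding LIMSEQ_iff using close[OF p] by simp blast
  from tendsto_add[OF this l] show ?thesis by simp
qed

lemma cfc_poly: "a\<^sup>\<star> = a \<Longrightarrow> cfc (poly p) a = rpeval p a"
  using cfc_tendsto[of a "\<lambda>_. p" "poly p"] LIMSEQ_unique[OF _ tendsto_const]
  by (auto simp: uniform_limit_const)

lemma cfc_const: "a\<^sup>\<star> = a \<Longrightarrow> cfc (\<lambda>_. c) a = of_real c"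
proof -
  have "poly [:c:] = (\<lambda>_. c)" by (simp add: fun_eq_iff)
  then show "a\<^sup>\<star> = a \<Longrightarrow> ?thesis" using cfc_poly[of a "[:c:]"] by (simp add: real_eval.peval_const)
qed

lemma cfc_ident: "a\<^sup>\<star> = a \<Longrightarrow> cfc (\<lambda>t. t) a = a"
proof -
  have "poly [:0, 1:] = (\<lambda>t::real. t)" by (simp add: fun_eq_iff)
  then show "a\<^sup>\<star> = a \<Longrightarrow> ?thesis"
    using cfc_poly[of a "[:0, 1:]"] by (simp add: real_eval.peval_pCons real_eval.peval_0)
qed

lemma cfc_cong:
  assumes "a\<^sup>\<star> = a" "continuous_on (rspec a) f" "\<And>t. t \<in> rspec a \<Longrightarrow> f t = g t"
  shows "cfc f a = cfc g a"
proof -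
  obtain p where p: "uniform_limit (rspec a) (\<lambda>n. poly (p n)) f sequentially"
    using polynomial_approximation[OF compact_rspec assms(2)] by blast
  then have "uniform_limit (rspec a) (\<lambda>n. poly (p n)) g sequentially"
    by (rule uniform_limit_cong'[THEN iffD1, rotated 2]) (use assms(3) in auto)
  then show ?thesis using cfc_tendsto[OF assms(1)] p LIMSEQ_unique by blast
qed

lemma cfc_add:
  assumes a: "a\<^sup>\<star> = a" and f: "continuous_on (rspec a) f" "continuous_on (rspec a) g"
  shows "cfc (\<lambda>t. f t + g t) a = cfc f a + cfc g a"
proof -
  obtain p q where p: "uniform_limit (rspec a) (\<lambda>n. poly (p n)) f sequentially"
    and q: "uniform_limit (rspec a) (\<lambda>n. poly (q n)) g sequentially"
    using polynomial_approximation[OF compact_rspec f(1)]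
      polynomial_approximation[OF compact_rspec f(2)] by blast
  have "uniform_limit (rspec a) (\<lambda>n. poly (p n + q n)) (\<lambda>t. f t + g t) sequentially"
    using uniform_limit_add[OF p q] unfolding poly_add[abs_def] .
  from cfc_tendsto[OF a this] tendsto_add[OF cfc_tendsto[OF a p] cfc_tendsto[OF a q]]
  show ?thesis by (simp add: real_eval.peval_add LIMSEQ_unique)
qed

lemma cfc_mult:
  assumes a: "a\<^sup>\<star> = a" and f: "continuous_on (rspec a) f" "continuous_on (rspec a) g"
  shows "cfc (\<lambda>t. f t * g t) a = cfc f a * cfc g a"
proof -
  obtain p q where p: "uniform_limit (rspec a) (\<lambda>n. poly (p n)) f sequentially"
    and q: "uniform_limit (rspec a) (\<lambda>n. poly (q n)) g sequentially"
    using polynomial_approximation[OF compact_rspec f(1)]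
      polynomial_approximation[OF compact_rspec f(2)] by blast
  have "bounded (f ` rspec a)" "bounded (g ` rspec a)"
    using f by (auto intro!: compact_imp_bounded compact_continuous_image compact_rspec)
  then have "uniform_limit (rspec a) (\<lambda>n. poly (p n * q n)) (\<lambda>t. f t * g t) sequentially"
    using uniform_lim_mult[OF p q] unfolding poly_mult[abs_def] by blast
  from cfc_tendsto[OF a this] tendsto_mult[OF cfc_tendsto[OF a p] cfc_tendsto[OF a q]]
  show ?thesis by (simp add: real_eval.peval_mult LIMSEQ_unique)
qed

lemma cfc_cmult:
  assumes a: "a\<^sup>\<star> = a" and f: "continuous_on (rspec a) f"
  shows "cfc (\<lambda>t. c * f t) a = c *\<^sub>R cfc f a"
  using cfc_mult[OF a continuous_on_const f, of c] cfc_const[OF a, of c]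
  by (simp add: scaleR_conv_of_real)

lemma cfc_diff:
  assumes a: "a\<^sup>\<star> = a" and f: "continuous_on (rspec a) f" "continuous_on (rspec a) g"
  shows "cfc (\<lambda>t. f t - g t) a = cfc f a - cfc g a"
  using cfc_add[OF a f(1), of "\<lambda>t. (-1) * g t"] cfc_cmult[OF a f(2), of "-1"] f(2)
  by (simp add: continuous_on_minus)

lemma cfc_star:
  assumes a: "a\<^sup>\<star> = a" and f: "continuous_on (rspec a) f"
  shows "(cfc f a)\<^sup>\<star> = cfc f a"
proof -
  obtain p where p: "uniform_limit (rspec a) (\<lambda>n. poly (p n)) f sequentially"
    using polynomial_approximation[OF compact_rspec f] by blast
  from tendsto_star[OF cfc_tendsto[OF a p]] cfc_tendsto[OF a p] show ?thesis
    by (simp add: star_rpeval[OF a] LIMSEQ_unique)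
qed

text \<open>The same polynomials approximate \<open>f\<close> on both spectra, and intertwining
  passes to polynomials and then to limits.\<close>

lemma cfc_intertwine:
  assumes a: "a\<^sup>\<star> = a" "b\<^sup>\<star> = b" and f: "continuous_on (rspec a \<union> rspec b) f"
    and x: "x * a = b * x"
  shows "x * cfc f a = cfc f b * x"
proof -
  obtain p where p: "uniform_limit (rspec a \<union> rspec b) (\<lambda>n. poly (p n)) f sequentially"
    using polynomial_approximation[OF compact_Un[OF compact_rspec compact_rspec] f] by blast
  have pa: "uniform_limit (rspec a) (\<lambda>n. poly (p n)) f sequentially"
   and pb: "uniform_limit (rspec b) (\<lambda>n. poly (p n)) f sequentially"
    using uniform_limit_on_subset[OF p] by auto
  have e: "x * rpeval (p n) a = rpeval (p n) b * x" for n
    by (rule real_eval.peval_intertwine[OF x])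
  have "(\<lambda>n. x * rpeval (p n) a) \<longlonglongrightarrow> x * cfc f a"
    by (intro tendsto_intros cfc_tendsto[OF a(1) pa])
  moreover have "(\<lambda>n. rpeval (p n) b * x) \<longlonglongrightarrow> cfc f b * x"
    by (intro tendsto_intros cfc_tendsto[OF a(2) pb])
  ultimately show ?thesis by (simp add: e LIMSEQ_unique)
qed

lemma norm_cfc_le:
  assumes a: "a\<^sup>\<star> = a" and f: "continuous_on (rspec a) f"
    and B: "\<And>t. t \<in> rspec a \<Longrightarrow> \<bar>f t\<bar> \<le> B"
  shows "norm (cfc f a) \<le> B"
proof -
  obtain p where p: "uniform_limit (rspec a) (\<lambda>n. poly (p n)) f sequentially"
    using polynomial_approximation[OF compact_rspec f] by blast
  show ?thesis
  proof (rule field_le_epsilon)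
    fix e :: real assume e: "e > 0"
    obtain N where N: "\<And>n t. n \<ge> N \<Longrightarrow> t \<in> rspec a \<Longrightarrow> dist (poly (p n) t) (f t) < e"
      using p e unfolding uniform_limit_sequentially_iff by meson
    have "norm (rpeval (p n) a) \<le> B + e" if "n \<ge> N" for n
    proof (rule norm_rpeval_le[OF a])
      fix t assume t: "t \<in> rspec a"
      show "\<bar>poly (p n) t\<bar> \<le> B + e" using N[OF that t] B[OF t] by (simp add: dist_real_def)
    qed
    then show "norm (cfc f a) \<le> B + e"
      by (intro tendsto_upperbound[OF tendsto_norm[OF cfc_tendsto[OF a p]]])
        (auto simp: eventually_sequentially)
  qed
qed

lemma rspec_cfc:
  assumes a: "a\<^sup>\<star> = a" and f: "continuous_on (rspec a) f"
  shows "rspec (cfc f a) \<subseteq> f ` rspec a"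
proof
  fix s assume s: "s \<in> rspec (cfc f a)"
  show "s \<in> f ` rspec a"
  proof (rule ccontr)
    assume ns: "s \<notin> f ` rspec a"
    \<comment> \<open>Off the image of \<open>f\<close>, the function \<open>s - f t\<close> has a
      continuous reciprocal on the spectrum, whose value at \<open>a\<close> is the desired
      inverse.\<close>
    define g where "g = (\<lambda>t. inverse (s - f t))"
    have g: "continuous_on (rspec a) g" and sf: "continuous_on (rspec a) (\<lambda>t. s - f t)"
      unfolding g_def using ns by (auto intro!: continuous_intros f)
    have 1: "cfc (\<lambda>t. s - f t) a = of_real s - cfc f a"
      by (simp add: cfc_diff[OF a] cfc_const[OF a] f)
    have 2: "cfc (\<lambda>t. (s - f t) * g t) a = 1"
    proof -
      have "(s - f t) * g t = 1" if "t \<in> rspec a" for t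
        using ns that by (auto simp: g_def image_iff)
      then have "cfc (\<lambda>t. (s - f t) * g t) a = cfc (\<lambda>_. 1) a"
        by (rule cfc_cong[OF a continuous_on_mult[OF sf g]])
      then show ?thesis using cfc_const[OF a, of 1] by simp
    qed
    have 3: "cfc (\<lambda>t. g t * (s - f t)) a = 1" using 2 by (simp add: mult.commute)
    have "inverse_of (of_real s - cfc f a) (cfc g a)"
      using cfc_mult[OF a sf g] cfc_mult[OF a g sf] 1 2 3 by (simp add: inverse_of_def)
    then show False using s by (auto simp: rspec_def uspec_def)
  qed
qed

text \<open>For polynomial \<open>g\<close> this is multiplicativity. In general polynomials
  approximate \<open>g\<close> on the compact image of \<open>f\<close>, and
  \<open>norm_cfc_le\<close> carries the error over.\<close>

lemma cfc_compose:
  fixes a :: "'a::cstar_algebra_1"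
  assumes a: "a\<^sup>\<star> = a" and f: "continuous_on (rspec a) f" and g: "continuous_on (f ` rspec a) g"
  shows "cfc g (cfc f a) = cfc (\<lambda>t. g (f t)) a"
proof -
  have c: "compact (f ` rspec a)" by (rule compact_continuous_image[OF f compact_rspec])
  obtain p where p: "uniform_limit (f ` rspec a) (\<lambda>n. poly (p n)) g sequentially"
    using polynomial_approximation[OF c g] by blast
  have pf: "continuous_on (rspec a) (\<lambda>t. poly q (f t))" for q
    by (intro continuous_intros f)
  have q: "rpeval q (cfc f a) = cfc (\<lambda>t. poly q (f t)) a" for q
  proof (induction q)
    case 0 then show ?case by (simp add: real_eval.peval_0 cfc_const[OF a])
  next
    case (pCons c q)
    have m: "continuous_on (rspec a) (\<lambda>t. f t * poly q (f t))" by (intro continuous_intros f)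
    show ?case
      using cfc_add[OF a continuous_on_const m, of c] cfc_mult[OF a f pf[of q]] pCons
      by (simp add: real_eval.peval_pCons cfc_const[OF a] scaleR_conv_of_real)
  qed
  have "(\<lambda>n. rpeval (p n) (cfc f a)) \<longlonglongrightarrow> cfc g (cfc f a)"
    by (rule cfc_tendsto[OF cfc_star[OF a f] uniform_limit_on_subset[OF p rspec_cfc[OF a f]]])
  moreover have "(\<lambda>n. rpeval (p n) (cfc f a)) \<longlonglongrightarrow> cfc (\<lambda>t. g (f t)) a"
    unfolding LIMSEQ_def q
  proof (intro allI impI)
    fix e :: real assume e: "e > 0"
    then have "e / 2 > 0" by simp
    then obtain N where N: "\<And>n t. n \<ge> N \<Longrightarrow> t \<in> f ` rspec a \<Longrightarrow> dist (poly (p n) t) (g t) < e / 2"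
      using p unfolding uniform_limit_sequentially_iff by meson
    have gf: "continuous_on (rspec a) (\<lambda>t. g (f t))" using continuous_on_compose2[OF g f] by simp
    have "dist (cfc (\<lambda>t. poly (p n) (f t)) a) (cfc (\<lambda>t. g (f t)) a) < e" if n: "n \<ge> N" for n
    proof -
      have "norm (cfc (\<lambda>t. poly (p n) (f t) - g (f t)) a) \<le> e / 2"
      proof (rule norm_cfc_le[OF a])
        show "continuous_on (rspec a) (\<lambda>t. poly (p n) (f t) - g (f t))"
          by (intro continuous_intros pf gf f)
        show "\<bar>poly (p n) (f t) - g (f t)\<bar> \<le> e / 2" if "t \<in> rspec a" for t
          using N[OF n, of "f t"] that by (auto simp: dist_real_def less_imp_le)
      qed
      then show ?thesis using e by (simp add: cfc_diff[OF a pf gf] dist_norm)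
    qed
    then show "\<exists>N. \<forall>n\<ge>N. dist (cfc (\<lambda>t. poly (p n) (f t)) a) (cfc (\<lambda>t. g (f t)) a) < e" by blast
  qed
  ultimately show ?thesis by (rule LIMSEQ_unique)
qed

subsection \<open>Positivity in unital C*-algebras\<close>

definition upos :: "'a::cstar_algebra_1 set" where
  "upos = {a. a\<^sup>\<star> = a \<and> uspec a \<subseteq> \<real>\<^sub>\<ge>\<^sub>0}"

definition ule :: "'a::cstar_algebra_1 \<Rightarrow> 'a \<Rightarrow> bool" (infix "\<preceq>" 50) where
  "a \<preceq> b \<longleftrightarrow> b - a \<in> upos"

lemma upos_iff: "a \<in> upos \<longleftrightarrow> a\<^sup>\<star> = a \<and> rspec a \<subseteq> {0..}"
proof (cases "a\<^sup>\<star> = a")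
  case True
  show ?thesis
    by (simp add: upos_def True uspec_selfadjoint[OF True] image_subset_iff) auto
qed (simp add: upos_def)

lemma upos_star: "a \<in> upos \<Longrightarrow> a\<^sup>\<star> = a"
  by (simp add: upos_iff)

lemma upos_rspec: "a \<in> upos \<Longrightarrow> t \<in> rspec a \<Longrightarrow> 0 \<le> t"
  by (auto simp: upos_iff)

lemma rspec_norm_le: "t \<in> rspec a \<Longrightarrow> \<bar>t\<bar> \<le> norm a"
  using uspec_norm_le[of "complex_of_real t" a] by (simp add: rspec_def)

lemma rspec_reflect: "t \<in> rspec a \<Longrightarrow> r - t \<in> rspec (of_real r - a)"
proof -
  have "complex_of_real (r - t) *\<^sub>C 1 - (of_real r - a) = - (complex_of_real t *\<^sub>C 1 - a)"
    by (simp only: scaleC_of_real_one) simp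
  then show "t \<in> rspec a \<Longrightarrow> ?thesis"
    unfolding rspec_def uspec_def mem_Collect_eq by (simp only: ex_inverse_of_minus not_False_eq_True)
qed

lemma upos_norm_diff: "a \<in> upos \<Longrightarrow> norm a \<le> r \<Longrightarrow> norm (of_real r - a) \<le> r"
proof -
  assume a: "a \<in> upos" "norm a \<le> r"
  have sa: "a\<^sup>\<star> = a" using a by (simp add: upos_star)
  have "norm (cfc (\<lambda>t. r - t) a) \<le> r"
  proof (rule norm_cfc_le[OF sa])
    show "continuous_on (rspec a) (\<lambda>t. r - t)" by (intro continuous_intros)
    show "\<bar>r - t\<bar> \<le> r" if "t \<in> rspec a" for t
      using rspec_norm_le[OF that] upos_rspec[OF a(1) that] a(2) by simp
  qed
  then show ?thesis
    by (simp add: cfc_diff[OF sa] cfc_const[OF sa] cfc_ident[OF sa] continuous_intros)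
qed

text \<open>A spectral value \<open>t\<close> of \<open>a\<close> gives the value
  \<open>r - t\<close> of \<open>of_real r - a\<close>, so \<open>\<bar>r - t\<bar> \<le> r\<close>.
  With \<open>upos_norm_diff\<close>, positivity becomes a norm inequality, and closure under sums
  and limits is the triangle inequality and continuity.\<close>

lemma norm_diff_upos:
  assumes a: "a\<^sup>\<star> = a" and r: "norm (of_real r - a) \<le> r"
  shows "a \<in> upos"
  using rspec_norm_le[OF rspec_reflect[of _ a r]] r by (force simp: upos_iff a)

lemma upos_add: "a \<in> upos \<Longrightarrow> b \<in> upos \<Longrightarrow> a + b \<in> upos"
proof (rule norm_diff_upos[where r = "norm a + norm b"])
  assume a: "a \<in> upos" and b: "b \<in> upos"
  show "(a + b)\<^sup>\<star> = a + b" using a b by (simp add: star_add upos_star)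
  have "norm ((of_real (norm a) - a) + (of_real (norm b) - b)) \<le> norm a + norm b"
    using upos_norm_diff[OF a, of "norm a"] upos_norm_diff[OF b, of "norm b"]
    by (intro norm_triangle_le) simp
  then show "norm (of_real (norm a + norm b) - (a + b)) \<le> norm a + norm b"
    by (simp add: algebra_simps)
qed

lemma upos_scaleR: "a \<in> upos \<Longrightarrow> 0 \<le> c \<Longrightarrow> c *\<^sub>R a \<in> upos"
proof (rule norm_diff_upos[where r = "c * norm a"])
  assume a: "a \<in> upos" and c: "0 \<le> c"
  show "(c *\<^sub>R a)\<^sup>\<star> = c *\<^sub>R a" using a by (simp add: star_scaleR upos_star)
  have "norm (c *\<^sub>R (of_real (norm a) - a)) \<le> c * norm a"
    using upos_norm_diff[OF a, of "norm a"] c by (simp add: mult_left_mono)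
  then show "norm (of_real (c * norm a) - c *\<^sub>R a) \<le> c * norm a"
    by (simp add: right_diff_distrib scaleR_conv_of_real)
qed

lemma upos_LIMSEQ:
  assumes X: "\<And>n. X n \<in> upos" "X \<longlonglongrightarrow> x"
  shows "x \<in> upos"
proof (rule norm_diff_upos[where r = "norm x"])
  have "(\<lambda>n. (X n)\<^sup>\<star>) \<longlonglongrightarrow> x\<^sup>\<star>" by (intro tendsto_intros X)
  then show "x\<^sup>\<star> = x" using X by (simp add: upos_star LIMSEQ_unique)
  have "norm (of_real (norm (X n)) - X n) \<le> norm (X n)" for n
    by (rule upos_norm_diff[OF X(1)]) simp
  moreover have "(\<lambda>n. norm (of_real (norm (X n)) - X n)) \<longlonglongrightarrow> norm (of_real (norm x) - x)"
    by (intro tendsto_intros X)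
  moreover have "(\<lambda>n. norm (X n)) \<longlonglongrightarrow> norm x" by (intro tendsto_intros X)
  ultimately show "norm (of_real (norm x) - x) \<le> norm x" by (blast intro: LIMSEQ_le)
qed

lemma upos_0: "0 \<in> upos"
  by (rule norm_diff_upos[where r = 0]) simp_all

lemma upos_norm_le: "a \<in> upos \<Longrightarrow> of_real r - a \<in> upos \<Longrightarrow> norm a \<le> r"
proof -
  assume a: "a \<in> upos" "of_real r - a \<in> upos"
  obtain l where l: "l \<in> uspec a" "cmod l = norm a"
    using selfadjoint_spec_norm[OF upos_star[OF a(1)]] by blast
  then obtain t where t: "t \<in> rspec a" "l = complex_of_real t"
    using uspec_selfadjoint[OF upos_star[OF a(1)]] by blast
  have "0 \<le> t" "0 \<le> r - t" using upos_rspec a rspec_reflect[OF t(1)] t(1) by blast+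
  then show ?thesis using l t by simp
qed

lemma upos_antisym: "a \<in> upos \<Longrightarrow> - a \<in> upos \<Longrightarrow> a = 0"
  using upos_norm_le[of a 0] by simp

lemma cfc_upos:
  assumes "a\<^sup>\<star> = a" "continuous_on (rspec a) f" "\<And>t. t \<in> rspec a \<Longrightarrow> 0 \<le> f t"
  shows "cfc f a \<in> upos"
  using rspec_cfc[OF assms(1,2)] assms(3) by (force simp: upos_iff cfc_star[OF assms(1,2)])

lemma cfc_mono:
  assumes "a\<^sup>\<star> = a" "continuous_on (rspec a) f" "continuous_on (rspec a) g"
    "\<And>t. t \<in> rspec a \<Longrightarrow> f t \<le> g t"
  shows "cfc f a \<preceq> cfc g a"
  using cfc_upos[OF assms(1) continuous_on_diff[OF assms(3,2)]] assms(4)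
  by (simp add: ule_def cfc_diff[OF assms(1,3,2)])

lemma upos_square: "a\<^sup>\<star> = a \<Longrightarrow> a * a \<in> upos"
  using cfc_upos[of a "\<lambda>t. t * t"] cfc_mult[of a "\<lambda>t. t" "\<lambda>t. t"]
  by (simp add: cfc_ident continuous_intros)

text \<open>If \<open>u\<close> inverts \<open>l - y x\<close>, then \<open>(1 + x u y) / l\<close>
  inverts \<open>l - x y\<close>, as the geometric series suggests.\<close>

lemma uspec_mult_commute:
  fixes x y :: "'a::cstar_algebra_1"
  assumes l: "l \<in> uspec (x * y)" "l \<noteq> 0"
  shows "l \<in> uspec (y * x)"
proof (rule ccontr)
  assume "l \<notin> uspec (y * x)"
  then obtain u where u: "inverse_of (l *\<^sub>C 1 - y * x) u" by (auto simp: uspec_def)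
  have lu: "l *\<^sub>C u = 1 + y * x * u" "l *\<^sub>C u = 1 + u * (y * x)"
    using u unfolding inverse_of_def left_diff_distrib right_diff_distrib
      mult_scaleC_left mult_scaleC_right mult_1_left mult_1_right diff_eq_eq by auto
  have lx: "l *\<^sub>C (x * u * y) = x * (l *\<^sub>C u) * y"
    by (simp add: mult_scaleC_left mult_scaleC_right)
  have "inverse_of (l *\<^sub>C 1 - x * y) (inverse l *\<^sub>C (1 + x * u * y))"
  proof -
    have "(l *\<^sub>C 1 - x * y) * (1 + x * u * y) = l *\<^sub>C 1 - x * y + (l *\<^sub>C (x * u * y) - x * (y * x * u) * y)"
      by (simp add: algebra_simps mult_scaleC_left)
    also have "\<dots> = l *\<^sub>C 1" unfolding lx lu(1) by (simp add: algebra_simps)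
    finally have 1: "(l *\<^sub>C 1 - x * y) * (1 + x * u * y) = l *\<^sub>C 1" .
    have "(1 + x * u * y) * (l *\<^sub>C 1 - x * y) = l *\<^sub>C 1 - x * y + (l *\<^sub>C (x * u * y) - x * (u * (y * x)) * y)"
      by (simp add: algebra_simps mult_scaleC_right)
    also have "\<dots> = l *\<^sub>C 1" unfolding lx lu(2) by (simp add: algebra_simps)
    finally have 2: "(1 + x * u * y) * (l *\<^sub>C 1 - x * y) = l *\<^sub>C 1" .
    show ?thesis using l(2) 1 2
      by (simp add: inverse_of_def mult_scaleC_left mult_scaleC_right scaleC_scaleC)
  qed
  then show False using l(1) by (auto simp: uspec_def)
qed

lemma upos_mult_commute:
  assumes "x * y \<in> upos" "(y * x)\<^sup>\<star> = y * x"
  shows "y * x \<in> upos"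
  unfolding upos_def
proof (intro CollectI conjI subsetI assms(2))
  fix l assume "l \<in> uspec (y * x)"
  then show "l \<in> \<real>\<^sub>\<ge>\<^sub>0"
    using uspec_mult_commute[of l y x] assms(1) by (cases "l = 0") (auto simp: upos_def)
qed

text \<open>\<open>H\<close> and \<open>K\<close> are twice the real and imaginary parts of
  \<open>y\<close>, and half of \<open>H * H + K * K\<close> is
  \<open>y\<^sup>\<star> * y + y * y\<^sup>\<star>\<close>. As \<open>- y * y\<^sup>\<star>\<close>
  is positive along with \<open>- (y\<^sup>\<star> * y)\<close>, adding it makes
  \<open>y\<^sup>\<star> * y\<close> positive too, hence 0.\<close>

lemma neg_star_mult_upos:
  fixes y :: "'a::cstar_algebra_1"
  assumes y: "- (y\<^sup>\<star> * y) \<in> upos"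
  shows "y = 0"
proof -
  define H where "H = y + y\<^sup>\<star>"
  define K where "K = \<i> *\<^sub>C (y\<^sup>\<star> - y)"
  have sa: "H\<^sup>\<star> = H" "K\<^sup>\<star> = K"
    by (simp_all add: H_def K_def star_add star_star star_scaleC star_diff add.commute scaleC_diff_right)
  have "- y * y\<^sup>\<star> \<in> upos"
    by (rule upos_mult_commute) (use y in \<open>simp_all add: star_mult star_star\<close>)
  moreover have "H * H + K * K = 2 *\<^sub>R (y\<^sup>\<star> * y) + 2 *\<^sub>R (y * y\<^sup>\<star>)"
    by (simp add: H_def K_def mult_scaleC_left mult_scaleC_right scaleC_scaleC algebra_simps scaleR_2)
  ultimately have "(1/2) *\<^sub>R (H * H + K * K) + (- y * y\<^sup>\<star>) \<in> upos"
    using upos_square sa by (intro upos_add upos_scaleR) auto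
  moreover have "(1/2) *\<^sub>R (H * H + K * K) + (- y * y\<^sup>\<star>) = y\<^sup>\<star> * y"
    unfolding \<open>H * H + K * K = _\<close> by (simp add: scaleR_add_right)
  ultimately have "y\<^sup>\<star> * y = 0" using y upos_antisym by metis
  then show ?thesis by simp
qed

text \<open>Let \<open>n\<close> be the negative part of \<open>c\<close>. Then
  \<open>n * c * n\<close> is \<open>- n^3\<close>, so \<open>neg_star_mult_upos\<close> applies to
  \<open>x * n\<close> and gives \<open>x * n = 0\<close>, which kills \<open>n\<close>.\<close>

lemma star_mult_upos [simp]: "x\<^sup>\<star> * x \<in> upos"
proof -
  define c where "c = x\<^sup>\<star> * x"
  have c: "c\<^sup>\<star> = c" by (simp add: c_def star_mult star_star)
  define m where "m = (\<lambda>t::real. max (- t) 0)"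
  have mc: "continuous_on S m" for S unfolding m_def by (intro continuous_intros)
  define n where "n = cfc m c"
  have n: "n\<^sup>\<star> = n" unfolding n_def by (rule cfc_star[OF c mc])
  have "cfc (\<lambda>t. t * m t) c = cfc (\<lambda>t. (-1) * (m t * m t)) c"
    by (rule cfc_cong[OF c continuous_on_mult[OF continuous_on_id mc]]) (simp add: m_def max_def)
  then have cn: "c * n = - (n * n)"
    unfolding cfc_mult[OF c continuous_on_id mc] cfc_mult[OF c mc mc]
      cfc_cmult[OF c continuous_on_mult[OF mc mc]] cfc_ident[OF c] n_def by simp
  have nn: "n \<in> upos" unfolding n_def by (rule cfc_upos[OF c mc]) (simp add: m_def)
  have n3: "n * n * n = cfc (\<lambda>t. m t * m t * m t) c"
    by (simp add: n_def cfc_mult[OF c] mc continuous_on_mult)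
  have "(x * n)\<^sup>\<star> * (x * n) = n * (c * n)"
    by (simp add: star_mult n c_def mult.assoc)
  then have "- ((x * n)\<^sup>\<star> * (x * n)) = n * n * n" by (simp add: cn mult.assoc)
  moreover have "n * n * n \<in> upos"
    unfolding n3 by (rule cfc_upos[OF c]) (auto intro!: continuous_intros mc simp: m_def)
  ultimately have "x * n = 0" using neg_star_mult_upos by metis
  then have "c * n = 0" by (simp add: c_def mult.assoc)
  then have "n\<^sup>\<star> * n = 0" using cn n by simp
  then have n0: "cfc m c = 0" unfolding n_def[symmetric] by simp
  have "cfc (\<lambda>t. t + m t) c \<in> upos"
    by (rule cfc_upos[OF c continuous_on_add[OF continuous_on_id mc]]) (simp add: m_def max_def)
  then show ?thesis
    by (simp add: cfc_add[OF c] mc continuous_on_id cfc_ident[OF c] n0 flip: c_def)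
qed

lemma mult_star_upos [simp]: "x * x\<^sup>\<star> \<in> upos"
  using star_mult_upos[of "x\<^sup>\<star>"] by (simp only: star_star)

lemma upos_sqrt:
  assumes "a \<in> upos" shows "\<exists>s\<in>upos. s * s = a"
proof
  have a: "a\<^sup>\<star> = a" by (rule upos_star[OF assms])
  have q: "continuous_on (rspec a) sqrt" by (intro continuous_intros)
  have "cfc (\<lambda>t. sqrt t * sqrt t) a = cfc (\<lambda>t. t) a"
    by (rule cfc_cong[OF a continuous_on_mult[OF q q]]) (use upos_rspec[OF assms] in auto)
  then show "cfc sqrt a * cfc sqrt a = a"
    unfolding cfc_mult[OF a q q] cfc_ident[OF a] .
  show "cfc sqrt a \<in> upos"
    by (rule cfc_upos[OF a]) (auto intro!: continuous_intros simp: upos_rspec[OF assms])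
qed

lemma upos_conj: assumes "a \<in> upos" shows "x\<^sup>\<star> * a * x \<in> upos"
proof -
  obtain s where s: "s \<in> upos" "s * s = a" using upos_sqrt[OF assms] by blast
  have "x\<^sup>\<star> * a * x = (s * x)\<^sup>\<star> * (s * x)"
    by (simp add: star_mult upos_star[OF s(1)] mult.assoc flip: s(2))
  then show ?thesis by simp
qed

lemma ule_conj: "a \<preceq> b \<Longrightarrow> x\<^sup>\<star> * a * x \<preceq> x\<^sup>\<star> * b * x"
  using upos_conj[of "b - a" x] by (simp add: ule_def left_diff_distrib right_diff_distrib)

lemma ule_conj': "a \<preceq> b \<Longrightarrow> x * a * x\<^sup>\<star> \<preceq> x * b * x\<^sup>\<star>"
  using ule_conj[of a b "x\<^sup>\<star>"] by (simp add: star_star)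

lemma ule_conj_sa: "a \<preceq> b \<Longrightarrow> x\<^sup>\<star> = x \<Longrightarrow> x * a * x \<preceq> x * b * x"
  using ule_conj[of a b x] by simp

lemma ule_refl [simp]: "a \<preceq> a"
  by (simp add: ule_def upos_0)

lemma ule_trans [trans]: "a \<preceq> b \<Longrightarrow> b \<preceq> c \<Longrightarrow> a \<preceq> c"
  using upos_add[of "b - a" "c - b"] by (simp add: ule_def)

lemma ule_add: "a \<preceq> b \<Longrightarrow> c \<preceq> d \<Longrightarrow> a + c \<preceq> b + d"
  using upos_add[of "b - a" "d - c"] by (simp add: ule_def algebra_simps)

lemma ule_scaleR: "a \<preceq> b \<Longrightarrow> 0 \<le> r \<Longrightarrow> r *\<^sub>R a \<preceq> r *\<^sub>R b"
  using upos_scaleR[of "b - a" r] by (simp add: ule_def scaleR_right_diff_distrib)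

lemma upos_ule_trans: "a \<in> upos \<Longrightarrow> a \<preceq> b \<Longrightarrow> b \<in> upos"
  using upos_add[of a "b - a"] by (simp add: ule_def)

lemma ule_norm: "a \<in> upos \<Longrightarrow> a \<preceq> of_real (norm a)"
proof -
  assume a: "a \<in> upos"
  have "cfc (\<lambda>t. t) a \<preceq> cfc (\<lambda>_. norm a) a"
    by (rule cfc_mono[OF upos_star[OF a]])
      (auto intro!: continuous_intros dest: rspec_norm_le simp: abs_le_iff)
  then show ?thesis by (simp add: cfc_ident[OF upos_star[OF a]] cfc_const[OF upos_star[OF a]])
qed

lemma norm_mono: "a \<in> upos \<Longrightarrow> a \<preceq> b \<Longrightarrow> norm a \<le> norm b"
  using upos_norm_le[of a "norm b"] ule_trans[OF _ ule_norm[OF upos_ule_trans]]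
  by (auto simp: ule_def)

lemma ule_LIMSEQ:
  "(\<And>n. X n \<preceq> b) \<Longrightarrow> X \<longlonglongrightarrow> a \<Longrightarrow> a \<preceq> b"
  unfolding ule_def by (rule upos_LIMSEQ[of "\<lambda>n. b - X n"]) (auto intro!: tendsto_intros)

text \<open>The archimedean property of the order, by which the regularisations below are removed;
  \<open>w\<close> must not depend on \<open>e\<close>.\<close>

lemma ule_epsilon:
  assumes "\<And>e. e > 0 \<Longrightarrow> a \<preceq> b + e *\<^sub>R w"
  shows "a \<preceq> b"
  unfolding ule_def
proof (rule upos_LIMSEQ)
  show "b + (1 / real (Suc n)) *\<^sub>R w - a \<in> upos" for n
    using assms[of "1 / real (Suc n)"] by (simp add: ule_def)
  have "(\<lambda>n. b + (1 / real (Suc n)) *\<^sub>R w - a) \<longlonglongrightarrow> b + 0 *\<^sub>R w - a"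
    using LIMSEQ_Suc[OF lim_1_over_n] by (intro tendsto_intros) (simp add: add.commute)
  then show "(\<lambda>n. b + (1 / real (Suc n)) *\<^sub>R w - a) \<longlonglongrightarrow> b - a" by simp
qed

subsection \<open>Powers of positive elements\<close>

text \<open>As \<open>0 powr s = 0\<close> for every \<open>s\<close>, even for
  \<open>s = 0\<close>, continuity on a spectrum containing 0 is guaranteed only for
  \<open>s > 0\<close>. Hence the recurring hypothesis
  \<open>0 < s \<or> 0 \<notin> rspec a\<close>.\<close>

definition upowr :: "'a::cstar_algebra_1 \<Rightarrow> real \<Rightarrow> 'a" where
  "upowr a s = cfc (\<lambda>t. t powr s) a"

lemma continuous_powr:
  "a \<in> upos \<Longrightarrow> 0 < s \<or> 0 \<notin> rspec a \<Longrightarrow> continuous_on (rspec a) (\<lambda>t. t powr s)"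
  by (rule continuous_on_powr') (auto intro!: continuous_intros dest: upos_rspec)

lemma upowr_star: "a \<in> upos \<Longrightarrow> 0 < s \<or> 0 \<notin> rspec a \<Longrightarrow> (upowr a s)\<^sup>\<star> = upowr a s"
  unfolding upowr_def by (rule cfc_star[OF upos_star continuous_powr])

lemma upowr_upos: "a \<in> upos \<Longrightarrow> 0 < s \<or> 0 \<notin> rspec a \<Longrightarrow> upowr a s \<in> upos"
  unfolding upowr_def by (rule cfc_upos[OF upos_star continuous_powr]) auto

lemma upowr_add:
  assumes "a \<in> upos" "0 < s \<or> 0 \<notin> rspec a" "0 < t \<or> 0 \<notin> rspec a"
  shows "upowr a s * upowr a t = upowr a (s + t)"
  using cfc_mult[OF upos_star continuous_powr continuous_powr, of a s t] assms
  by (simp add: upowr_def powr_add)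

lemma upowr_1: "a \<in> upos \<Longrightarrow> upowr a 1 = a"
  unfolding upowr_def
  using cfc_cong[OF upos_star continuous_powr, of a 1 "\<lambda>t. t"] upos_rspec[of a]
  by (simp add: cfc_ident[OF upos_star])

lemma upowr_0:
  assumes "a \<in> upos" "0 \<notin> rspec a" shows "upowr a 0 = 1"
proof -
  have "cfc (\<lambda>t. t powr 0) a = cfc (\<lambda>_. 1) a"
    by (rule cfc_cong[OF upos_star continuous_powr]) (use assms in \<open>auto simp: powr_def\<close>)
  then show ?thesis unfolding upowr_def by (simp add: cfc_const upos_star assms)
qed

lemma upowr_powr:
  assumes "a \<in> upos" "0 < s" "0 < t"
  shows "upowr (upowr a s) t = upowr a (s * t)"
proof -
  have "continuous_on ((\<lambda>u. u powr s) ` rspec a) (\<lambda>u. u powr t)"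
    by (rule continuous_on_powr') (use assms(3) in \<open>auto intro!: continuous_intros\<close>)
  then show ?thesis
    unfolding upowr_def using assms
    by (subst cfc_compose[OF upos_star continuous_powr]) (auto simp: powr_powr)
qed

lemma upowr_mono_exp:
  assumes "a \<in> upos" "0 < s" "s \<le> t"
  shows "upowr a t \<preceq> (norm a powr (t - s)) *\<^sub>R upowr a s"
proof -
  have "u powr t \<le> norm a powr (t - s) * u powr s" if "u \<in> rspec a" for u
  proof -
    have u: "0 \<le> u" "u \<le> norm a" using upos_rspec[OF assms(1) that] rspec_norm_le[OF that] by auto
    have "u powr t = u powr (t - s) * u powr s" by (simp flip: powr_add)
    also have "\<dots> \<le> norm a powr (t - s) * u powr s"
      using u assms by (intro mult_right_mono powr_mono2) auto
    finally show ?thesis .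
  qed
  then have "cfc (\<lambda>u. u powr t) a \<preceq> cfc (\<lambda>u. norm a powr (t - s) * u powr s) a"
    using assms by (intro cfc_mono upos_star continuous_on_mult continuous_on_const continuous_powr) auto
  then show ?thesis
    using assms by (simp add: upowr_def cfc_cmult[OF upos_star continuous_powr])
qed

subsection \<open>The Loewner--Heinz inequality\<close>

text \<open>Conjugation by \<open>upowr b (- s/2)\<close> turns the larger side of \<open>le\<close>
  into 1 and the smaller into \<open>?X * ?X\<^sup>\<star>\<close>.\<close>

lemma norm_upowr_le_1:
  assumes a: "a \<in> upos" "0 \<notin> rspec a" and b: "b \<in> upos" "0 \<notin> rspec b"
    and le: "upowr a s \<preceq> upowr b s"
  shows "norm (upowr b (- s/2) * upowr a (s/2)) \<le> 1"
proof -
  let ?X = "upowr b (- s/2) * upowr a (s/2)"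
  have "upowr b (- s/2) * upowr a s * upowr b (- s/2) \<preceq> upowr b (- s/2) * upowr b s * upowr b (- s/2)"
    by (rule ule_conj_sa[OF le upowr_star]) (use b in auto)
  also have "\<dots> = 1" using b by (simp add: upowr_add upowr_0)
  also have "upowr b (- s/2) * upowr a s * upowr b (- s/2) = ?X * ?X\<^sup>\<star>"
  proof -
    have "upowr a s = upowr a (s/2) * upowr a (s/2)" using a by (simp add: upowr_add)
    then show ?thesis using a b by (simp add: star_mult upowr_star mult.assoc)
  qed
  finally have "norm (?X * ?X\<^sup>\<star>) \<le> norm (1::'a)" by (rule norm_mono[rotated]) simp
  then show ?thesis using power2_le_imp_le[of "norm ?X" 1] by (simp add: cstar_identity')
qed

text \<open>A contraction satisfies \<open>X\<^sup>\<star> * X \<preceq> 1\<close> as well;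
  conjugating this by \<open>upowr a (- s/2)\<close> leaves \<open>upowr b (- s)\<close> on the
  left.\<close>

lemma upowr_antimono:
  assumes a: "a \<in> upos" "0 \<notin> rspec a" and b: "b \<in> upos" "0 \<notin> rspec b"
    and le: "upowr a s \<preceq> upowr b s"
  shows "upowr b (- s) \<preceq> upowr a (- s)"
proof -
  define X where "X = upowr b (- s/2) * upowr a (s/2)"
  have n: "norm X \<le> 1" unfolding X_def by (rule norm_upowr_le_1[OF assms])
  have "norm (X\<^sup>\<star> * X) \<le> 1" using n by (simp add: cstar_identity power_le_one)
  then have "of_real (norm (X\<^sup>\<star> * X)) \<preceq> (1::'a)"
    using upos_scaleR[of "1::'a" "1 - norm (X\<^sup>\<star> * X)"] upos_square[of "1::'a"]
    by (simp add: ule_def scaleR_conv_of_real)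
  with ule_norm[OF star_mult_upos] have 1: "X\<^sup>\<star> * X \<preceq> 1" by (rule ule_trans)
  have sm: "upowr a (- s/2) * upowr a (s/2) = 1" "upowr a (s/2) * upowr a (- s/2) = 1"
    using a by (simp_all add: upowr_add upowr_0)
  have "X\<^sup>\<star> * X = upowr a (s/2) * (upowr b (- s/2) * upowr b (- s/2)) * upowr a (s/2)"
    using a b by (simp add: X_def star_mult upowr_star mult.assoc)
  also have "upowr b (- s/2) * upowr b (- s/2) = upowr b (- s)" using b by (simp add: upowr_add)
  finally have "upowr a (- s/2) * (X\<^sup>\<star> * X) * upowr a (- s/2) =
      (upowr a (- s/2) * upowr a (s/2)) * upowr b (- s) * (upowr a (s/2) * upowr a (- s/2))"
    by (simp only: mult.assoc)
  then have "upowr a (- s/2) * (X\<^sup>\<star> * X) * upowr a (- s/2) = upowr b (- s)"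
    unfolding sm by simp
  moreover have "upowr a (- s/2) * 1 * upowr a (- s/2) = upowr a (- s)"
    using a by (simp add: upowr_add)
  ultimately show ?thesis
    using ule_conj_sa[OF 1 upowr_star[OF a(1)], of "- s/2"] a by simp
qed

text \<open>With \<open>X = b\<^sup>-\<^sup>s\<^sup>/\<^sup>2 a\<^sup>s\<^sup>/\<^sup>2\<close> and \<open>Y = a\<^sup>t\<^sup>/\<^sup>2 b\<^sup>-\<^sup>t\<^sup>/\<^sup>2\<close>, both contractions, the positive element
  \<open>b\<^sup>-\<^sup>r\<^sup>/\<^sup>2 a\<^sup>r b\<^sup>-\<^sup>r\<^sup>/\<^sup>2\<close>, where \<open>r = (s+t)/2\<close>, is similar to \<open>X Y\<close>, so its spectrum lies in \<open>[0,1]\<close>.\<close>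

lemma upowr_midpoint:
  assumes a: "a \<in> upos" "0 \<notin> rspec a" and b: "b \<in> upos" "0 \<notin> rspec b"
    and s: "upowr a s \<preceq> upowr b s" and t: "upowr a t \<preceq> upowr b t"
  shows "upowr a ((s + t) / 2) \<preceq> upowr b ((s + t) / 2)"
proof -
  define r where "r = (s + t) / 2"
  define X where "X = upowr b (- s/2) * upowr a (s/2)"
  \<comment> \<open>The adjoint of the \<open>Y\<close> in the text above, so that one norm bound
    serves both factors.\<close>
  define Y where "Y = upowr b (- t/2) * upowr a (t/2)"
  define Z where "Z = upowr b (- r/2) * upowr a r * upowr b (- r/2)"
  define M where "M = X * Y\<^sup>\<star>"
  have mb: "upowr b x * upowr b y = upowr b (x + y)" for x y using b by (simp add: upowr_add)
  have ma: "upowr a x * upowr a y = upowr a (x + y)" for x y using a by (simp add: upowr_add)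
  have mb': "upowr b x * (upowr b y * z) = upowr b (x + y) * z" for x y z
    by (simp add: mb flip: mult.assoc)
  have ma': "upowr a x * (upowr a y * z) = upowr a (x + y) * z" for x y z
    by (simp add: ma flip: mult.assoc)
  have nX: "norm X \<le> 1" "norm Y \<le> 1"
    unfolding X_def Y_def using norm_upowr_le_1[OF a b] s t by auto
  have "norm M \<le> norm X * norm Y" unfolding M_def using norm_mult_ineq[of X "Y\<^sup>\<star>"] by simp
  also have "\<dots> \<le> 1" using nX mult_mono[of "norm X" 1 "norm Y" 1] by simp
  finally have nM: "norm M \<le> 1" .
  have M: "M = upowr b (- s/2) * (upowr a r * upowr b (- t/2))"
    unfolding M_def X_def Y_def r_def
    using a b by (simp add: star_mult upowr_star mult.assoc ma' add_divide_distrib)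
  \<comment> \<open>The exponent that balances the ends: \<open>b^u M b^(-u)\<close> carries the
    power \<open>- r/2\<close> of \<open>b\<close> on either side, hence is
    \<open>Z\<close>.\<close>
  define u where "u = (s - t) / 4"
  have Zu: "Z = upowr b u * (M * upowr b (- u))"
  proof -
    have "u + - s/2 = - r/2" "- t/2 + - u = - r/2" by (simp_all add: u_def r_def field_simps)
    then show ?thesis unfolding Z_def M by (simp only: mult.assoc mb mb')
  qed
  have Mu: "(M * upowr b (- u)) * upowr b u = M"
    using b by (simp add: mult.assoc mb upowr_0)
  have Zs: "Z\<^sup>\<star> = Z" using a b by (simp add: Z_def star_mult upowr_star mult.assoc)
  have bound: "x \<le> 1" if x: "x \<in> rspec Z" for x
  proof (cases "x = 0")
    case False
    then have "complex_of_real x \<in> uspec ((M * upowr b (- u)) * upowr b u)"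
      using x uspec_mult_commute[of "complex_of_real x" "upowr b u" "M * upowr b (- u)"]
      unfolding rspec_def Zu by simp
    then show ?thesis using uspec_norm_le[of "complex_of_real x" M] nM by (simp add: Mu)
  qed simp
  have "cfc (\<lambda>x. x) Z \<preceq> cfc (\<lambda>_. 1) Z"
    by (rule cfc_mono[OF Zs]) (auto intro!: continuous_intros bound)
  then have Z1: "Z \<preceq> 1" by (simp add: cfc_ident[OF Zs] cfc_const[OF Zs])
  have "upowr b (r/2) * Z * upowr b (r/2) \<preceq> upowr b (r/2) * 1 * upowr b (r/2)"
    by (rule ule_conj_sa[OF Z1 upowr_star]) (use b in auto)
  then show ?thesis
    unfolding Z_def r_def[symmetric] using b by (simp add: mult.assoc mb mb' upowr_0)
qed

text \<open>Midpoints with the exponent 0 produce the first family, midpoints with 1 the second. The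
  first serves \<open>upowr_dominated\<close>, the second \<open>upowr_sum\<close>.\<close>

lemma upowr_mono_dyadic:
  assumes a: "a \<in> upos" "0 \<notin> rspec a" and b: "b \<in> upos" "0 \<notin> rspec b"
    and le: "a \<preceq> b"
  shows "upowr a ((1/2) ^ j) \<preceq> upowr b ((1/2) ^ j) \<and>
    upowr a (1 - (1/2) ^ j) \<preceq> upowr b (1 - (1/2) ^ j)"
proof (induction j)
  case 0
  show ?case using a b le by (simp add: upowr_1 upowr_0)
next
  case (Suc j)
  have 0: "upowr a 0 \<preceq> upowr b 0" using a b by (simp add: upowr_0)
  have 1: "upowr a 1 \<preceq> upowr b 1" using a b le by (simp add: upowr_1)
  have "(0 + (1/2) ^ j) / 2 = (1/2::real) ^ Suc j"
    "(1 + (1 - (1/2) ^ j)) / 2 = 1 - (1/2::real) ^ Suc j" by simp_all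
  then show ?case
    using upowr_midpoint[OF a b 0 conjunct1[OF Suc]] upowr_midpoint[OF a b 1 conjunct2[OF Suc]]
    by metis
qed

text \<open>Adding a positive scalar gives invertibility, which negative powers and Loewner--Heinz
  require; writing shifted powers as functions of \<open>a\<close> reduces the later estimates to
  real inequalities.\<close>

lemma shift_cfc:
  assumes a: "a \<in> upos" and e: "0 < e"
  shows "a + of_real e = cfc (\<lambda>t. t + e) a" "a + of_real e \<in> upos" "0 \<notin> rspec (a + of_real e)"
    "upowr (a + of_real e) s = cfc (\<lambda>t. (t + e) powr s) a"
proof -
  have sa: "a\<^sup>\<star> = a" by (rule upos_star[OF a])
  have c: "continuous_on (rspec a) (\<lambda>t. t + e)" by (intro continuous_intros)
  show 1: "a + of_real e = cfc (\<lambda>t. t + e) a"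
    by (simp add: cfc_add[OF sa] continuous_on_id continuous_on_const cfc_ident[OF sa] cfc_const[OF sa])
  show "a + of_real e \<in> upos"
    unfolding 1 by (rule cfc_upos[OF sa c]) (use upos_rspec[OF a] e in force)
  show "0 \<notin> rspec (a + of_real e)"
    using rspec_cfc[OF sa c] upos_rspec[OF a] e unfolding 1 by force
  show "upowr (a + of_real e) s = cfc (\<lambda>t. (t + e) powr s) a"
    unfolding 1 upowr_def using upos_rspec[OF a] e
    by (intro cfc_compose[OF sa c] continuous_on_powr') (force intro!: continuous_intros)+
qed

lemma continuous_shift_powr:
  assumes "a \<in> upos" "0 < e" shows "continuous_on (rspec a) (\<lambda>t. (t + e) powr s)"
  by (rule continuous_on_powr') (use assms upos_rspec[of a] in \<open>force intro!: continuous_intros\<close>)+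

lemma ule_shift: "a \<preceq> b \<Longrightarrow> a + of_real e \<preceq> b + of_real e"
  by (simp add: ule_def)

lemma powr_one_plus: "0 \<le> t \<Longrightarrow> t powr (1 + s) = t * t powr (s::real)"
  by (simp add: powr_add)

text \<open>The first inequality is \<open>a \<preceq> b\<close> conjugated by
  \<open>upowr a (th/2)\<close>; the second is Loewner--Heinz for the exponent \<open>th\<close>,
  conjugated by \<open>upowr b (1/2)\<close> after a shift by \<open>e\<close>.\<close>

lemma upowr_dominated:
  assumes a: "a \<in> upos" and b: "b \<in> upos" and le: "a \<preceq> b" and th: "th = (1/2) ^ j"
  defines "z \<equiv> upowr b (1/2) * upowr a (th/2)"
  shows "upowr a (1 + th) \<preceq> z\<^sup>\<star> * z" "z * z\<^sup>\<star> \<preceq> upowr b (1 + th)"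
proof -
  have th0: "0 < th" "th \<le> 1" unfolding th by (simp_all add: power_le_one)
  have sa: "(upowr a (th/2))\<^sup>\<star> = upowr a (th/2)" using a th0 by (simp add: upowr_star)
  have sb: "(upowr b (1/2))\<^sup>\<star> = upowr b (1/2)" using b by (simp add: upowr_star)
  have "upowr a (th/2) * a * upowr a (th/2) \<preceq> upowr a (th/2) * b * upowr a (th/2)"
    by (rule ule_conj_sa[OF le sa])
  moreover have "upowr a (th/2) * a * upowr a (th/2) = upowr a (1 + th)"
    using upowr_add[OF a, of "th/2" 1] upowr_add[OF a, of "th/2 + 1" "th/2"] th0
    by (simp add: upowr_1[OF a] add.commute)
  moreover have "upowr b (1/2) * upowr b (1/2) = b"
    using upowr_add[OF b, of "1/2" "1/2"] by (simp add: upowr_1[OF b])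
  then have "upowr a (th/2) * b * upowr a (th/2) = z\<^sup>\<star> * z"
    by (simp add: z_def star_mult sa sb mult.assoc) (simp flip: mult.assoc)
  ultimately show "upowr a (1 + th) \<preceq> z\<^sup>\<star> * z" by simp
  have zz: "z * z\<^sup>\<star> = upowr b (1/2) * upowr a th * upowr b (1/2)"
    using upowr_add[OF a, of "th/2" "th/2"] th0
    by (simp add: z_def star_mult sa sb mult.assoc) (simp flip: mult.assoc)
  show "z * z\<^sup>\<star> \<preceq> upowr b (1 + th)"
  proof (rule ule_epsilon)
    fix d :: real assume d: "d > 0"
    \<comment> \<open>Chosen so that \<open>e powr th = d\<close>: subadditivity then bounds
      \<open>(t + e) powr th\<close> by \<open>t powr th + d\<close>.\<close>
    define e where "e = d powr (1 / th)"
    have e: "e > 0" "e powr th = d" using d th0 by (simp_all add: e_def powr_powr)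
    have cb: "continuous_on (rspec b) (\<lambda>t. (t + e) powr th)"
      by (rule continuous_shift_powr[OF b e(1)])
    have ca: "continuous_on (rspec a) (\<lambda>t. (t + e) powr th)"
      by (rule continuous_shift_powr[OF a e(1)])
    have "upowr a th \<preceq> upowr (a + of_real e) th"
      unfolding shift_cfc(4)[OF a e(1)] unfolding upowr_def
      by (rule cfc_mono[OF upos_star continuous_powr ca])
        (use a th0 e upos_rspec[OF a] in \<open>auto intro!: powr_mono2\<close>)
    also have "\<dots> \<preceq> upowr (b + of_real e) th"
      unfolding th
      using upowr_mono_dyadic[OF shift_cfc(2,3)[OF a e(1)] shift_cfc(2,3)[OF b e(1)] ule_shift[OF le], of j]
      by blast
    finally have "upowr b (1/2) * upowr a th * upowr b (1/2) \<preceq>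
        upowr b (1/2) * upowr (b + of_real e) th * upowr b (1/2)"
      by (rule ule_conj_sa[OF _ sb])
    also have "\<dots> = cfc (\<lambda>t. t powr (1/2) * (t + e) powr th * t powr (1/2)) b"
      unfolding shift_cfc(4)[OF b e(1)] unfolding upowr_def
      by (simp add: cfc_mult[OF upos_star[OF b]] continuous_powr[OF b] cb continuous_on_mult)
    also have "\<dots> \<preceq> cfc (\<lambda>t. t powr (1 + th) + d * t) b"
    proof (rule cfc_mono[OF upos_star[OF b]])
      show "continuous_on (rspec b) (\<lambda>t. t powr (1/2) * (t + e) powr th * t powr (1/2))"
        by (intro continuous_on_mult cb continuous_powr[OF b]) auto
      show "continuous_on (rspec b) (\<lambda>t. t powr (1 + th) + d * t)"
        by (intro continuous_intros continuous_powr[OF b]) (use th0 in auto)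
      fix t assume "t \<in> rspec b"
      then have t: "0 \<le> t" by (rule upos_rspec[OF b])
      have "(t + e) powr th \<le> t powr th + d"
      proof (cases "t = 0")
        case False
        \<comment> \<open>Used for both summands \<open>u\<close> of \<open>t + e\<close>; adding
          the two instances yields subadditivity.\<close>
        have *: "u * (t + e) powr (th - 1) \<le> u powr th" if "0 < u" "u \<le> t + e" for u
        proof -
          have "(t + e) powr (th - 1) \<le> u powr (th - 1)"
            using that th0 by (intro powr_mono2') auto
          then have "u * (t + e) powr (th - 1) \<le> u * u powr (th - 1)"
            using that by (intro mult_left_mono) auto
          then show ?thesis using that powr_one_plus[of u "th - 1"] by simp
        qed
        have "(t + e) powr th = t * (t + e) powr (th - 1) + e * (t + e) powr (th - 1)"
          using powr_one_plus[of "t + e" "th - 1"] t e by (simp add: distrib_right)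
        then show ?thesis using *[of t] *[of e] t False e by simp
      qed (use e in simp)
      then have le: "t * (t + e) powr th \<le> t * (t powr th + d)" using t by (rule mult_left_mono)
      have "t powr (1/2) * t powr (1/2) = t" using t by (simp flip: powr_add)
      then have eq: "t powr (1/2) * (t + e) powr th * t powr (1/2) = t * (t + e) powr th"
        by (metis mult.assoc mult.commute)
      have "t * (t powr th + d) = t powr (1 + th) + d * t"
        by (simp add: powr_one_plus[OF t] algebra_simps)
      then show "t powr (1/2) * (t + e) powr th * t powr (1/2) \<le> t powr (1 + th) + d * t"
        unfolding eq using le by linarith
    qed
    also have "\<dots> = upowr b (1 + th) + d *\<^sub>R b"
      unfolding upowr_def using th0
      by (simp add: cfc_add[OF upos_star[OF b]] cfc_cmult[OF upos_star[OF b]] cfc_ident[OF upos_star[OF b]]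
          continuous_powr[OF b] continuous_on_mult continuous_on_const continuous_on_id)
    finally show "z * z\<^sup>\<star> \<preceq> upowr b (1 + th) + d *\<^sub>R b" by (simp only: zz)
  qed
qed

text \<open>Up to \<open>e\<close>, the power of \<open>c = a + b\<close> is
  \<open>c * T * c\<close> with \<open>T = (c + e)^(th - 1)\<close>. The form
  \<open>x * T * x\<close> obeys the parallelogram inequality, the source of the factor 2, and
  inverting Loewner--Heinz for \<open>1 - th\<close> bounds \<open>T\<close> by
  \<open>(x + e)^(th - 1)\<close> for \<open>x\<close> equal to \<open>a\<close> or
  \<open>b\<close>.\<close>

lemma upowr_sum:
  assumes a: "a \<in> upos" and b: "b \<in> upos" and th: "th = (1/2) ^ j"
  shows "upowr (a + b) (1 + th) \<preceq> 2 *\<^sub>R (upowr a (1 + th) + upowr b (1 + th))"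
proof (rule ule_epsilon)
  fix e :: real assume e: "e > 0"
  have th0: "0 < th" "th \<le> 1" unfolding th by (simp_all add: power_le_one)
  define c where "c = a + b"
  have c: "c \<in> upos" using a b by (simp add: c_def upos_add)
  define T where "T = upowr (c + of_real e) (th - 1)"
  have T: "T \<in> upos" unfolding T_def using upowr_upos shift_cfc(2,3)[OF c e] by blast
  have cont: "continuous_on (rspec x) (\<lambda>t. t * (t + e) powr (th - 1) * t)" if "x \<in> upos" for x :: 'a
    by (intro continuous_on_mult continuous_shift_powr[OF that e] continuous_on_id)
  have xTx: "x * upowr (x + of_real e) (th - 1) * x = cfc (\<lambda>t. t * (t + e) powr (th - 1) * t) x"
    if "x \<in> upos" for x
    unfolding shift_cfc(4)[OF that e]
    by (simp add: cfc_mult[OF upos_star[OF that]] continuous_shift_powr[OF that e] continuous_on_id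
        continuous_on_mult cfc_ident[OF upos_star[OF that]])
  have part: "x * T * x \<preceq> upowr x (1 + th)" if x: "x \<in> upos" and xc: "x \<preceq> c" for x
  proof -
    have "T \<preceq> upowr (x + of_real e) (th - 1)"
      using upowr_antimono[OF shift_cfc(2,3)[OF x e] shift_cfc(2,3)[OF c e], of "1 - th"]
        upowr_mono_dyadic[OF shift_cfc(2,3)[OF x e] shift_cfc(2,3)[OF c e] ule_shift[OF xc], of j]
      by (simp add: T_def th)
    then have "x * T * x \<preceq> x * upowr (x + of_real e) (th - 1) * x"
      by (rule ule_conj_sa[OF _ upos_star[OF x]])
    also have "\<dots> = cfc (\<lambda>t. t * (t + e) powr (th - 1) * t) x" by (rule xTx[OF x])
    also have "\<dots> \<preceq> cfc (\<lambda>t. t powr (1 + th)) x"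
    proof (rule cfc_mono[OF upos_star[OF x] cont[OF x] continuous_powr[OF x]])
      show "0 < 1 + th \<or> 0 \<notin> rspec x" using th0 by simp
      fix t assume "t \<in> rspec x"
      then have t: "0 \<le> t" by (rule upos_rspec[OF x])
      show "t * (t + e) powr (th - 1) * t \<le> t powr (1 + th)"
      proof (cases "t = 0")
        case False
        have "(t + e) powr (th - 1) \<le> t powr (th - 1)"
          using t False e th0 by (intro powr_mono2') auto
        then have "t * (t + e) powr (th - 1) * t \<le> t * t powr (th - 1) * t"
          using t by (intro mult_right_mono mult_left_mono) auto
        also have "\<dots> = t powr (1 + th)"
          using t powr_one_plus[of t th] powr_one_plus[of t "th - 1"] by simp
        finally show ?thesis .
      qed simp
    qed
    finally show ?thesis by (simp add: upowr_def)
  qed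
  have "upowr c (1 + th) \<preceq> c * T * c + e *\<^sub>R upowr c th"
  proof -
    have "cfc (\<lambda>t. t powr (1 + th)) c \<preceq> cfc (\<lambda>t. t * (t + e) powr (th - 1) * t + e * t powr th) c"
    proof (rule cfc_mono[OF upos_star[OF c]])
      show "continuous_on (rspec c) (\<lambda>t. t powr (1 + th))" using th0 by (simp add: continuous_powr[OF c])
      show "continuous_on (rspec c) (\<lambda>t. t * (t + e) powr (th - 1) * t + e * t powr th)"
        using th0 by (intro continuous_on_add cont[OF c] continuous_on_mult continuous_on_const
            continuous_powr[OF c]) auto
      fix t assume "t \<in> rspec c"
      then have t: "0 \<le> t" by (rule upos_rspec[OF c])
      show "t powr (1 + th) \<le> t * (t + e) powr (th - 1) * t + e * t powr th"
      proof (cases "t = 0")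
        case False
        then have tp: "0 < t" using t by simp
        have te: "(t + e) * (t + e) powr (th - 1) = (t + e) powr th"
          using powr_one_plus[of "t + e" "th - 1"] tp e by simp
        \<comment> \<open>With \<open>q = t / (t + e)\<close>, the left side splits into
          \<open>t * t powr th * q\<close>, absorbed by the first term on the right, and
          \<open>e * t powr th * q\<close>, absorbed by the second because
          \<open>q \<le> 1\<close>.\<close>
        have "t powr th * (t / (t + e)) \<le> (t + e) powr th * (t / (t + e))"
          using tp e th0 by (intro mult_right_mono powr_mono2) auto
        also have "\<dots> = t * (t + e) powr (th - 1)" using tp e by (simp flip: te)
        finally have "t * (t powr th * (t / (t + e))) \<le> t * (t * (t + e) powr (th - 1))"
          using tp by (intro mult_left_mono) auto
        moreover have "t * t powr th = t * (t powr th * (t / (t + e))) + e * t powr th * (t / (t + e))"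
        proof -
          have *: "t * p = t * (p * q) + e * p * q" if "(t + e) * q = t" for p q
          proof -
            have "t * p = (t + e) * q * p" using that by simp
            then show ?thesis by (simp add: algebra_simps)
          qed
          show ?thesis by (rule *) (use tp e in simp)
        qed
        moreover have "e * t powr th * (t / (t + e)) \<le> e * t powr th * 1"
          using tp e by (intro mult_left_mono) auto
        moreover have "t * (t + e) powr (th - 1) * t = t * (t * (t + e) powr (th - 1))" by simp
        ultimately show ?thesis unfolding powr_one_plus[OF t] by linarith
      qed simp
    qed
    also have "\<dots> = c * T * c + e *\<^sub>R upowr c th"
      unfolding T_def xTx[OF c] unfolding upowr_def using th0
      by (simp add: cfc_add[OF upos_star[OF c]] cfc_cmult[OF upos_star[OF c]] cont[OF c]
          continuous_powr[OF c] continuous_on_mult continuous_on_const)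
    finally show ?thesis by (simp add: upowr_def)
  qed
  also have "\<dots> \<preceq> 2 *\<^sub>R (a * T * a + b * T * b) + e *\<^sub>R upowr c th"
  proof (rule ule_add[OF _ ule_refl])
    have "(a - b)\<^sup>\<star> * T * (a - b) \<in> upos" by (rule upos_conj[OF T])
    moreover have "2 *\<^sub>R (a * T * a + b * T * b) - c * T * c = (a - b) * T * (a - b)"
      by (simp add: c_def algebra_simps scaleR_2)
    ultimately show "c * T * c \<preceq> 2 *\<^sub>R (a * T * a + b * T * b)"
      using a b by (simp add: ule_def star_diff upos_star)
  qed
  also have "\<dots> \<preceq> 2 *\<^sub>R (upowr a (1 + th) + upowr b (1 + th)) + e *\<^sub>R upowr c th"
    by (intro ule_add ule_scaleR ule_refl part a b) (use a b in \<open>auto simp: ule_def c_def\<close>)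
  finally show "upowr (a + b) (1 + th) \<preceq> 2 *\<^sub>R (upowr a (1 + th) + upowr b (1 + th)) + e *\<^sub>R upowr c th"
    by (simp only: c_def)
qed

text \<open>For the second product, \<open>x\<close> intertwines \<open>x\<^sup>\<star> * x\<close>
  with \<open>x * x\<^sup>\<star>\<close> and hence their powers. This replaces a polar
  decomposition, whose partial isometry need not lie in the algebra.\<close>

lemma upowr_star_swap:
  fixes x :: "'a::cstar_algebra_1"
  assumes r: "1 < r"
  defines "z \<equiv> x * upowr (x\<^sup>\<star> * x) ((r - 1) / 2)"
  shows "z\<^sup>\<star> * z = upowr (x\<^sup>\<star> * x) r" "z * z\<^sup>\<star> = upowr (x * x\<^sup>\<star>) r"
proof -
  define c where "c = x\<^sup>\<star> * x"
  define d where "d = x * x\<^sup>\<star>"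
  have c: "c \<in> upos" and d: "d \<in> upos" by (simp_all add: c_def d_def)
  have s: "(upowr c ((r - 1) / 2))\<^sup>\<star> = upowr c ((r - 1) / 2)" using c r by (simp add: upowr_star)
  have "z\<^sup>\<star> * z = upowr c ((r - 1) / 2) * upowr c 1 * upowr c ((r - 1) / 2)"
    by (simp add: z_def star_mult s mult.assoc upowr_1[OF c] flip: c_def)
       (simp add: c_def mult.assoc)
  also have "\<dots> = upowr c ((r - 1) / 2 + 1 + (r - 1) / 2)"
  proof -
    have "0 < (r - 1) / 2" "0 < (r - 1) / 2 + 1" using r by (simp_all add: add_pos_pos)
    then show ?thesis by (simp only: upowr_add[OF c] zero_less_one simp_thms)
  qed
  also have "(r - 1) / 2 + 1 + (r - 1) / 2 = r" by (simp add: field_simps)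
  finally show "z\<^sup>\<star> * z = upowr (x\<^sup>\<star> * x) r" by (simp only: c_def)
  have "z * z\<^sup>\<star> = x * (upowr c ((r - 1) / 2) * upowr c ((r - 1) / 2)) * x\<^sup>\<star>"
    by (simp add: z_def star_mult s mult.assoc flip: c_def)
  also have "upowr c ((r - 1) / 2) * upowr c ((r - 1) / 2) = upowr c (r - 1)"
    using r by (simp add: upowr_add[OF c])
  also have "x * upowr c (r - 1) = upowr d (r - 1) * x"
    unfolding upowr_def
  proof (rule cfc_intertwine[OF upos_star[OF c] upos_star[OF d]])
    show "continuous_on (rspec c \<union> rspec d) (\<lambda>t. t powr (r - 1))"
      by (rule continuous_on_powr') (use r upos_rspec[OF c] upos_rspec[OF d] in \<open>auto intro!: continuous_intros\<close>)
    show "x * c = d * x" by (simp add: c_def d_def mult.assoc)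
  qed
  also have "upowr d (r - 1) * x * x\<^sup>\<star> = upowr d (r - 1) * upowr d 1"
    by (simp add: upowr_1[OF d] mult.assoc) (simp add: d_def)
  also have "\<dots> = upowr d r" using r by (simp add: upowr_add[OF d])
  finally show "z * z\<^sup>\<star> = upowr (x * x\<^sup>\<star>) r" by (simp only: d_def)
qed

subsection \<open>Factorisation and Riesz decomposition\<close>

lemma cfc_sandwich:
  assumes c: "c \<in> upos" and f: "continuous_on (rspec c) f"
  shows "cfc f c * c * cfc f c = cfc (\<lambda>t. t * (f t)\<^sup>2) c"
proof -
  note [simp] = cfc_mult[OF upos_star[OF c]] f continuous_on_mult
  have "cfc f c * c * cfc f c = cfc f c * cfc (\<lambda>t. t) c * cfc f c"
    by (simp add: cfc_ident[OF upos_star[OF c]])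
  also have "\<dots> = cfc (\<lambda>t. f t * t * f t) c"
    by (simp add: continuous_on_id)
  also have "(\<lambda>t. f t * t * f t) = (\<lambda>t. t * (f t)\<^sup>2)" by (simp add: power2_eq_square fun_eq_iff)
  finally show ?thesis .
qed

text \<open>By the C*-identity the squared norm is that of
  \<open>f(c) y\<^sup>\<star> y f(c)\<close>, which lies below \<open>c f(c)^2\<close>. Thus
  \<open>y\<close> may be estimated as if it were the square root of \<open>c\<close>.\<close>

lemma norm_mult_cfc_le:
  assumes y: "y\<^sup>\<star> * y \<preceq> c" and f: "continuous_on (rspec c) f"
    and B: "0 \<le> B" "\<And>t. t \<in> rspec c \<Longrightarrow> t * (f t)\<^sup>2 \<le> B\<^sup>2"
  shows "norm (y * cfc f c) \<le> B"
proof -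
  have c: "c \<in> upos" by (rule upos_ule_trans[OF star_mult_upos y])
  have s: "(cfc f c)\<^sup>\<star> = cfc f c" by (rule cfc_star[OF upos_star[OF c] f])
  have "cfc f c * (y\<^sup>\<star> * y) * cfc f c \<preceq> cfc (\<lambda>t. t * (f t)\<^sup>2) c"
    using ule_conj_sa[OF y s] by (simp only: cfc_sandwich[OF c f])
  then have "(y * cfc f c)\<^sup>\<star> * (y * cfc f c) \<preceq> cfc (\<lambda>t. t * (f t)\<^sup>2) c"
    by (simp add: star_mult s mult.assoc)
  then have "norm ((y * cfc f c)\<^sup>\<star> * (y * cfc f c)) \<le> norm (cfc (\<lambda>t. t * (f t)\<^sup>2) c)"
    by (rule norm_mono[OF star_mult_upos])
  also have "\<dots> \<le> B\<^sup>2"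
    by (rule norm_cfc_le[OF upos_star[OF c]])
      (use B(2) upos_rspec[OF c] in \<open>auto intro!: continuous_intros f\<close>)
  finally have "(norm (y * cfc f c))\<^sup>2 \<le> B\<^sup>2" by (simp only: cstar_identity)
  then show ?thesis using B(1) by (rule power2_le_imp_le)
qed

text \<open>The inner \<open>x\<^sup>\<star> * x\<close> is enlarged to \<open>c\<close>, whose
  square root is then moved to \<open>f\<close>; this reduces the claim to the preceding bound for
  \<open>f t * sqrt t\<close>.\<close>

lemma norm_cfc_between_le:
  assumes y: "y\<^sup>\<star> * y \<preceq> c" and x: "x\<^sup>\<star> * x \<preceq> c" and f: "continuous_on (rspec c) f"
    and B: "0 \<le> B" "\<And>t. t \<in> rspec c \<Longrightarrow> t * \<bar>f t\<bar> \<le> B"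
  shows "norm (y * cfc f c * x\<^sup>\<star>) \<le> B"
proof -
  have c: "c \<in> upos" by (rule upos_ule_trans[OF star_mult_upos y])
  define g where "g = cfc f c"
  have s: "g\<^sup>\<star> = g" unfolding g_def by (rule cfc_star[OF upos_star[OF c] f])
  have q: "continuous_on (rspec c) sqrt" by (intro continuous_intros)
  obtain w where w: "w = cfc sqrt c" by simp
  have ws: "w\<^sup>\<star> = w" unfolding w by (rule cfc_star[OF upos_star[OF c] q])
  have "cfc (\<lambda>t. sqrt t * sqrt t) c = cfc (\<lambda>t. t) c"
    by (rule cfc_cong[OF upos_star[OF c] continuous_on_mult[OF q q]]) (use upos_rspec[OF c] in auto)
  then have ww: "w * w = c"
    unfolding w cfc_mult[OF upos_star[OF c] q q] cfc_ident[OF upos_star[OF c]] .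
  have "(norm (y * g * x\<^sup>\<star>))\<^sup>2 = norm ((y * g * x\<^sup>\<star>) * (y * g * x\<^sup>\<star>)\<^sup>\<star>)"
    by (simp only: cstar_identity')
  also have "(y * g * x\<^sup>\<star>) * (y * g * x\<^sup>\<star>)\<^sup>\<star> = (y * g) * (x\<^sup>\<star> * x) * (y * g)\<^sup>\<star>"
    by (simp add: star_mult star_star mult.assoc)
  also have "norm \<dots> \<le> norm ((y * g) * c * (y * g)\<^sup>\<star>)"
    by (rule norm_mono[OF _ ule_conj'[OF x]])
       (use upos_conj[OF star_mult_upos, of "(y * g)\<^sup>\<star>" x] in \<open>simp only: star_star\<close>)
  also have "(y * g) * c * (y * g)\<^sup>\<star> = (y * (g * w)) * (y * (g * w))\<^sup>\<star>"
    by (simp add: star_mult ws mult.assoc flip: ww)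
  also have "norm \<dots> = (norm (y * (g * w)))\<^sup>2" by (simp only: cstar_identity')
  also have "\<dots> \<le> B\<^sup>2"
  proof (rule power_mono[OF _ norm_ge_zero])
    have "norm (y * cfc (\<lambda>t. f t * sqrt t) c) \<le> B"
    proof (rule norm_mult_cfc_le[OF y _ B(1)])
      show "continuous_on (rspec c) (\<lambda>t. f t * sqrt t)" by (intro continuous_intros f)
      fix t assume t: "t \<in> rspec c"
      then have t0: "0 \<le> t" by (rule upos_rspec[OF c])
      have "t * (f t * sqrt t)\<^sup>2 = (t * \<bar>f t\<bar>)\<^sup>2" using t0
        by (simp add: power_mult_distrib) (simp add: power2_eq_square)
      also have "\<dots> \<le> B\<^sup>2" using B(2)[OF t] t0 by (intro power_mono) auto
      finally show "t * (f t * sqrt t)\<^sup>2 \<le> B\<^sup>2" .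
    qed
    then show "norm (y * (g * w)) \<le> B" by (simp only: cfc_mult[OF upos_star[OF c] f q] g_def w)
  qed
  finally show ?thesis unfolding g_def using B(1) by (rule power2_le_imp_le)
qed

text \<open>A continuous stand-in for \<open>t powr (- s)\<close> on spectra containing 0: constant
  below \<open>e\<close>, exact from \<open>e\<close> on.\<close>

definition cut_powr :: "real \<Rightarrow> real \<Rightarrow> real \<Rightarrow> real" where
  "cut_powr e s t = max t e powr (- s)"

lemma continuous_cut_powr: "0 < e \<Longrightarrow> continuous_on S (cut_powr e s)"
  unfolding cut_powr_def by (rule continuous_on_powr') (auto intro!: continuous_intros)

lemma cut_powr_nonneg: "0 \<le> cut_powr e s t"
  by (simp add: cut_powr_def)

lemma cut_powr_le: "0 < t \<Longrightarrow> 0 \<le> s \<Longrightarrow> cut_powr e s t \<le> t powr (- s)"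
  by (auto simp: cut_powr_def intro: powr_mono2')

lemma cut_powr_eq: "e \<le> t \<Longrightarrow> cut_powr e s t = t powr (- s)"
  by (simp add: cut_powr_def max_absorb1)

text \<open>Truncations at levels up to \<open>m\<close> agree from \<open>m\<close> on; below it
  both lie between 0 and \<open>t powr (- s)\<close>.\<close>

lemma cut_powr_diff:
  assumes "0 \<le> t" "0 < d" "0 < e" "d \<le> m" "e \<le> m" "0 \<le> s" "s < 1"
  shows "t powr s * \<bar>cut_powr d s t - cut_powr e s t\<bar> \<le> (if t < m then 1 else 0)"
proof (cases "t = 0 \<or> m \<le> t")
  case True
  then show ?thesis using assms by (auto simp: cut_powr_eq)
next
  case False
  then have t: "0 < t" "t < m" using assms by auto
  have "\<bar>cut_powr d s t - cut_powr e s t\<bar> \<le> t powr (- s)"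
    using cut_powr_le[OF t(1) assms(6), of d] cut_powr_le[OF t(1) assms(6), of e]
      cut_powr_nonneg[of d s t] cut_powr_nonneg[of e s t] by linarith
  then have "t powr s * \<bar>cut_powr d s t - cut_powr e s t\<bar> \<le> t powr s * t powr (- s)"
    by (intro mult_left_mono) auto
  also have "\<dots> = 1" using t by (simp flip: powr_add)
  finally show ?thesis using t by simp
qed

lemma cut_powr_defect:
  assumes "0 \<le> t" "0 < e" "0 < s"
  shows "0 \<le> 1 - t powr s * cut_powr e s t" "1 - t powr s * cut_powr e s t \<le> (if t < e then 1 else 0)"
proof -
  have "t powr s * cut_powr e s t \<le> 1 \<and> (e \<le> t \<longrightarrow> t powr s * cut_powr e s t = 1)"
  proof (cases "t = 0")
    case False
    then have t: "0 < t" using assms by simp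
    have "t powr s * cut_powr e s t \<le> t powr s * t powr (- s)"
      using cut_powr_le[OF t, of s e] assms by (intro mult_left_mono) auto
    moreover have "t powr s * t powr (- s) = 1" using t by (simp flip: powr_add)
    ultimately show ?thesis by (auto simp: cut_powr_eq)
  qed (use assms in auto)
  then show "0 \<le> 1 - t powr s * cut_powr e s t"
    "1 - t powr s * cut_powr e s t \<le> (if t < e then 1 else 0)"
    using cut_powr_nonneg[of e s t] by auto
qed

section \<open>Rates of convergence along \<open>1 / real (Suc n)\<close>\<close>

lemma powr_mult_le:
  assumes "0 \<le> t" "t \<le> m" "0 \<le> p" "0 \<le> u" "u \<le> (1::real)"
  shows "t powr p * u \<le> m powr p"
  using mult_mono[OF powr_mono2[OF assms(3,1,2)] assms(5) _ assms(4)] by simp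

lemma power2_powr_half_mult: "0 \<le> t \<Longrightarrow> (t powr (1/2) * x)\<^sup>2 = t * (x::real)\<^sup>2"
  by (simp add: powr_half_sqrt power_mult_distrib)

lemma inverse_Suc_small:
  assumes "0 < (d::real)" shows "\<exists>N. \<forall>n\<ge>N. 1 / real (Suc n) < d"
proof -
  obtain N where N: "1 / real (Suc N) < d" using nat_approx_posE[OF assms] by blast
  have "1 / real (Suc n) < d" if "n \<ge> N" for n
  proof -
    have "1 / real (Suc n) \<le> 1 / real (Suc N)" using that by (intro divide_left_mono) auto
    then show ?thesis using N by simp
  qed
  then show ?thesis by blast
qed

lemma tendstoI_norm_le:
  fixes X :: "nat \<Rightarrow> 'b::real_normed_vector"
  assumes "\<And>n. norm (X n - L) \<le> (1 / real (Suc n)) powr s" "0 < s"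
  shows "X \<longlonglongrightarrow> L"
proof -
  have "(\<lambda>n. (1 / real (Suc n)) powr s) \<longlonglongrightarrow> 0 powr s"
    by (rule tendsto_powr'[OF LIMSEQ_Suc[OF lim_1_over_n] tendsto_const]) (use assms(2) in auto)
  then have "(\<lambda>n. (1 / real (Suc n)) powr s) \<longlonglongrightarrow> 0" by simp
  moreover have "\<forall>\<^sub>F n in sequentially. norm (X n - L) \<le> (1 / real (Suc n)) powr s"
    by (rule always_eventually) (use assms(1) in blast)
  ultimately have "(\<lambda>n. X n - L) \<longlonglongrightarrow> 0" by (rule Lim_null_comparison[rotated])
  then show ?thesis by (simp add: LIM_zero_iff)
qed

lemma CauchyI_norm_le:
  fixes X :: "nat \<Rightarrow> 'b::real_normed_vector"
  assumes "\<And>N m n. N \<le> m \<Longrightarrow> N \<le> n \<Longrightarrow> norm (X m - X n) \<le> (1 / real (Suc N)) powr s" "0 < s"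
  shows "Cauchy X"
  unfolding Cauchy_iff
proof (intro allI impI)
  fix e :: real assume e: "e > 0"
  obtain N where "1 / real (Suc N) < e powr (1 / s)" using inverse_Suc_small[of "e powr (1/s)"] e by auto
  then have "(1 / real (Suc N)) powr s < (e powr (1 / s)) powr s"
    using assms(2) by (intro powr_less_mono2) auto
  then have "(1 / real (Suc N)) powr s < e" using e assms(2) by (simp add: powr_powr)
  then show "\<exists>M. \<forall>m\<ge>M. \<forall>n\<ge>M. norm (X m - X n) < e" using assms(1) by (meson le_less_trans)
qed

text \<open>\<open>w\<close> is the limit of \<open>y * d n\<close> for truncations
  \<open>d n\<close> of \<open>c^(-s)\<close>. By \<open>norm_mult_cfc_le\<close> the error is of
  order \<open>t^(1/2 - s)\<close> over small \<open>t\<close>, so \<open>s < 1/2\<close> gives norm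
  convergence. The sequence \<open>d\<close> is kept in the conclusion to show later that
  \<open>w\<close> has scalar part 0.\<close>

lemma factorisation:
  fixes y c :: "'a::cstar_algebra_1"
  assumes y: "y\<^sup>\<star> * y \<preceq> c" and s: "0 < s" "s < 1/2"
  shows "\<exists>d w. (\<lambda>n. y * d n) \<longlonglongrightarrow> w \<and> w * upowr c s = y \<and>
    (c = y\<^sup>\<star> * y \<longrightarrow> w\<^sup>\<star> * y = upowr c (1 - s))"
proof -
  have c: "c \<in> upos" by (rule upos_ule_trans[OF star_mult_upos y])
  note cs = upos_star[OF c]
  define ee where "ee = (\<lambda>n. 1 / real (Suc n))"
  have e0: "0 < ee n" for n by (simp add: ee_def)
  have mono: "ee n \<le> ee N" if "N \<le> n" for n N using that by (simp add: ee_def frac_le)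
  define d where "d = (\<lambda>n. cfc (cut_powr (ee n) s) c)"
  note ct = continuous_cut_powr[OF e0]
  have "Cauchy (\<lambda>n. y * d n)"
  proof (rule CauchyI_norm_le)
    show "0 < 1/2 - s" using s by simp
    fix N m n :: nat assume Nmn: "N \<le> m" "N \<le> n"
    have "norm (y * cfc (\<lambda>t. cut_powr (ee m) s t - cut_powr (ee n) s t) c) \<le> ee N powr (1/2 - s)"
    proof (rule norm_mult_cfc_le[OF y])
      show "continuous_on (rspec c) (\<lambda>t. cut_powr (ee m) s t - cut_powr (ee n) s t)"
        by (intro continuous_intros ct)
      fix t assume "t \<in> rspec c"
      then have t: "0 \<le> t" by (rule upos_rspec[OF c])
      let ?D = "\<bar>cut_powr (ee m) s t - cut_powr (ee n) s t\<bar>"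
      have D: "t powr s * ?D \<le> (if t < ee N then 1 else 0)"
        using cut_powr_diff[OF t e0 e0 mono mono] Nmn s by simp
      have D2: "(t powr s * ?D)\<^sup>2 \<le> (if t < ee N then 1 else 0)"
      proof -
        have "x\<^sup>2 \<le> (if t < ee N then 1 else 0)" if "0 \<le> x" "x \<le> (if t < ee N then 1 else 0)" for x :: real
          using that by (auto simp: power_le_one split: if_splits)
        then show ?thesis using D by simp
      qed
      show "t * (cut_powr (ee m) s t - cut_powr (ee n) s t)\<^sup>2 \<le> (ee N powr (1/2 - s))\<^sup>2"
      proof (cases "t = 0")
        case False
        have "t = t powr (1 - 2 * s) * (t powr s)\<^sup>2"
          using t False by (simp add: power2_eq_square flip: powr_add)
        then have "t * (cut_powr (ee m) s t - cut_powr (ee n) s t)\<^sup>2 = t powr (1 - 2 * s) * (t powr s * ?D)\<^sup>2"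
          by (metis power_mult_distrib mult.assoc power2_abs)
        also have "\<dots> \<le> ee N powr (1 - 2 * s)"
        proof (cases "t < ee N")
          case True
          then show ?thesis using D2 t s by (intro powr_mult_le) auto
        next
          case F: False
          have "(t powr s * ?D)\<^sup>2 = 0"
            by (rule antisym[OF D2[unfolded if_not_P[OF F]] zero_le_power2])
          then show ?thesis by (simp only: mult_zero_right powr_ge_zero)
        qed
        also have "\<dots> = (ee N powr (1/2 - s))\<^sup>2"
          using e0[of N] by (simp add: power2_eq_square flip: powr_add)
        finally show ?thesis .
      qed simp
    qed simp
    then show "norm (y * d m - y * d n) \<le> (1 / real (Suc N)) powr (1/2 - s)"
      unfolding cfc_diff[OF cs ct ct] by (simp add: d_def ee_def right_diff_distrib)
  qed
  then obtain w where w: "(\<lambda>n. y * d n) \<longlonglongrightarrow> w" using Cauchy_convergent convergent_def by blast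
  have cp: "continuous_on (rspec c) (\<lambda>t. t powr s)" using c s by (simp add: continuous_powr)
  have "(\<lambda>n. y * d n * upowr c s) \<longlonglongrightarrow> y"
  proof (rule tendstoI_norm_le)
    fix n
    have dc: "d n * upowr c s = cfc (\<lambda>t. cut_powr (ee n) s t * t powr s) c"
      unfolding d_def upowr_def by (rule cfc_mult[OF cs ct cp, symmetric])
    have cc: "continuous_on (rspec c) (\<lambda>t. cut_powr (ee n) s t * t powr s)"
      by (intro continuous_on_mult ct cp)
    have "norm (y * cfc (\<lambda>t. cut_powr (ee n) s t * t powr s - 1) c) \<le> ee n powr (1/2)"
    proof (rule norm_mult_cfc_le[OF y])
      show "continuous_on (rspec c) (\<lambda>t. cut_powr (ee n) s t * t powr s - 1)"
        by (intro continuous_on_diff cc continuous_on_const)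
      fix t assume "t \<in> rspec c"
      then have t: "0 \<le> t" by (rule upos_rspec[OF c])
      define u where "u = 1 - t powr s * cut_powr (ee n) s t"
      have u: "0 \<le> u" "u \<le> (if t < ee n then 1 else 0)"
        unfolding u_def using cut_powr_defect[OF t e0 s(1)] by auto
      have "t * u\<^sup>2 \<le> ee n"
      proof (cases "t < ee n")
        case True
        then have "u\<^sup>2 \<le> 1" using u by (simp add: power_le_one)
        then show ?thesis using True t mult_mono[of t "ee n" "u\<^sup>2" 1] by simp
      next
        case False
        then have "u = 0" using u by simp
        then show ?thesis using e0[of n] by simp
      qed
      moreover have "(cut_powr (ee n) s t * t powr s - 1)\<^sup>2 = u\<^sup>2"
        by (simp add: u_def power2_eq_square algebra_simps)
      ultimately show "t * (cut_powr (ee n) s t * t powr s - 1)\<^sup>2 \<le> (ee n powr (1/2))\<^sup>2"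
        using e0[of n] by (simp add: power2_eq_square flip: powr_add)
    qed simp
    then show "norm (y * d n * upowr c s - y) \<le> (1 / real (Suc n)) powr (1/2)"
      unfolding cfc_diff[OF cs cc continuous_on_const] cfc_const[OF cs] dc[symmetric]
      by (simp add: right_diff_distrib ee_def mult.assoc)
  qed simp
  moreover have "(\<lambda>n. y * d n * upowr c s) \<longlonglongrightarrow> w * upowr c s" by (intro tendsto_intros w)
  ultimately have wy: "w * upowr c s = y" by (rule LIMSEQ_unique[rotated])
  \<comment> \<open>In this case \<open>(y * d n)\<^sup>\<star> * y\<close> is a function of
    \<open>c\<close> alone, and it converges uniformly on the spectrum.\<close>
  have "w\<^sup>\<star> * y = upowr c (1 - s)" if cy: "c = y\<^sup>\<star> * y"
  proof -
    have ds: "(d n)\<^sup>\<star> = d n" for n unfolding d_def by (rule cfc_star[OF cs ct])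
    have "(\<lambda>n. (y * d n)\<^sup>\<star> * y) \<longlonglongrightarrow> upowr c (1 - s)"
    proof (rule tendstoI_norm_le)
      show "0 < 1 - s" using s by simp
      fix n
      have cc: "continuous_on (rspec c) (\<lambda>t. cut_powr (ee n) s t * t)"
        by (intro continuous_on_mult ct continuous_on_id)
      have c1: "continuous_on (rspec c) (\<lambda>t. t powr (1 - s))" using c s by (simp add: continuous_powr)
      have "(y * d n)\<^sup>\<star> * y = cfc (cut_powr (ee n) s) c * cfc (\<lambda>t. t) c"
        by (simp add: star_mult ds mult.assoc flip: cy) (simp add: d_def cfc_ident[OF cs])
      also have "\<dots> = cfc (\<lambda>t. cut_powr (ee n) s t * t) c"
        by (rule cfc_mult[OF cs ct continuous_on_id, symmetric])
      finally have "(y * d n)\<^sup>\<star> * y - upowr c (1 - s) =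
          cfc (\<lambda>t. cut_powr (ee n) s t * t - t powr (1 - s)) c"
        by (simp add: cfc_diff[OF cs cc c1] upowr_def)
      moreover have "norm (cfc (\<lambda>t. cut_powr (ee n) s t * t - t powr (1 - s)) c) \<le> ee n powr (1 - s)"
      proof (rule norm_cfc_le[OF cs continuous_on_diff[OF cc c1]])
        fix t assume "t \<in> rspec c"
        then have t: "0 \<le> t" by (rule upos_rspec[OF c])
        define u where "u = 1 - t powr s * cut_powr (ee n) s t"
        have u: "0 \<le> u" "u \<le> (if t < ee n then 1 else 0)"
          unfolding u_def using cut_powr_defect[OF t e0 s(1)] by auto
        have "t = t powr (1 - s) * t powr s" using t by (simp flip: powr_add)
        then have "cut_powr (ee n) s t * t - t powr (1 - s) = - (t powr (1 - s) * u)"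
          unfolding u_def by (simp add: algebra_simps)
        then have "\<bar>cut_powr (ee n) s t * t - t powr (1 - s)\<bar> = t powr (1 - s) * u"
          using u by (simp add: abs_mult)
        also have "\<dots> \<le> ee n powr (1 - s)"
        proof (cases "t < ee n")
          case True
          then show ?thesis using u s t by (intro powr_mult_le) auto
        next
          case False
          then have "u = 0" using u by simp
          then show ?thesis by simp
        qed
        finally show "\<bar>cut_powr (ee n) s t * t - t powr (1 - s)\<bar> \<le> ee n powr (1 - s)" .
      qed
      ultimately show "norm ((y * d n)\<^sup>\<star> * y - upowr c (1 - s)) \<le> (1 / real (Suc n)) powr (1 - s)"
        by (simp add: ee_def)
    qed
    moreover have "(\<lambda>n. (y * d n)\<^sup>\<star> * y) \<longlonglongrightarrow> w\<^sup>\<star> * y" by (intro tendsto_intros w)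
    ultimately show ?thesis by (rule LIMSEQ_unique[rotated])
  qed
  then show ?thesis using w wy by blast
qed

text \<open>A Riesz decomposition after Pedersen: \<open>v\<^sub>k\<close> is the limit of \<open>y (x\<^sub>1\<^sup>* x\<^sub>1 + x\<^sub>2\<^sup>* x\<^sub>2)\<^sup>-\<^sup>1\<^sup>/\<^sup>2 x\<^sub>k\<^sup>*\<close>.\<close>

lemma riesz_decomposition:
  fixes y x1 x2 :: "'a::cstar_algebra_1"
  assumes y: "y\<^sup>\<star> * y \<preceq> x1\<^sup>\<star> * x1 + x2\<^sup>\<star> * x2"
  shows "\<exists>d v1 v2. (\<lambda>n. y * d n * x1\<^sup>\<star>) \<longlonglongrightarrow> v1 \<and> (\<lambda>n. y * d n * x2\<^sup>\<star>) \<longlonglongrightarrow> v2 \<and>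
    v1 * v1\<^sup>\<star> + v2 * v2\<^sup>\<star> = y * y\<^sup>\<star> \<and> v1\<^sup>\<star> * v1 \<preceq> x1 * x1\<^sup>\<star> \<and> v2\<^sup>\<star> * v2 \<preceq> x2 * x2\<^sup>\<star>"
proof -
  define c where "c = x1\<^sup>\<star> * x1 + x2\<^sup>\<star> * x2"
  have yc: "y\<^sup>\<star> * y \<preceq> c" using y by (simp add: c_def)
  have c: "c \<in> upos" by (rule upos_ule_trans[OF star_mult_upos yc])
  note cs = upos_star[OF c]
  have x1c: "x1\<^sup>\<star> * x1 \<preceq> c" and x2c: "x2\<^sup>\<star> * x2 \<preceq> c" by (simp_all add: ule_def c_def)
  define ee where "ee = (\<lambda>n. 1 / real (Suc n))"
  have e0: "0 < ee n" for n by (simp add: ee_def)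
  have mono: "ee n \<le> ee N" if "N \<le> n" for n N using that by (simp add: ee_def frac_le)
  define d where "d = (\<lambda>n. cfc (cut_powr (ee n) (1/2)) c)"
  note ct = continuous_cut_powr[OF e0]
  have ds: "(d n)\<^sup>\<star> = d n" for n unfolding d_def by (rule cfc_star[OF cs ct])
  \<comment> \<open>At exponent 1/2 the products \<open>y * d n\<close> need not converge; the extra
    factor \<open>x\<^sup>\<star>\<close> with \<open>x\<^sup>\<star> * x \<preceq> c\<close>
    restores a rate.\<close>
  have conv: "\<exists>v. (\<lambda>n. y * d n * x\<^sup>\<star>) \<longlonglongrightarrow> v \<and> v\<^sup>\<star> * v \<preceq> x * x\<^sup>\<star>" if x: "x\<^sup>\<star> * x \<preceq> c" for x
  proof -
    have "Cauchy (\<lambda>n. y * d n * x\<^sup>\<star>)"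
    proof (rule CauchyI_norm_le)
      show "(0::real) < 1/2" by simp
      fix N m n :: nat assume Nmn: "N \<le> m" "N \<le> n"
      have "norm (y * cfc (\<lambda>t. cut_powr (ee m) (1/2) t - cut_powr (ee n) (1/2) t) c * x\<^sup>\<star>) \<le> ee N powr (1/2)"
      proof (rule norm_cfc_between_le[OF yc x])
        show "continuous_on (rspec c) (\<lambda>t. cut_powr (ee m) (1/2) t - cut_powr (ee n) (1/2) t)"
          by (intro continuous_intros ct)
        fix t assume "t \<in> rspec c"
        then have t: "0 \<le> t" by (rule upos_rspec[OF c])
        let ?D = "\<bar>cut_powr (ee m) (1/2) t - cut_powr (ee n) (1/2) t\<bar>"
        have D: "t powr (1/2) * ?D \<le> (if t < ee N then 1 else 0)"
          using cut_powr_diff[OF t e0 e0 mono mono] Nmn by simp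
        have "t = t powr (1/2) * t powr (1/2)" using t by (simp flip: powr_add)
        then have "t * ?D = t powr (1/2) * (t powr (1/2) * ?D)" by (metis mult.assoc)
        also have "\<dots> \<le> ee N powr (1/2)"
        proof (cases "t < ee N")
          case True
          then show ?thesis using D t by (intro powr_mult_le) auto
        next
          case F: False
          have "t powr (1/2) * ?D = 0"
            by (rule antisym[OF D[unfolded if_not_P[OF F]]]) simp
          then show ?thesis by (simp only: mult_zero_right powr_ge_zero)
        qed
        finally show "t * ?D \<le> ee N powr (1/2)" .
      qed simp
      then show "norm (y * d m * x\<^sup>\<star> - y * d n * x\<^sup>\<star>) \<le> (1 / real (Suc N)) powr (1/2)"
        unfolding cfc_diff[OF cs ct ct] by (simp add: d_def ee_def right_diff_distrib left_diff_distrib)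
    qed
    then obtain v where v: "(\<lambda>n. y * d n * x\<^sup>\<star>) \<longlonglongrightarrow> v" using Cauchy_convergent convergent_def by blast
    have "v\<^sup>\<star> * v \<preceq> x * x\<^sup>\<star>"
    proof (rule ule_LIMSEQ)
      show "(\<lambda>n. (y * d n * x\<^sup>\<star>)\<^sup>\<star> * (y * d n * x\<^sup>\<star>)) \<longlonglongrightarrow> v\<^sup>\<star> * v" by (intro tendsto_intros v)
      fix n
      have "d n * (y\<^sup>\<star> * y) * d n \<preceq> d n * c * d n" by (rule ule_conj_sa[OF yc ds])
      also have "\<dots> = cfc (\<lambda>t. t * (cut_powr (ee n) (1/2) t)\<^sup>2) c"
        unfolding d_def by (rule cfc_sandwich[OF c ct])
      also have "\<dots> \<preceq> cfc (\<lambda>_. 1) c"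
      proof (rule cfc_mono[OF cs])
        show "continuous_on (rspec c) (\<lambda>t. t * (cut_powr (ee n) (1/2) t)\<^sup>2)"
          by (intro continuous_intros ct)
        fix t assume "t \<in> rspec c"
        then have t: "0 \<le> t" by (rule upos_rspec[OF c])
        have "t powr (1/2) * cut_powr (ee n) (1/2) t \<le> 1"
          using cut_powr_defect(1)[OF t e0, of "1/2" n] by simp
        then have "(t powr (1/2) * cut_powr (ee n) (1/2) t)\<^sup>2 \<le> 1"
          by (simp add: power_le_one cut_powr_nonneg)
        then show "t * (cut_powr (ee n) (1/2) t)\<^sup>2 \<le> 1"
          unfolding power2_powr_half_mult[OF t] .
      qed (intro continuous_intros)
      finally have "d n * (y\<^sup>\<star> * y) * d n \<preceq> 1" by (simp add: cfc_const[OF cs])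
      from ule_conj'[OF this, of x]
      show "(y * d n * x\<^sup>\<star>)\<^sup>\<star> * (y * d n * x\<^sup>\<star>) \<preceq> x * x\<^sup>\<star>"
        by (simp add: star_mult star_star ds mult.assoc)
    qed
    then show ?thesis using v by blast
  qed
  obtain v1 where v1: "(\<lambda>n. y * d n * x1\<^sup>\<star>) \<longlonglongrightarrow> v1" "v1\<^sup>\<star> * v1 \<preceq> x1 * x1\<^sup>\<star>" using conv[OF x1c] by blast
  obtain v2 where v2: "(\<lambda>n. y * d n * x2\<^sup>\<star>) \<longlonglongrightarrow> v2" "v2\<^sup>\<star> * v2 \<preceq> x2 * x2\<^sup>\<star>" using conv[OF x2c] by blast
  \<comment> \<open>The two terms add up to \<open>y * (d n * c * d n) * y\<^sup>\<star>\<close>.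
    The middle factor need not tend to 1 in norm, but between \<open>y\<close> and its adjoint the
    small spectral values of \<open>c\<close>, where it differs from 1, count little.\<close>
  have "(\<lambda>n. (y * d n * x1\<^sup>\<star>) * (y * d n * x1\<^sup>\<star>)\<^sup>\<star> + (y * d n * x2\<^sup>\<star>) * (y * d n * x2\<^sup>\<star>)\<^sup>\<star>) \<longlonglongrightarrow> y * y\<^sup>\<star>"
  proof (rule tendstoI_norm_le[where s = 1])
    fix n
    have cd: "continuous_on (rspec c) (\<lambda>t. t * (cut_powr (ee n) (1/2) t)\<^sup>2)"
      by (intro continuous_intros ct)
    have "(y * d n * x1\<^sup>\<star>) * (y * d n * x1\<^sup>\<star>)\<^sup>\<star> + (y * d n * x2\<^sup>\<star>) * (y * d n * x2\<^sup>\<star>)\<^sup>\<star> =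
        y * (d n * c * d n) * y\<^sup>\<star>"
      by (simp add: c_def star_mult star_star ds distrib_left distrib_right mult.assoc)
    also have "d n * c * d n = cfc (\<lambda>t. t * (cut_powr (ee n) (1/2) t)\<^sup>2) c"
      unfolding d_def by (rule cfc_sandwich[OF c ct])
    finally have e: "(y * d n * x1\<^sup>\<star>) * (y * d n * x1\<^sup>\<star>)\<^sup>\<star> + (y * d n * x2\<^sup>\<star>) * (y * d n * x2\<^sup>\<star>)\<^sup>\<star> - y * y\<^sup>\<star> =
        y * cfc (\<lambda>t. t * (cut_powr (ee n) (1/2) t)\<^sup>2 - 1) c * y\<^sup>\<star>"
      by (simp add: cfc_diff[OF cs cd continuous_on_const] cfc_const[OF cs] left_diff_distrib right_diff_distrib)
    have "norm (y * cfc (\<lambda>t. t * (cut_powr (ee n) (1/2) t)\<^sup>2 - 1) c * y\<^sup>\<star>) \<le> ee n"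
    proof (rule norm_cfc_between_le[OF yc yc])
      show "continuous_on (rspec c) (\<lambda>t. t * (cut_powr (ee n) (1/2) t)\<^sup>2 - 1)"
        by (intro continuous_intros ct)
      show "0 \<le> ee n" using e0[of n] by simp
      fix t assume "t \<in> rspec c"
      then have t: "0 \<le> t" by (rule upos_rspec[OF c])
      define p where "p = t powr (1/2) * cut_powr (ee n) (1/2) t"
      have p: "0 \<le> p" "p \<le> 1" "ee n \<le> t \<longrightarrow> p = 1"
        using cut_powr_defect[OF t e0, of "1/2" n] by (auto simp: p_def cut_powr_nonneg)
      have pp: "t * (cut_powr (ee n) (1/2) t)\<^sup>2 = p\<^sup>2"
        by (simp only: p_def power2_powr_half_mult[OF t])
      have "\<bar>p\<^sup>2 - 1\<bar> \<le> (if t < ee n then 1 else 0)" using p by (auto simp: power_le_one)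
      then show "t * \<bar>t * (cut_powr (ee n) (1/2) t)\<^sup>2 - 1\<bar> \<le> ee n"
        unfolding pp using t e0[of n] mult_mono[of t "ee n" "\<bar>p\<^sup>2 - 1\<bar>" 1]
        by (cases "t < ee n") auto
    qed
    then show "norm ((y * d n * x1\<^sup>\<star>) * (y * d n * x1\<^sup>\<star>)\<^sup>\<star> + (y * d n * x2\<^sup>\<star>) * (y * d n * x2\<^sup>\<star>)\<^sup>\<star> - y * y\<^sup>\<star>)
        \<le> (1 / real (Suc n)) powr 1"
      unfolding e by (simp add: ee_def)
  qed simp
  moreover have "(\<lambda>n. (y * d n * x1\<^sup>\<star>) * (y * d n * x1\<^sup>\<star>)\<^sup>\<star> + (y * d n * x2\<^sup>\<star>) * (y * d n * x2\<^sup>\<star>)\<^sup>\<star>)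
      \<longlonglongrightarrow> v1 * v1\<^sup>\<star> + v2 * v2\<^sup>\<star>"
    by (intro tendsto_intros v1 v2)
  ultimately have "v1 * v1\<^sup>\<star> + v2 * v2\<^sup>\<star> = y * y\<^sup>\<star>" by (rule LIMSEQ_unique[rotated])
  then show ?thesis using v1 v2 by blast
qed

subsection \<open>The unitization as a unital C*-algebra\<close>

datatype 'a unitization = Unitize (algebra_part: 'a) (scalar_part: complex)

text \<open>The operator norm of left multiplication on A is not definite when A is unital, so the
  norm below is its maximum with the modulus of the scalar part.\<close>

definition left_mult :: "'a::cstar_algebra unitization \<Rightarrow> 'a \<Rightarrow> 'a" where
  "left_mult u b = algebra_part u * b + scalar_part u *\<^sub>C b"

lemma scaleC_scaleR: "c *\<^sub>C (r *\<^sub>R x) = r *\<^sub>R (c *\<^sub>C (x::'a::cstar_algebra))"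
  by (simp only: scaleC_of_real[symmetric] scaleC_scaleC mult.commute)

lemma scaleR_scaleC: "(r *\<^sub>R c) *\<^sub>C x = r *\<^sub>R (c *\<^sub>C (x::'a::cstar_algebra))"
  by (simp only: scaleC_of_real[symmetric] scaleC_scaleC scaleR_conv_of_real)

lemma bounded_linear_scaleC: "bounded_linear (\<lambda>b::'a::cstar_algebra. c *\<^sub>C b)"
  by (rule bounded_linear_intro[where K = "cmod c"])
    (simp_all add: scaleC_add_right norm_scaleC mult.commute scaleC_scaleR)

lemma bounded_linear_left_mult: "bounded_linear (left_mult u)"
  unfolding left_mult_def
  by (intro bounded_linear_add bounded_linear_mult_right bounded_linear_scaleC)

lemma norm_left_mult_le: "norm (left_mult u b) \<le> onorm (left_mult u) * norm b"
  by (rule onorm[OF bounded_linear_left_mult])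

lemma unitization_eqI:
  "algebra_part u = algebra_part v \<Longrightarrow> scalar_part u = scalar_part v \<Longrightarrow> u = v"
  by (cases u; cases v) simp

instantiation unitization :: (cstar_algebra) ring_1
begin

definition "0 = Unitize 0 0"
definition "1 = Unitize 0 1"
definition "u + v = Unitize (algebra_part u + algebra_part v) (scalar_part u + scalar_part v)"
definition "u - v = Unitize (algebra_part u - algebra_part v) (scalar_part u - scalar_part v)"
definition "- u = Unitize (- algebra_part u) (- scalar_part u)"
definition "u * v = Unitize
  (algebra_part u * algebra_part v + scalar_part u *\<^sub>C algebra_part v + scalar_part v *\<^sub>C algebra_part u)
  (scalar_part u * scalar_part v)"

instance
  by standard
    (simp_all add: zero_unitization_def one_unitization_def plus_unitization_def minus_unitization_def
      uminus_unitization_def times_unitization_def algebra_simps mult_scaleC_left mult_scaleC_right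
      scaleC_add_left scaleC_add_right scaleC_scaleC)

end

instantiation unitization :: (cstar_algebra) real_algebra_1
begin

definition "r *\<^sub>R u = Unitize (r *\<^sub>R algebra_part u) (r *\<^sub>R scalar_part u)"

instance
proof
  fix a b :: real and x y :: "'a unitization"
  show "a *\<^sub>R (x + y) = a *\<^sub>R x + a *\<^sub>R y" "(a + b) *\<^sub>R x = a *\<^sub>R x + b *\<^sub>R x"
    "a *\<^sub>R b *\<^sub>R x = (a * b) *\<^sub>R x" "1 *\<^sub>R x = x"
    "a *\<^sub>R x * y = a *\<^sub>R (x * y)" "x * a *\<^sub>R y = a *\<^sub>R (x * y)"
    by (simp_all add: scaleR_unitization_def plus_unitization_def times_unitization_def scaleR_add_left
        scaleR_add_right scaleC_scaleR scaleR_scaleC)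
qed

end

lemma algebra_part_simps [simp]:
  "algebra_part 0 = 0" "algebra_part 1 = 0"
  "algebra_part (u + v) = algebra_part u + algebra_part v"
  "algebra_part (u - v) = algebra_part u - algebra_part v"
  "algebra_part (- u) = - algebra_part u"
  "algebra_part (r *\<^sub>R u) = r *\<^sub>R algebra_part u"
  "algebra_part (u * v) = algebra_part u * algebra_part v + scalar_part u *\<^sub>C algebra_part v
     + scalar_part v *\<^sub>C algebra_part u"
  by (simp_all add: zero_unitization_def one_unitization_def plus_unitization_def
      minus_unitization_def uminus_unitization_def times_unitization_def scaleR_unitization_def)

lemma scalar_part_simps [simp]:
  "scalar_part 0 = 0" "scalar_part 1 = 1"
  "scalar_part (u + v) = scalar_part u + scalar_part v"
  "scalar_part (u - v) = scalar_part u - scalar_part v"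
  "scalar_part (- u) = - scalar_part u"
  "scalar_part (r *\<^sub>R u) = r *\<^sub>R scalar_part u"
  "scalar_part (u * v) = scalar_part u * scalar_part v"
  by (simp_all add: zero_unitization_def one_unitization_def plus_unitization_def
      minus_unitization_def uminus_unitization_def times_unitization_def scaleR_unitization_def)

lemma left_mult_add: "left_mult (u + v) = (\<lambda>b. left_mult u b + left_mult v b)"
  by (simp add: left_mult_def fun_eq_iff distrib_right scaleC_add_left)

lemma left_mult_scaleR: "left_mult (r *\<^sub>R u) = (\<lambda>b. r *\<^sub>R left_mult u b)"
  by (simp add: left_mult_def fun_eq_iff scaleR_add_right scaleR_scaleC)

lemma left_mult_mult: "left_mult (u * v) = left_mult u \<circ> left_mult v"
  by (simp add: left_mult_def fun_eq_iff distrib_right distrib_left scaleC_add_right scaleC_scaleC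
      mult_scaleC_left mult_scaleC_right mult.assoc algebra_simps)

instantiation unitization :: (cstar_algebra) real_normed_algebra_1
begin

definition "norm u = max (cmod (scalar_part u)) (onorm (left_mult u))"
definition "dist u v = norm (u - v :: 'a unitization)"
definition "sgn u = inverse (norm u) *\<^sub>R (u :: 'a unitization)"
definition [code del]: "(uniformity :: ('a unitization \<times> 'a unitization) filter) =
  (INF e\<in>{0<..}. principal {(x, y). dist x y < e})"
definition [code del]: "open (S :: 'a unitization set) \<longleftrightarrow>
  (\<forall>x\<in>S. \<forall>\<^sub>F (x', y) in uniformity. x' = x \<longrightarrow> y \<in> S)"

text \<open>Left multiplication is tested on the adjoint of the algebra part \<open>a\<close>, where
  \<open>a * a\<^sup>\<star>\<close> has norm \<open>(norm a)\<^sup>2\<close>. Definiteness and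
  completeness of the norm follow from this bound.\<close>

lemma norm_algebra_part_le: "norm (algebra_part u) \<le> 2 * norm (u :: 'a unitization)"
proof (cases "algebra_part u = 0")
  case True
  then show ?thesis by (simp add: norm_unitization_def le_max_iff_disj)
next
  case False
  define a l where "a = algebra_part u" and "l = scalar_part u"
  have "(norm a)\<^sup>2 = norm (left_mult u (a\<^sup>\<star>) - l *\<^sub>C a\<^sup>\<star>)"
    by (simp add: left_mult_def a_def l_def cstar_identity')
  also have "\<dots> \<le> onorm (left_mult u) * norm a + cmod l * norm a"
    using norm_left_mult_le[of u "a\<^sup>\<star>"] norm_triangle_ineq4[of "left_mult u (a\<^sup>\<star>)" "l *\<^sub>C a\<^sup>\<star>"]
    by (simp add: norm_scaleC)
  finally have "norm a * norm a \<le> (onorm (left_mult u) + cmod l) * norm a"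
    by (simp add: power2_eq_square distrib_right)
  then have "norm a \<le> onorm (left_mult u) + cmod l"
    using False by (simp add: a_def)
  then show ?thesis by (auto simp: norm_unitization_def a_def l_def)
qed

instance
proof
  fix r :: real and u v :: "'a unitization" and S :: "'a unitization set"
  show "dist u v = norm (u - v)" "sgn u = u /\<^sub>R norm u"
    "(uniformity :: ('a unitization \<times> 'a unitization) filter) =
       (INF e\<in>{0<..}. principal {(x, y). dist x y < e})"
    "open S = (\<forall>x\<in>S. \<forall>\<^sub>F (x', y) in uniformity. x' = x \<longrightarrow> y \<in> S)"
    by (simp_all only: dist_unitization_def sgn_unitization_def uniformity_unitization_def
        open_unitization_def)
  show "norm u = 0 \<longleftrightarrow> u = 0"
  proof
    assume n: "norm u = 0"
    then have "algebra_part u = 0" using norm_algebra_part_le[of u] by simp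
    moreover have "cmod (scalar_part u) \<le> norm u" by (simp add: norm_unitization_def)
    then have "scalar_part u = 0" using n by simp
    ultimately show "u = 0" by (simp add: unitization_eqI)
  next
    assume "u = 0"
    then have "left_mult u = (\<lambda>_. 0)" by (simp add: left_mult_def fun_eq_iff)
    then show "norm u = 0" using \<open>u = 0\<close> by (simp add: norm_unitization_def onorm_zero)
  qed
  have "onorm (left_mult (u + v)) \<le> onorm (left_mult u) + onorm (left_mult v)"
    unfolding left_mult_add by (intro onorm_triangle bounded_linear_left_mult)
  then show "norm (u + v) \<le> norm u + norm v"
    using norm_triangle_ineq[of "scalar_part u" "scalar_part v"] by (auto simp: norm_unitization_def)
  have "onorm (left_mult (r *\<^sub>R u)) = \<bar>r\<bar> * onorm (left_mult u)"
    unfolding left_mult_scaleR by (intro onorm_scaleR bounded_linear_left_mult)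
  then show "norm (r *\<^sub>R u) = \<bar>r\<bar> * norm u"
    by (simp add: norm_unitization_def max_mult_distrib_left norm_mult)
  have o: "0 \<le> onorm (left_mult w)" for w :: "'a unitization"
    by (rule onorm_pos_le[OF bounded_linear_left_mult])
  have "onorm (left_mult (u * v)) \<le> onorm (left_mult u) * onorm (left_mult v)"
    unfolding left_mult_mult by (intro onorm_compose bounded_linear_left_mult)
  also have "\<dots> \<le> norm u * norm v"
    by (intro mult_mono) (auto simp: norm_unitization_def o le_max_iff_disj)
  finally have "onorm (left_mult (u * v)) \<le> norm u * norm v" .
  moreover have "cmod (scalar_part (u * v)) \<le> norm u * norm v"
    unfolding scalar_part_simps norm_mult by (intro mult_mono) (auto simp: norm_unitization_def le_max_iff_disj)
  ultimately show "norm (u * v) \<le> norm u * norm v" by (simp add: norm_unitization_def[of "u * v"])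
  have "onorm (left_mult (1 :: 'a unitization)) \<le> 1"
    by (rule onorm_bound) (simp_all add: left_mult_def)
  then show "norm (1 :: 'a unitization) = 1" by (simp add: norm_unitization_def)
qed

end

lemma norm_scalar_part_le: "cmod (scalar_part u) \<le> norm u"
  by (simp add: norm_unitization_def)

lemma norm_unitization_le: "norm u \<le> norm (algebra_part u) + cmod (scalar_part u)"
proof -
  have "onorm (left_mult u) \<le> norm (algebra_part u) + cmod (scalar_part u)"
  proof (rule onorm_bound)
    fix b
    have "norm (left_mult u b) \<le> norm (algebra_part u * b) + norm (scalar_part u *\<^sub>C b)"
      unfolding left_mult_def by (rule norm_triangle_ineq)
    also have "\<dots> \<le> (norm (algebra_part u) + cmod (scalar_part u)) * norm b"
      using norm_mult_ineq[of "algebra_part u" b] by (simp add: norm_scaleC distrib_right)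
    finally show "norm (left_mult u b) \<le> (norm (algebra_part u) + cmod (scalar_part u)) * norm b" .
  qed simp
  then show ?thesis by (simp add: norm_unitization_def)
qed

instance unitization :: (cstar_algebra) banach
proof
  fix X :: "nat \<Rightarrow> 'a unitization"
  assume X: "Cauchy X"
  have "Cauchy (\<lambda>n. scalar_part (X n))"
    unfolding Cauchy_iff
  proof (intro allI impI)
    fix e :: real assume "e > 0"
    then obtain M where M: "\<forall>m\<ge>M. \<forall>n\<ge>M. norm (X m - X n) < e" using X unfolding Cauchy_iff by meson
    have "norm (scalar_part (X m) - scalar_part (X n)) \<le> norm (X m - X n)" for m n
      using norm_scalar_part_le[of "X m - X n"] by simp
    then show "\<exists>M. \<forall>m\<ge>M. \<forall>n\<ge>M. norm (scalar_part (X m) - scalar_part (X n)) < e"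
      using M by (meson le_less_trans)
  qed
  then obtain l where l: "(\<lambda>n. scalar_part (X n)) \<longlonglongrightarrow> l" using Cauchy_convergent convergent_def by blast
  have "Cauchy (\<lambda>n. algebra_part (X n))"
    unfolding Cauchy_iff
  proof (intro allI impI)
    fix e :: real assume "e > 0"
    then have "e / 2 > 0" by simp
    then obtain M where M: "\<forall>m\<ge>M. \<forall>n\<ge>M. norm (X m - X n) < e / 2" using X unfolding Cauchy_iff by meson
    have "norm (algebra_part (X m) - algebra_part (X n)) < e" if "m \<ge> M" "n \<ge> M" for m n
    proof -
      have "norm (X m - X n) < e / 2" using M that by blast
      then show ?thesis using norm_algebra_part_le[of "X m - X n"] by simp
    qed
    then show "\<exists>M. \<forall>m\<ge>M. \<forall>n\<ge>M. norm (algebra_part (X m) - algebra_part (X n)) < e" by blast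
  qed
  then obtain a where a: "(\<lambda>n. algebra_part (X n)) \<longlonglongrightarrow> a" using Cauchy_convergent convergent_def by blast
  have "(\<lambda>n. norm (algebra_part (X n) - a) + norm (scalar_part (X n) - l)) \<longlonglongrightarrow> norm (a - a) + norm (l - l)"
    by (intro tendsto_intros a l)
  then have t: "(\<lambda>n. norm (algebra_part (X n) - a) + norm (scalar_part (X n) - l)) \<longlonglongrightarrow> 0" by simp
  have "norm (X n - Unitize a l) \<le> norm (algebra_part (X n) - a) + norm (scalar_part (X n) - l)" for n
    using norm_unitization_le[of "X n - Unitize a l"] by simp
  then have "(\<lambda>n. X n - Unitize a l) \<longlonglongrightarrow> 0"
    by (intro Lim_null_comparison[OF always_eventually t]) blast
  then show "convergent X" using LIM_zero_cancel convergent_def by blast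
qed

instantiation unitization :: (cstar_algebra) cstar_algebra
begin

definition "c *\<^sub>C u = Unitize (c *\<^sub>C algebra_part u) (c * scalar_part u)"
definition "u\<^sup>\<star> = Unitize ((algebra_part u)\<^sup>\<star>) (cnj (scalar_part u))"

lemma scaleC_unitization_simps [simp]:
  "algebra_part (c *\<^sub>C (u :: 'a unitization)) = c *\<^sub>C algebra_part u"
  "scalar_part (c *\<^sub>C (u :: 'a unitization)) = c * scalar_part u"
  by (simp_all add: scaleC_unitization_def)

lemma star_unitization_simps [simp]:
  "algebra_part ((u :: 'a unitization)\<^sup>\<star>) = (algebra_part u)\<^sup>\<star>"
  "scalar_part ((u :: 'a unitization)\<^sup>\<star>) = cnj (scalar_part u)"
  by (simp_all add: star_unitization_def)

text \<open>One inequality holds for every complex factor; applying it to \<open>c\<close> and to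
  \<open>inverse c\<close> gives equality.\<close>

lemma norm_scaleC_unitization: "norm (c *\<^sub>C (u :: 'a unitization)) = cmod c * norm u"
proof -
  have le: "onorm (left_mult (c *\<^sub>C u)) \<le> cmod c * onorm (left_mult u)" for c and u :: "'a unitization"
  proof (rule onorm_bound)
    show "0 \<le> cmod c * onorm (left_mult u)" by (simp add: onorm_pos_le bounded_linear_left_mult)
    fix b
    have "left_mult (c *\<^sub>C u) b = c *\<^sub>C left_mult u b"
      by (simp add: left_mult_def mult_scaleC_left scaleC_add_right scaleC_scaleC)
    then show "norm (left_mult (c *\<^sub>C u) b) \<le> cmod c * onorm (left_mult u) * norm b"
      using norm_left_mult_le[of u b] by (simp add: norm_scaleC mult_left_mono mult.assoc)
  qed
  have "onorm (left_mult (c *\<^sub>C u)) = cmod c * onorm (left_mult u)"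
  proof (cases "c = 0")
    case True
    then have "left_mult (c *\<^sub>C u) = (\<lambda>_. 0)" by (simp add: left_mult_def fun_eq_iff)
    then show ?thesis using True by (simp add: onorm_zero)
  next
    case False
    then have "inverse c *\<^sub>C c *\<^sub>C u = u" by (simp add: unitization_eqI scaleC_scaleC)
    then have "onorm (left_mult u) \<le> inverse (cmod c) * onorm (left_mult (c *\<^sub>C u))"
      using le[of "inverse c" "c *\<^sub>C u"] by (simp add: norm_inverse)
    then have "cmod c * onorm (left_mult u) \<le> cmod c * (inverse (cmod c) * onorm (left_mult (c *\<^sub>C u)))"
      by (rule mult_left_mono) simp
    also have "\<dots> = onorm (left_mult (c *\<^sub>C u))" using False by (simp flip: mult.assoc)
    finally show ?thesis by (rule antisym[OF le])
  qed
  then show ?thesis by (simp add: norm_unitization_def max_mult_distrib_left norm_mult)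
qed

text \<open>The C*-identity of \<open>A\<close> at \<open>left_mult u b\<close> gives the bound for
  operator norms. The reverse inequality is submultiplicativity once the star is isometric.\<close>

lemma norm_star_mult_unitization: "(norm u)\<^sup>2 \<le> norm (u\<^sup>\<star> * (u :: 'a unitization))"
proof -
  let ?K = "onorm (left_mult (u\<^sup>\<star> * u))"
  have K: "0 \<le> ?K" by (rule onorm_pos_le[OF bounded_linear_left_mult])
  have "onorm (left_mult u) \<le> sqrt ?K"
  proof (rule onorm_bound)
    show "0 \<le> sqrt ?K" using K by simp
    fix b
    have "(norm (left_mult u b))\<^sup>2 = norm ((left_mult u b)\<^sup>\<star> * left_mult u b)"
      by (simp add: cstar_identity)
    also have "(left_mult u b)\<^sup>\<star> * left_mult u b = b\<^sup>\<star> * left_mult (u\<^sup>\<star> * u) b"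
      by (simp add: left_mult_def star_add star_mult star_scaleC algebra_simps mult_scaleC_left
          mult_scaleC_right scaleC_scaleC scaleC_add_right)
    also have "norm \<dots> \<le> norm b * (?K * norm b)"
      using norm_mult_ineq[of "b\<^sup>\<star>" "left_mult (u\<^sup>\<star> * u) b"]
        mult_left_mono[OF norm_left_mult_le[of "u\<^sup>\<star> * u" b] norm_ge_zero[of b]]
      unfolding norm_star by (rule order_trans)
    also have "\<dots> = (sqrt ?K * norm b)\<^sup>2" using K by (simp add: power_mult_distrib power2_eq_square)
    finally show "norm (left_mult u b) \<le> sqrt ?K * norm b"
      by (rule power2_le_imp_le) (use K in simp)
  qed
  then have "(onorm (left_mult u))\<^sup>2 \<le> (sqrt ?K)\<^sup>2"
    by (intro power_mono onorm_pos_le bounded_linear_left_mult)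
  then have 1: "(onorm (left_mult u))\<^sup>2 \<le> ?K" using K by simp
  have "(cmod (scalar_part u))\<^sup>2 = cmod (scalar_part (u\<^sup>\<star> * u))"
    by (simp add: norm_mult power2_eq_square)
  then show ?thesis using 1
    by (cases "cmod (scalar_part u) \<le> onorm (left_mult u)")
      (auto simp: norm_unitization_def max_def simp del: scalar_part_simps)
qed

instance
proof
  fix c d :: complex and r :: real and u v :: "'a unitization"
  show "c *\<^sub>C (u + v) = c *\<^sub>C u + c *\<^sub>C v" "(c + d) *\<^sub>C u = c *\<^sub>C u + d *\<^sub>C u"
    "c *\<^sub>C d *\<^sub>C u = (c * d) *\<^sub>C u"
    "c *\<^sub>C u * v = c *\<^sub>C (u * v)" "u * c *\<^sub>C v = c *\<^sub>C (u * v)"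
    by (rule unitization_eqI; simp add: scaleC_add_left scaleC_add_right scaleC_scaleC algebra_simps
        mult_scaleC_left mult_scaleC_right)+
  show "complex_of_real r *\<^sub>C u = r *\<^sub>R u"
  proof (rule unitization_eqI)
    show "scalar_part (complex_of_real r *\<^sub>C u) = scalar_part (r *\<^sub>R u)"
      unfolding scaleC_unitization_simps scalar_part_simps by (rule scaleR_conv_of_real[symmetric])
  qed (simp add: scaleC_of_real)
  show "norm (c *\<^sub>C u) = cmod c * norm u" by (rule norm_scaleC_unitization)
  show ss: "(u\<^sup>\<star>)\<^sup>\<star> = u" for u :: "'a unitization" by (rule unitization_eqI) (simp_all add: star_star)
  show "(u + v)\<^sup>\<star> = u\<^sup>\<star> + v\<^sup>\<star>" "(c *\<^sub>C u)\<^sup>\<star> = cnj c *\<^sub>C u\<^sup>\<star>" "(u * v)\<^sup>\<star> = v\<^sup>\<star> * u\<^sup>\<star>"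
    by (rule unitization_eqI; simp add: star_add star_scaleC star_mult algebra_simps)+
  have le: "norm u \<le> norm (u\<^sup>\<star>)" for u :: "'a unitization"
  proof (cases "u = 0")
    case False
    have "norm u * norm u \<le> norm (u\<^sup>\<star>) * norm u"
      using norm_star_mult_unitization[of u] norm_mult_ineq[of "u\<^sup>\<star>" u] by (simp add: power2_eq_square)
    then show ?thesis using False by simp
  qed simp
  have "norm (u\<^sup>\<star>) = norm u" using le[of u] le[of "u\<^sup>\<star>"] ss by simp
  then show "norm (u\<^sup>\<star> * u) = (norm u)\<^sup>2"
    using norm_star_mult_unitization[of u] norm_mult_ineq[of "u\<^sup>\<star>" u] by (simp add: power2_eq_square)
qed

end

instance unitization :: (cstar_algebra) cstar_algebra_1 ..

subsection \<open>Transfer along the embedding into the unitization\<close>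

definition iota :: "'a::cstar_algebra \<Rightarrow> 'a unitization" where
  "iota a = Unitize a 0"

lemma iota_parts [simp]: "algebra_part (iota a) = a" "scalar_part (iota a) = 0"
  by (simp_all add: iota_def)

lemma iota_eq_iff [simp]: "iota a = iota b \<longleftrightarrow> a = b"
  by (simp add: iota_def)

lemma iota_0 [simp]: "iota 0 = 0"
  by (simp add: unitization_eqI)

lemma iota_add: "iota (a + b) = iota a + iota b"
  and iota_diff: "iota (a - b) = iota a - iota b"
  and iota_mult: "iota (a * b) = iota a * iota b"
  and iota_scaleR: "iota (r *\<^sub>R a) = r *\<^sub>R iota a"
  and iota_star: "iota (a\<^sup>\<star>) = (iota a)\<^sup>\<star>"
  by (simp_all add: unitization_eqI)

lemma iota_algebra_part: "scalar_part u = 0 \<Longrightarrow> iota (algebra_part u) = u"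
  by (simp add: unitization_eqI)

lemma norm_iota [simp]: "norm (iota a) = norm a"
proof (cases "a = 0")
  case False
  have "left_mult (iota a) (a\<^sup>\<star>) = a * a\<^sup>\<star>" by (simp add: left_mult_def)
  then have "norm a * norm a \<le> onorm (left_mult (iota a)) * norm a"
    using norm_left_mult_le[of "iota a" "a\<^sup>\<star>"] by (simp add: cstar_identity' power2_eq_square)
  then have "norm a \<le> norm (iota a)" using False by (simp add: norm_unitization_def)
  then show ?thesis using norm_unitization_le[of "iota a"] by simp
qed simp

lemma iota_LIMSEQ: "(\<lambda>n. iota (X n)) \<longlonglongrightarrow> iota a \<longleftrightarrow> X \<longlonglongrightarrow> a"
  unfolding LIMSEQ_iff iota_diff[symmetric] norm_iota ..

lemma bounded_linear_scalar_part: "bounded_linear (scalar_part :: 'a::cstar_algebra unitization \<Rightarrow> complex)"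
  by (rule bounded_linear_intro[where K = 1]) (simp_all add: norm_scalar_part_le)

text \<open>Limits formed inside the unitization return to \<open>A\<close> in this way.\<close>

lemma scalar_part_LIMSEQ:
  assumes "X \<longlonglongrightarrow> v" "\<And>n. scalar_part (X n) = 0" shows "scalar_part v = 0"
  using bounded_linear.tendsto[OF bounded_linear_scalar_part assms(1)] assms(2)
  by (simp add: LIMSEQ_const_iff)

lemma spectrum_iota: "spectrum a = uspec (iota a)"
proof -
  have "unitization_invertible (b, l) \<longleftrightarrow> (\<exists>y. inverse_of (Unitize b l) y)" for b :: 'a and l
  proof -
    have m: "unitization_mult (b, l) (c, k) = (p, q) \<longleftrightarrow> Unitize b l * Unitize c k = Unitize p q"
      for b c p :: 'a and l k q
      by (simp add: times_unitization_def)
    show ?thesis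
    proof
      assume "unitization_invertible (b, l)"
      then obtain c k where "unitization_mult (b, l) (c, k) = (0, 1)" "unitization_mult (c, k) (b, l) = (0, 1)"
        unfolding unitization_invertible_def by (metis surj_pair)
      then show "\<exists>y. inverse_of (Unitize b l) y"
        unfolding m inverse_of_def one_unitization_def by blast
    next
      assume "\<exists>y. inverse_of (Unitize b l) y"
      then obtain c k where "inverse_of (Unitize b l) (Unitize c k)" by (metis unitization.collapse)
      then show "unitization_invertible (b, l)"
        unfolding inverse_of_def one_unitization_def unitization_invertible_def m[symmetric] by blast
    qed
  qed
  moreover have "l *\<^sub>C 1 - iota a = Unitize (- a) l" for l by (simp add: unitization_eqI)
  ultimately show ?thesis by (simp add: spectrum_def uspec_def)
qed

lemma positive_iff: "a \<in> positive_elements \<longleftrightarrow> iota a \<in> upos"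
  by (simp add: positive_elements_def upos_def spectrum_iota flip: iota_star)

lemma cstar_le_iff: "cstar_le a b \<longleftrightarrow> iota a \<preceq> iota b"
  by (simp add: cstar_le_def ule_def positive_iff iota_diff)

lemma iota_eval_mult_var: "iota (eval_mult_var q a) = rpeval (pCons 0 q) (iota a)"
proof -
  have p: "iota (((*) a ^^ i) a) = iota a ^ Suc i" for i
    by (induction i) (simp_all add: iota_mult)
  have c: "c *\<^sub>R iota a ^ Suc i = iota a * (of_real c * iota a ^ i)" for c i
    by (simp only: of_real_def mult_scaleR_left mult_scaleR_right mult_1_left power_Suc)
  have "iota (\<Sum>i\<in>S. coeff q i *\<^sub>R ((*) a ^^ i) a) = (\<Sum>i\<in>S. iota a * (of_real (coeff q i) * iota a ^ i))"
    if "finite S" for S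
    using that by induction (simp_all only: sum.empty sum.insert iota_0 iota_add iota_scaleR p c simp_thms)
  then have "iota (eval_mult_var q a) = (\<Sum>i\<le>degree q. iota a * (of_real (coeff q i) * iota a ^ i))"
    unfolding eval_mult_var_def by blast
  also have "\<dots> = rpeval (pCons 0 q) (iota a)"
    unfolding real_eval.peval_pCons by (simp add: peval_def sum_distrib_left)
  finally show ?thesis .
qed

lemma zero_in_rspec_iota: "0 \<in> rspec (iota a)"
proof -
  have "\<not> inverse_of (- iota a) y" for y
  proof
    assume "inverse_of (- iota a) y"
    then have "scalar_part (- iota a * y) = 1" by (simp only: inverse_of_def scalar_part_simps)
    then show False by simp
  qed
  then show ?thesis by (simp add: rspec_def uspec_def)
qed

text \<open>Evaluation in \<open>A\<close> admits only polynomials without constant term. Constant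
  terms may be dropped, because 0 is a spectral value and \<open>f 0 = 0\<close> makes them tend to
  0; the existence of such a sequence determines the \<open>THE\<close>.\<close>

lemma iota_functional_calculus:
  assumes a: "a\<^sup>\<star> = a" and f: "continuous_on (rspec (iota a)) f" "f 0 = 0"
  shows "iota (functional_calculus f a) = cfc f (iota a)"
proof -
  have sa: "(iota a)\<^sup>\<star> = iota a" using a by (simp flip: iota_star)
  have K: "{t. complex_of_real t \<in> spectrum a} = rspec (iota a)"
    by (simp add: spectrum_iota rspec_def)
  have lim: "(\<lambda>n. iota (eval_mult_var (q n) a)) \<longlonglongrightarrow> cfc f (iota a)"
    if "uniform_limit (rspec (iota a)) (\<lambda>n t. t * poly (q n) t) f sequentially" for q
  proof -
    have "(\<lambda>n. poly (pCons 0 (q n))) = (\<lambda>n t. t * poly (q n) t)" by (simp add: fun_eq_iff)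
    then have "uniform_limit (rspec (iota a)) (\<lambda>n. poly (pCons 0 (q n))) f sequentially"
      using that by simp
    from cfc_tendsto[OF sa this] show ?thesis by (simp only: iota_eval_mult_var)
  qed
  obtain p where p: "uniform_limit (rspec (iota a)) (\<lambda>n. poly (p n)) f sequentially"
    using polynomial_approximation[OF compact_rspec f(1)] by blast
  have "\<exists>q. p n = pCons (poly (p n) 0) q" for n
    by (cases "p n") simp
  then obtain q where q: "\<And>n. p n = pCons (poly (p n) 0) (q n)" by metis
  have "uniform_limit (rspec (iota a)) (\<lambda>n t. t * poly (q n) t) f sequentially"
    unfolding uniform_limit_sequentially_iff
  proof (intro allI impI)
    fix e :: real assume "e > 0"
    then have "e / 2 > 0" by simp
    then obtain N where N: "\<And>n t. n \<ge> N \<Longrightarrow> t \<in> rspec (iota a) \<Longrightarrow> dist (poly (p n) t) (f t) < e / 2"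
      using p unfolding uniform_limit_sequentially_iff by meson
    have "dist (t * poly (q n) t) (f t) < e" if n: "n \<ge> N" and t: "t \<in> rspec (iota a)" for n t
    proof -
      have "poly (p n) t = poly (p n) 0 + t * poly (q n) t" by (subst q) simp
      then show ?thesis
        using N[OF n t] N[OF n zero_in_rspec_iota] unfolding dist_real_def f(2) by linarith
    qed
    then show "\<exists>N. \<forall>n\<ge>N. \<forall>t\<in>rspec (iota a). dist (t * poly (q n) t) (f t) < e" by blast
  qed
  note q_lim = this
  have "scalar_part (cfc f (iota a)) = 0"
    by (rule scalar_part_LIMSEQ[OF lim[OF q_lim]]) simp
  then obtain b where b: "cfc f (iota a) = iota b" using iota_algebra_part by metis
  have "functional_calculus f a = b"
    unfolding functional_calculus_def K
  proof (rule the_equality)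
    show "\<forall>q. uniform_limit (rspec (iota a)) (\<lambda>n t. t * poly (q n) t) f sequentially \<longrightarrow>
        (\<lambda>n. eval_mult_var (q n) a) \<longlonglongrightarrow> b"
      using lim unfolding b iota_LIMSEQ by blast
    fix c assume "\<forall>q. uniform_limit (rspec (iota a)) (\<lambda>n t. t * poly (q n) t) f sequentially \<longrightarrow>
        (\<lambda>n. eval_mult_var (q n) a) \<longlonglongrightarrow> c"
    then have "(\<lambda>n. eval_mult_var (q n) a) \<longlonglongrightarrow> c" using q_lim by blast
    moreover have "(\<lambda>n. eval_mult_var (q n) a) \<longlonglongrightarrow> b" using lim[OF q_lim] unfolding b iota_LIMSEQ .
    ultimately show "c = b" by (rule LIMSEQ_unique)
  qed
  then show ?thesis by (simp add: b)
qed

section \<open>Powers, order and decompositions in \<open>A\<close> itself\<close>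

lemma iota_powr:
  assumes "a \<in> positive_elements" "0 < s"
  shows "iota (cstar_powr a s) = upowr (iota a) s"
  unfolding cstar_powr_def upowr_def
  by (rule iota_functional_calculus)
    (use assms continuous_powr[of "iota a" s] in \<open>auto simp: positive_iff[symmetric] positive_elements_def\<close>)

lemma positive_powr: "a \<in> positive_elements \<Longrightarrow> 0 < s \<Longrightarrow> cstar_powr a s \<in> positive_elements"
  using upowr_upos[of "iota a" s] by (simp add: positive_iff[symmetric] iota_powr[symmetric])

lemma positive_star: "a \<in> positive_elements \<Longrightarrow> a\<^sup>\<star> = a"
  by (simp add: positive_elements_def)

lemma positive_add: "a \<in> positive_elements \<Longrightarrow> b \<in> positive_elements \<Longrightarrow> a + b \<in> positive_elements"
  by (simp add: positive_iff iota_add upos_add)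

lemma positive_scaleR: "a \<in> positive_elements \<Longrightarrow> 0 \<le> r \<Longrightarrow> r *\<^sub>R a \<in> positive_elements"
  by (simp add: positive_iff iota_scaleR upos_scaleR)

lemma positive_0 [simp]: "0 \<in> positive_elements"
  by (simp add: positive_iff upos_0)

lemma positive_star_mult [simp]: "x\<^sup>\<star> * x \<in> positive_elements"
  by (simp add: positive_iff iota_mult iota_star)

lemma positive_mult_star [simp]: "x * x\<^sup>\<star> \<in> positive_elements"
  by (simp add: positive_iff iota_mult iota_star)

lemma cstar_le_refl [simp]: "cstar_le a a"
  by (simp add: cstar_le_iff)

lemma cstar_le_trans: "cstar_le a b \<Longrightarrow> cstar_le b c \<Longrightarrow> cstar_le a c"
  unfolding cstar_le_iff by (rule ule_trans)

lemma cstar_le_add: "cstar_le a b \<Longrightarrow> cstar_le c d \<Longrightarrow> cstar_le (a + c) (b + d)"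
  unfolding cstar_le_iff iota_add by (rule ule_add)

lemma cstar_le_0: "a \<in> positive_elements \<Longrightarrow> cstar_le a 0 \<Longrightarrow> a = 0"
  using upos_antisym[of "iota a"] by (simp add: positive_iff cstar_le_iff ule_def) (metis iota_0 iota_eq_iff)

lemma cstar_le_positive: "a \<in> positive_elements \<Longrightarrow> cstar_le a b \<Longrightarrow> b \<in> positive_elements"
  unfolding cstar_le_iff positive_iff by (rule upos_ule_trans)

lemma cstar_le_scaleR:
  "a \<in> positive_elements \<Longrightarrow> r \<le> s \<Longrightarrow> cstar_le (r *\<^sub>R a) (s *\<^sub>R a)"
  unfolding cstar_le_def by (simp add: positive_scaleR flip: scaleR_left_diff_distrib)

lemma star_mult_contract: "cstar_le ((a * s)\<^sup>\<star> * (a * s)) ((norm a)\<^sup>2 *\<^sub>R (s\<^sup>\<star> * s))"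
proof -
  have "(iota a)\<^sup>\<star> * iota a \<preceq> of_real ((norm a)\<^sup>2)"
    using ule_norm[OF star_mult_upos[of "iota a"]] by (simp add: cstar_identity)
  note le = ule_conj[OF this, of "iota s"]
  have "(iota s)\<^sup>\<star> * of_real ((norm a)\<^sup>2) * iota s = (norm a)\<^sup>2 *\<^sub>R ((iota s)\<^sup>\<star> * iota s)"
    unfolding of_real_def mult_scaleR_right mult_scaleR_left mult_1_right ..
  then show ?thesis
    using le unfolding cstar_le_iff iota_mult iota_star iota_scaleR star_mult
    by (simp only: mult.assoc)
qed

lemma powr_powr_positive:
  "a \<in> positive_elements \<Longrightarrow> 0 < s \<Longrightarrow> 0 < t \<Longrightarrow> cstar_powr (cstar_powr a s) t = cstar_powr a (s * t)"
  using upowr_powr[of "iota a" s t]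
  by (simp add: positive_iff[symmetric] iota_powr[symmetric] positive_powr)

lemma powr_add_positive:
  "a \<in> positive_elements \<Longrightarrow> 0 < s \<Longrightarrow> 0 < t \<Longrightarrow> cstar_powr a s * cstar_powr a t = cstar_powr a (s + t)"
  using upowr_add[of "iota a" s t]
  by (simp add: positive_iff[symmetric] iota_powr[symmetric] iota_mult[symmetric])

lemma powr_one_positive: "a \<in> positive_elements \<Longrightarrow> cstar_powr a 1 = a"
  using upowr_1[of "iota a"] by (simp add: positive_iff[symmetric] iota_powr[symmetric])

lemma positive_sqrt:
  assumes "a \<in> positive_elements" shows "\<exists>s. s\<^sup>\<star> = s \<and> s * s = a"
  using powr_add_positive[OF assms, of "1/2" "1/2"] positive_star[OF positive_powr[OF assms, of "1/2"]]
  by (auto simp: powr_one_positive[OF assms])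

lemma powr_le_scaleR_powr:
  assumes "a \<in> positive_elements" "0 < s" "s \<le> t"
  shows "\<exists>C\<ge>0. cstar_le (cstar_powr a t) (C *\<^sub>R cstar_powr a s)"
  using upowr_mono_exp[of "iota a" s t] assms
  by (intro exI[of _ "norm a powr (t - s)"])
    (simp add: cstar_le_iff iota_powr iota_scaleR positive_iff[symmetric])

text \<open>The factors \<open>d n\<close> live only in the unitization, but
  \<open>y * d n * x1\<^sup>\<star>\<close> has scalar part 0, and so has its limit.\<close>

lemma cstar_riesz_decomposition:
  assumes "cstar_le (y\<^sup>\<star> * y) (x1\<^sup>\<star> * x1 + x2\<^sup>\<star> * x2)"
  shows "\<exists>v1 v2. v1 * v1\<^sup>\<star> + v2 * v2\<^sup>\<star> = y * y\<^sup>\<star> \<and>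
    cstar_le (v1\<^sup>\<star> * v1) (x1 * x1\<^sup>\<star>) \<and> cstar_le (v2\<^sup>\<star> * v2) (x2 * x2\<^sup>\<star>)"
proof -
  have "(iota y)\<^sup>\<star> * iota y \<preceq> (iota x1)\<^sup>\<star> * iota x1 + (iota x2)\<^sup>\<star> * iota x2"
    using assms by (simp add: cstar_le_iff iota_add iota_mult iota_star)
  from riesz_decomposition[OF this] obtain d w1 w2 where
    w: "(\<lambda>n. iota y * d n * (iota x1)\<^sup>\<star>) \<longlonglongrightarrow> w1" "(\<lambda>n. iota y * d n * (iota x2)\<^sup>\<star>) \<longlonglongrightarrow> w2"
      "w1 * w1\<^sup>\<star> + w2 * w2\<^sup>\<star> = iota y * (iota y)\<^sup>\<star>"
      "w1\<^sup>\<star> * w1 \<preceq> iota x1 * (iota x1)\<^sup>\<star>" "w2\<^sup>\<star> * w2 \<preceq> iota x2 * (iota x2)\<^sup>\<star>"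
    by blast
  have "scalar_part w1 = 0" by (rule scalar_part_LIMSEQ[OF w(1)]) simp
  moreover have "scalar_part w2 = 0" by (rule scalar_part_LIMSEQ[OF w(2)]) simp
  ultimately obtain v1 v2 where v: "w1 = iota v1" "w2 = iota v2" using iota_algebra_part by metis
  show ?thesis
    using w(3-5) unfolding v cstar_le_iff iota_mult iota_star
    by (intro exI[of _ v1] exI[of _ v2]) (simp flip: iota_star iota_mult iota_add)
qed

lemma cstar_factorisation:
  assumes y: "cstar_le (y\<^sup>\<star> * y) c" and s: "0 < s" "s < 1/2"
  shows "\<exists>w. w * cstar_powr c s = y \<and> (c = y\<^sup>\<star> * y \<longrightarrow> w\<^sup>\<star> * y = cstar_powr c (1 - s))"
proof -
  have c: "c \<in> positive_elements" by (rule cstar_le_positive[OF positive_star_mult y])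
  have "(iota y)\<^sup>\<star> * iota y \<preceq> iota c" using y by (simp add: cstar_le_iff iota_mult iota_star)
  from factorisation[OF this s] obtain d u where
    u: "(\<lambda>n. iota y * d n) \<longlonglongrightarrow> u" "u * upowr (iota c) s = iota y"
      "iota c = (iota y)\<^sup>\<star> * iota y \<longrightarrow> u\<^sup>\<star> * iota y = upowr (iota c) (1 - s)"
    by blast
  have "scalar_part u = 0" by (rule scalar_part_LIMSEQ[OF u(1)]) simp
  then obtain w where w: "u = iota w" using iota_algebra_part by metis
  show ?thesis
    using u(2,3) s c unfolding w
    by (intro exI[of _ w]) (simp flip: iota_star iota_mult iota_powr)
qed

lemma cstar_powr_dominated:
  assumes a: "a \<in> positive_elements" and b: "b \<in> positive_elements" and le: "cstar_le a b"
    and th: "th = (1/2) ^ j"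
  shows "\<exists>z. cstar_le (cstar_powr a (1 + th)) (z\<^sup>\<star> * z) \<and> cstar_le (z * z\<^sup>\<star>) (cstar_powr b (1 + th))"
proof -
  have t: "0 < th" "0 < 1 + th" unfolding th by (simp_all add: add_pos_pos)
  have e: "iota (cstar_powr b (1/2) * cstar_powr a (th/2)) = upowr (iota b) (1/2) * upowr (iota a) (th/2)"
    using a b t by (simp add: iota_mult iota_powr)
  show ?thesis
    using upowr_dominated[of "iota a" "iota b" th j] assms t
    by (intro exI[of _ "cstar_powr b (1/2) * cstar_powr a (th/2)"])
      (simp add: cstar_le_iff positive_iff[symmetric] iota_powr iota_mult iota_star)
qed

lemma cstar_powr_sum:
  assumes a: "a \<in> positive_elements" and b: "b \<in> positive_elements" and th: "th = (1/2) ^ j"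
  shows "cstar_le (cstar_powr (a + b) (1 + th)) (2 *\<^sub>R (cstar_powr a (1 + th) + cstar_powr b (1 + th)))"
proof -
  have t: "0 < 1 + th" unfolding th by (simp add: add_pos_pos)
  show ?thesis
    using upowr_sum[of "iota a" "iota b" th j] assms t positive_add[OF a b]
    by (simp add: cstar_le_iff positive_iff[symmetric] iota_powr iota_add iota_scaleR)
qed

lemma cstar_powr_swap:
  assumes "1 < r"
  shows "\<exists>z. z\<^sup>\<star> * z = cstar_powr (x\<^sup>\<star> * x) r \<and> z * z\<^sup>\<star> = cstar_powr (x * x\<^sup>\<star>) r"
proof -
  define z where "z = x * cstar_powr (x\<^sup>\<star> * x) ((r - 1) / 2)"
  have z: "iota z = iota x * upowr ((iota x)\<^sup>\<star> * iota x) ((r - 1) / 2)"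
    using assms by (simp add: z_def iota_mult iota_powr iota_star)
  have "iota (z\<^sup>\<star> * z) = iota (cstar_powr (x\<^sup>\<star> * x) r)" "iota (z * z\<^sup>\<star>) = iota (cstar_powr (x * x\<^sup>\<star>) r)"
    using upowr_star_swap[OF assms, of "iota x"] assms
    by (simp_all add: iota_powr iota_mult iota_star z)
  then show ?thesis by auto
qed

subsection \<open>Strongly invariant order ideals and Dixmier ideals\<close>

lemma order_idealI:
  assumes "M \<subseteq> positive_elements" "0 \<in> M" "\<And>a b. a \<in> M \<Longrightarrow> b \<in> M \<Longrightarrow> a + b \<in> M"
    "\<And>a b. a \<in> positive_elements \<Longrightarrow> cstar_le a b \<Longrightarrow> b \<in> M \<Longrightarrow> a \<in> M"
  shows "order_ideal M"
  unfolding order_ideal_def using assms by blast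

lemma order_ideal_positive: "order_ideal M \<Longrightarrow> a \<in> M \<Longrightarrow> a \<in> positive_elements"
  unfolding order_ideal_def by blast

lemma order_ideal_0: "order_ideal M \<Longrightarrow> 0 \<in> M"
  unfolding order_ideal_def by blast

lemma order_ideal_add: "order_ideal M \<Longrightarrow> a \<in> M \<Longrightarrow> b \<in> M \<Longrightarrow> a + b \<in> M"
  unfolding order_ideal_def by blast

lemma order_ideal_mono:
  "order_ideal M \<Longrightarrow> a \<in> positive_elements \<Longrightarrow> cstar_le a b \<Longrightarrow> b \<in> M \<Longrightarrow> a \<in> M"
  unfolding order_ideal_def by blast

text \<open>Integer multiples come from addition, the others from heredity.\<close>

lemma order_ideal_scaleR:
  assumes M: "order_ideal M" and a: "a \<in> M" and r: "0 \<le> r"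
  shows "r *\<^sub>R a \<in> M"
proof -
  obtain n where n: "r \<le> real n" using real_arch_simple by blast
  have "real n *\<^sub>R a \<in> M"
    by (induction n) (use M a in \<open>auto simp: scaleR_add_left order_ideal_0 order_ideal_add\<close>)
  then show ?thesis
    using order_ideal_mono[OF M positive_scaleR cstar_le_scaleR] order_ideal_positive[OF M a] n r by blast
qed

lemma cspan_star:
  assumes M: "M \<subseteq> positive_elements" and x: "x \<in> cspan M"
  shows "x\<^sup>\<star> \<in> cspan M"
  using x
proof (induction rule: complex_space.span_induct_alt)
  case base
  show ?case by (simp add: complex_space.span_zero)
next
  case (step c m y)
  then have "m\<^sup>\<star> = m" using M positive_star by blast
  then show ?case
    using step by (simp add: star_add star_scaleC complex_space.span_add complex_space.span_scale
        complex_space.span_base)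
qed

text \<open>For a combination of elements \<open>m\<close> of \<open>M\<close> with coefficients
  \<open>k\<close>, the sum of the \<open>(2 * cmod k) *\<^sub>R m\<close> serves as
  \<open>p\<close>.\<close>

lemma cspan_order_ideal_bound:
  assumes M: "order_ideal M" and x: "x \<in> cspan M"
  shows "\<exists>p\<in>M. \<forall>c. cmod c \<le> 1 \<longrightarrow> cstar_le (c *\<^sub>C x + (c *\<^sub>C x)\<^sup>\<star>) p"
  using x
proof (induction rule: complex_space.span_induct_alt)
  case base
  show ?case using order_ideal_0[OF M] by (intro bexI[of _ 0]) simp_all
next
  case (step k m y)
  then obtain p where p: "p \<in> M" "\<And>c. cmod c \<le> 1 \<Longrightarrow> cstar_le (c *\<^sub>C y + (c *\<^sub>C y)\<^sup>\<star>) p" by blast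
  have m: "m \<in> positive_elements" using order_ideal_positive[OF M] step by blast
  have "cstar_le (c *\<^sub>C (k *\<^sub>C m + y) + (c *\<^sub>C (k *\<^sub>C m + y))\<^sup>\<star>) ((2 * cmod k) *\<^sub>R m + p)"
    if c: "cmod c \<le> 1" for c
  proof -
    have "(c * k) *\<^sub>C m + cnj (c * k) *\<^sub>C m = (2 * Re (c * k)) *\<^sub>R m"
      unfolding scaleC_add_left[symmetric] complex_add_cnj scaleC_of_real ..
    moreover have "Re (c * k) \<le> cmod k"
      using complex_Re_le_cmod[of "c * k"] mult_right_mono[OF c norm_ge_zero[of k]] by (simp add: norm_mult)
    ultimately have 1: "cstar_le ((c * k) *\<^sub>C m + cnj (c * k) *\<^sub>C m) ((2 * cmod k) *\<^sub>R m)"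
      using cstar_le_scaleR[OF m, of "2 * Re (c * k)" "2 * cmod k"] by simp
    have "c *\<^sub>C (k *\<^sub>C m + y) + (c *\<^sub>C (k *\<^sub>C m + y))\<^sup>\<star> =
        ((c * k) *\<^sub>C m + cnj (c * k) *\<^sub>C m) + (c *\<^sub>C y + (c *\<^sub>C y)\<^sup>\<star>)"
      by (simp add: scaleC_add_right scaleC_scaleC star_add star_scaleC positive_star[OF m])
    then show ?thesis using cstar_le_add[OF 1 p(2)[OF c]] by simp
  qed
  moreover have "(2 * cmod k) *\<^sub>R m + p \<in> M"
    using M step p by (intro order_ideal_add order_ideal_scaleR) auto
  ultimately show ?case by blast
qed

text \<open>A positive \<open>x\<close> in the span satisfies
  \<open>x \<le> x + x\<^sup>\<star> \<le> p\<close> for some \<open>p\<close> in \<open>M\<close>,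
  so heredity puts it in \<open>M\<close>.\<close>

lemma positive_part_cspan:
  assumes M: "order_ideal M"
  shows "positive_part (cspan M) = M"
proof
  show "M \<subseteq> positive_part (cspan M)"
    using order_ideal_positive[OF M] by (auto simp: positive_part_def complex_space.span_base)
  show "positive_part (cspan M) \<subseteq> M"
  proof
    fix x assume "x \<in> positive_part (cspan M)"
    then have x: "x \<in> cspan M" "x \<in> positive_elements" by (auto simp: positive_part_def)
    obtain p where p: "p \<in> M" "\<And>c. cmod c \<le> 1 \<Longrightarrow> cstar_le (c *\<^sub>C x + (c *\<^sub>C x)\<^sup>\<star>) p"
      using cspan_order_ideal_bound[OF M x(1)] by blast
    have "cstar_le (x + x) p" using p(2)[of 1] by (simp add: positive_star[OF x(2)])
    moreover have "cstar_le x (x + x)" using x(2) by (simp add: cstar_le_def)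
    ultimately show "x \<in> M" using order_ideal_mono[OF M x(2) cstar_le_trans p(1)] by blast
  qed
qed

text \<open>For \<open>Z c = s + c a s\<close> the parallelogram law puts
  \<open>(Z c)\<^sup>\<star> * Z c\<close> in \<open>M\<close>, and strong invariance does the same
  for \<open>Z c * (Z c)\<^sup>\<star>\<close>, whose cross term is \<open>c\<close> times
  \<open>a * m\<close>. The other order of factors would only give \<open>s * a * s\<close>.\<close>

lemma mult_order_ideal_mem_cspan:
  assumes M: "order_ideal M" "strongly_invariant M" and m: "m \<in> M"
  shows "a * m \<in> cspan M"
proof -
  have mp: "m \<in> positive_elements" by (rule order_ideal_positive[OF M(1) m])
  obtain s where s: "s\<^sup>\<star> = s" "s * s = m" using positive_sqrt[OF mp] by blast
  define Z where "Z c = s + c *\<^sub>C (a * s)" for c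
  have "Z c * (Z c)\<^sup>\<star> \<in> M" if c: "cmod c = 1" for c
  proof -
    have cc: "c * cnj c = 1" using c by (simp add: complex_norm_square[symmetric])
    define W where "W = s - c *\<^sub>C (a * s)"
    have "(Z c)\<^sup>\<star> * Z c + W\<^sup>\<star> * W = 2 *\<^sub>R (m + (a * s)\<^sup>\<star> * (a * s))"
      using cc by (simp add: Z_def W_def star_add star_diff star_scaleC s algebra_simps mult_scaleC_left
          mult_scaleC_right scaleC_scaleC scaleR_2 mult.commute[of "cnj c"])
    then have "cstar_le ((Z c)\<^sup>\<star> * Z c) (2 *\<^sub>R (m + (a * s)\<^sup>\<star> * (a * s)))"
      unfolding cstar_le_def by (metis add_diff_cancel_left' positive_star_mult)
    moreover have "(a * s)\<^sup>\<star> * (a * s) \<in> M"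
      using order_ideal_mono[OF M(1) positive_star_mult star_mult_contract] order_ideal_scaleR[OF M(1) m] s
      by simp
    then have "2 *\<^sub>R (m + (a * s)\<^sup>\<star> * (a * s)) \<in> M"
      using M m by (intro order_ideal_scaleR order_ideal_add) auto
    ultimately have "(Z c)\<^sup>\<star> * Z c \<in> M"
      using order_ideal_mono[OF M(1) positive_star_mult] by blast
    then show ?thesis using M(2) by (simp add: strongly_invariant_def)
  qed
  then have Zm: "Z c * (Z c)\<^sup>\<star> \<in> cspan M" if "cmod c = 1" for c
    using that complex_space.span_base by blast
  have ZZ: "Z c * (Z c)\<^sup>\<star> = m + c *\<^sub>C (a * m) + cnj c *\<^sub>C (m * a\<^sup>\<star>) + (c * cnj c) *\<^sub>C (a * m * a\<^sup>\<star>)" for c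
    by (simp add: Z_def star_add star_scaleC star_mult s algebra_simps mult_scaleC_left
          mult_scaleC_right scaleC_scaleC flip: s(2))
  \<comment> \<open>Polarisation: with weights \<open>cnj c\<close> over the fourth roots of unity
    \<open>c\<close>, only the term \<open>a * m\<close> survives.\<close>
  have "(1/4) *\<^sub>C (Z 1 * (Z 1)\<^sup>\<star> - Z (-1) * (Z (-1))\<^sup>\<star> + (-\<i>) *\<^sub>C (Z \<i> * (Z \<i>)\<^sup>\<star>) + \<i> *\<^sub>C (Z (-\<i>) * (Z (-\<i>))\<^sup>\<star>))
      \<in> cspan M"
    by (intro complex_space.span_add complex_space.span_diff complex_space.span_scale Zm) simp_all
  moreover have "Z 1 * (Z 1)\<^sup>\<star> - Z (-1) * (Z (-1))\<^sup>\<star> + (-\<i>) *\<^sub>C (Z \<i> * (Z \<i>)\<^sup>\<star>) + \<i> *\<^sub>C (Z (-\<i>) * (Z (-\<i>))\<^sup>\<star>)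
      = a * m + a * m + a * m + a * m"
    unfolding ZZ by (simp add: scaleC_add_right scaleC_diff_right scaleC_scaleC algebra_simps)
  moreover have "(1/4) *\<^sub>C (a * m + a * m + a * m + a * m) = a * m"
    by (simp add: scaleC_add_right flip: scaleC_add_left)
  ultimately show ?thesis by simp
qed

lemma dixmier_ideal_cspan:
  assumes M: "order_ideal M" "strongly_invariant M"
  shows "dixmier_ideal (cspan M)"
  unfolding dixmier_ideal_def positive_part_cspan[OF M(1)]
proof (intro conjI refl M)
  have left: "a * x \<in> cspan M" if "x \<in> cspan M" for a x
    using that
  proof (induction rule: complex_space.span_induct_alt)
    case base
    show ?case by (simp add: complex_space.span_zero)
  next
    case (step c m y)
    then show ?case
      by (simp add: distrib_left mult_scaleC_right complex_space.span_add complex_space.span_scale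
          mult_order_ideal_mem_cspan[OF M])
  qed
  have sub: "M \<subseteq> positive_elements" using order_ideal_positive[OF M(1)] by blast
  \<comment> \<open>The span is self-adjoint, so this is the adjoint of the left ideal
    property.\<close>
  have right: "x * a \<in> cspan M" if "x \<in> cspan M" for a x
    using cspan_star[OF sub left[OF cspan_star[OF sub that], of "a\<^sup>\<star>"]] by (simp add: star_mult star_star)
  show "cstar_ideal (cspan M)"
    unfolding cstar_ideal_def
    by (intro conjI ballI allI left right complex_space.span_zero complex_space.span_add
        complex_space.span_neg)
qed

subsection \<open>The two Dixmier ideals enclosing an ideal\<close>

text \<open>Ideals need not be closed under complex scalars, so the condition on \<open>y y\<^sup>*\<close> has to
  include its complex multiples for the span of the core to stay inside the ideal.\<close>

definition dixmier_core :: "'a::cstar_algebra set \<Rightarrow> 'a set" where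
  "dixmier_core I = {a \<in> positive_elements.
     \<forall>y. cstar_le (y\<^sup>\<star> * y) a \<longrightarrow> (\<forall>c. c *\<^sub>C (y * y\<^sup>\<star>) \<in> I)}"

lemma order_ideal_dixmier_core:
  assumes I: "cstar_ideal I"
  shows "order_ideal (dixmier_core I)"
proof (rule order_idealI)
  show "dixmier_core I \<subseteq> positive_elements" by (auto simp: dixmier_core_def)
  have "c *\<^sub>C (y * y\<^sup>\<star>) = 0" if "cstar_le (y\<^sup>\<star> * y) 0" for c and y :: 'a
    using cstar_le_0[OF positive_star_mult that] by simp
  then show "0 \<in> dixmier_core I" using I by (simp add: dixmier_core_def cstar_ideal_def) (metis complex_space.scale_eq_0_iff)
  show "a + b \<in> dixmier_core I" if a: "a \<in> dixmier_core I" and b: "b \<in> dixmier_core I" for a b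
    unfolding dixmier_core_def
  proof (intro CollectI conjI allI impI)
    have ab: "a \<in> positive_elements" "b \<in> positive_elements" using a b by (auto simp: dixmier_core_def)
    then show "a + b \<in> positive_elements" by (rule positive_add)
    obtain s t where st: "s\<^sup>\<star> = s" "s * s = a" "t\<^sup>\<star> = t" "t * t = b"
      using positive_sqrt[OF ab(1)] positive_sqrt[OF ab(2)] by blast
    fix y c assume "cstar_le (y\<^sup>\<star> * y) (a + b)"
    then have "cstar_le (y\<^sup>\<star> * y) (s\<^sup>\<star> * s + t\<^sup>\<star> * t)" by (simp add: st)
    from cstar_riesz_decomposition[OF this] obtain v w
      where v: "v * v\<^sup>\<star> + w * w\<^sup>\<star> = y * y\<^sup>\<star>" "cstar_le (v\<^sup>\<star> * v) a" "cstar_le (w\<^sup>\<star> * w) b"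
      by (auto simp: st)
    have "c *\<^sub>C (v * v\<^sup>\<star>) \<in> I" "c *\<^sub>C (w * w\<^sup>\<star>) \<in> I"
      using a b v(2,3) by (auto simp: dixmier_core_def)
    then show "c *\<^sub>C (y * y\<^sup>\<star>) \<in> I"
      using I by (simp add: cstar_ideal_def scaleC_add_right flip: v(1))
  qed
  show "a \<in> dixmier_core I"
    if "a \<in> positive_elements" "cstar_le a b" "b \<in> dixmier_core I" for a b
    using that cstar_le_trans[OF _ that(2)] unfolding dixmier_core_def mem_Collect_eq by blast
qed

lemma strongly_invariant_dixmier_core:
  assumes I: "cstar_ideal I"
  shows "strongly_invariant (dixmier_core I)"
proof -
  have *: "x * x\<^sup>\<star> \<in> dixmier_core I" if x: "x\<^sup>\<star> * x \<in> dixmier_core I" for x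
    unfolding dixmier_core_def
  proof (intro CollectI conjI allI impI positive_mult_star)
    fix y c assume "cstar_le (y\<^sup>\<star> * y) (x * x\<^sup>\<star>)"
    \<comment> \<open>With a zero second summand, Riesz decomposition exchanges
      \<open>x * x\<^sup>\<star>\<close> for \<open>x\<^sup>\<star> * x\<close> and keeps
      \<open>y * y\<^sup>\<star>\<close>.\<close>
    then have "cstar_le (y\<^sup>\<star> * y) ((x\<^sup>\<star>)\<^sup>\<star> * x\<^sup>\<star> + 0\<^sup>\<star> * 0)" by (simp add: star_star)
    from cstar_riesz_decomposition[OF this] obtain v w
      where v: "v * v\<^sup>\<star> + w * w\<^sup>\<star> = y * y\<^sup>\<star>" "cstar_le (v\<^sup>\<star> * v) (x\<^sup>\<star> * x)" "cstar_le (w\<^sup>\<star> * w) 0"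
      by (auto simp: star_star)
    have "w = 0" using cstar_le_0[OF positive_star_mult v(3)] by simp
    then show "c *\<^sub>C (y * y\<^sup>\<star>) \<in> I" using x v(1,2) by (auto simp: dixmier_core_def)
  qed
  show ?thesis
    unfolding strongly_invariant_def using * *[of "_\<^sup>\<star>"] by (metis star_star)
qed

lemma cspan_dixmier_core_subset:
  assumes I: "cstar_ideal I"
  shows "cspan (dixmier_core I) \<subseteq> I"
proof
  fix x assume "x \<in> cspan (dixmier_core I)"
  then show "x \<in> I"
  proof (induction rule: complex_space.span_induct_alt)
    case base
    show ?case using I by (simp add: cstar_ideal_def)
  next
    case (step c m y)
    then have m: "m \<in> positive_elements" by (simp add: dixmier_core_def)
    obtain s where s: "s\<^sup>\<star> = s" "s * s = m" using positive_sqrt[OF m] by blast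
    have "cstar_le (s\<^sup>\<star> * s) m" by (simp add: s)
    then have "c *\<^sub>C (s * s\<^sup>\<star>) \<in> I" using step by (simp add: dixmier_core_def)
    then show ?case using step I by (simp add: cstar_ideal_def s)
  qed
qed

text \<open>The bound 1/2 is the exponent 1 for \<open>cstar_abs x\<close>, the square root of
  \<open>x\<^sup>\<star> * x\<close>.\<close>

lemma powr_mem_dixmier_core:
  assumes I: "cstar_ideal I" and x: "x \<in> I" and p: "1/2 < p"
  shows "cstar_powr (x\<^sup>\<star> * x) p \<in> dixmier_core I"
  unfolding dixmier_core_def
proof (intro CollectI conjI allI impI)
  let ?c = "x\<^sup>\<star> * x"
  show "cstar_powr ?c p \<in> positive_elements" using p by (simp add: positive_powr)
  fix y k assume y: "cstar_le (y\<^sup>\<star> * y) (cstar_powr ?c p)"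
  text \<open>We write \<open>y = w c\<^sup>p\<^sup>s\<close> with \<open>s < 1/2\<close> but still \<open>2ps > 1/2\<close>.\<close>
  define q where "q = min (3/4) ((p + 1/2) / 2)"
  have q: "1/2 < q" "q < 1" "q < p" using p by (auto simp: q_def min_def)
  define s where "s = q / p / 2"
  have s: "0 < s" "s < 1/2" "p * s = q / 2" using q p by (simp_all add: s_def)
  obtain w where w: "w * cstar_powr (cstar_powr ?c p) s = y" using cstar_factorisation[OF y s(1,2)] by blast
  have yw: "y = w * cstar_powr ?c (q / 2)" using w p s by (simp add: powr_powr_positive)
  have cs: "(cstar_powr ?c (q / 2))\<^sup>\<star> = cstar_powr ?c (q / 2)" using q by (simp add: positive_star positive_powr)
  have "y * y\<^sup>\<star> = w * (cstar_powr ?c (q / 2) * cstar_powr ?c (q / 2)) * w\<^sup>\<star>"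
    by (simp add: yw star_mult cs mult.assoc)
  also have "cstar_powr ?c (q / 2) * cstar_powr ?c (q / 2) = cstar_powr ?c q"
    using q by (simp add: powr_add_positive)
  finally have yy: "y * y\<^sup>\<star> = w * cstar_powr ?c q * w\<^sup>\<star>" .
  \<comment> \<open>As \<open>1/2 < q < 1\<close>, the number \<open>1 - q\<close> is an admissible
    factorisation exponent; \<open>x\<close> itself becomes a factor of the power, and no limit in
    \<open>I\<close> occurs.\<close>
  obtain u where u: "u\<^sup>\<star> * x = cstar_powr ?c q"
    using cstar_factorisation[of x ?c "1 - q"] q by auto
  have "k *\<^sub>C (y * y\<^sup>\<star>) = (k *\<^sub>C (w * u\<^sup>\<star>)) * x * w\<^sup>\<star>"
    by (simp add: yy mult.assoc mult_scaleC_left flip: u)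
  then show "k *\<^sub>C (y * y\<^sup>\<star>) \<in> I" using I x by (simp add: cstar_ideal_def)
qed

definition powr_preimage :: "'a::cstar_algebra set \<Rightarrow> real \<Rightarrow> 'a set" where
  "powr_preimage M r = {a \<in> positive_elements. cstar_powr a r \<in> M}"

lemma order_ideal_powr_preimage:
  assumes M: "order_ideal M" "strongly_invariant M" and r: "r = 1 + (1/2) ^ j"
  shows "order_ideal (powr_preimage M r)"
proof (rule order_idealI)
  show "powr_preimage M r \<subseteq> positive_elements" by (auto simp: powr_preimage_def)
  have r0: "0 < r" unfolding r by (simp add: add_pos_pos)
  have "cstar_powr (0::'a) r = 0"
  proof -
    obtain C where C: "cstar_le (cstar_powr (0::'a) r) (C *\<^sub>R cstar_powr 0 1)"
      using powr_le_scaleR_powr[of "0::'a" 1 r] unfolding r by auto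
    then show ?thesis
      using cstar_le_0[OF positive_powr[OF positive_0 r0]] by (simp add: powr_one_positive)
  qed
  then show "0 \<in> powr_preimage M r" by (simp add: powr_preimage_def order_ideal_0[OF M(1)])
  show "a + b \<in> powr_preimage M r" if "a \<in> powr_preimage M r" "b \<in> powr_preimage M r" for a b
  proof -
    have ab: "a \<in> positive_elements" "b \<in> positive_elements" "cstar_powr a r \<in> M" "cstar_powr b r \<in> M"
      using that by (auto simp: powr_preimage_def)
    have "2 *\<^sub>R (cstar_powr a r + cstar_powr b r) \<in> M"
      using ab M(1) by (intro order_ideal_scaleR order_ideal_add) auto
    then have "cstar_powr (a + b) r \<in> M"
      using order_ideal_mono[OF M(1) positive_powr[OF positive_add[OF ab(1,2)] r0]]
        cstar_powr_sum[OF ab(1,2) refl, of j] unfolding r by blast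
    then show ?thesis using ab by (simp add: powr_preimage_def positive_add)
  qed
  show "a \<in> powr_preimage M r"
    if ab: "a \<in> positive_elements" "cstar_le a b" "b \<in> powr_preimage M r" for a b
  proof -
    have b: "b \<in> positive_elements" by (rule cstar_le_positive[OF ab(1,2)])
    obtain z where z: "cstar_le (cstar_powr a r) (z\<^sup>\<star> * z)" "cstar_le (z * z\<^sup>\<star>) (cstar_powr b r)"
      using cstar_powr_dominated[OF ab(1) b ab(2) refl, of j] unfolding r by blast
    \<comment> \<open>Powers above 1 are not monotone; strong invariance of \<open>M\<close> links
      the two inequalities on either side of \<open>z\<close>.\<close>
    have "z * z\<^sup>\<star> \<in> M"
      using order_ideal_mono[OF M(1) positive_mult_star z(2)] ab(3) by (simp add: powr_preimage_def)
    then have "z\<^sup>\<star> * z \<in> M" using M(2) by (simp add: strongly_invariant_def)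
    then have "cstar_powr a r \<in> M"
      using order_ideal_mono[OF M(1) positive_powr[OF ab(1) r0] z(1)] by blast
    then show ?thesis using ab(1) by (simp add: powr_preimage_def)
  qed
qed

lemma strongly_invariant_powr_preimage:
  assumes M: "strongly_invariant M" and r: "1 < r"
  shows "strongly_invariant (powr_preimage M r)"
  unfolding strongly_invariant_def
proof
  fix x :: 'a
  obtain z where z: "z\<^sup>\<star> * z = cstar_powr (x\<^sup>\<star> * x) r" "z * z\<^sup>\<star> = cstar_powr (x * x\<^sup>\<star>) r"
    using cstar_powr_swap[OF r] by blast
  have "z\<^sup>\<star> * z \<in> M \<longleftrightarrow> z * z\<^sup>\<star> \<in> M" using M by (simp add: strongly_invariant_def)
  then show "x\<^sup>\<star> * x \<in> powr_preimage M r \<longleftrightarrow> x * x\<^sup>\<star> \<in> powr_preimage M r"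
    by (simp add: powr_preimage_def z)
qed

text \<open>The span is an ideal, so it suffices that \<open>x\<close> has a right factor in the
  preimage; a power of \<open>x\<^sup>\<star> * x\<close> below 1/2 is such a factor.\<close>

lemma ideal_subset_cspan_powr_preimage:
  assumes I: "cstar_ideal I" and r: "r = 1 + (1/2) ^ j"
  shows "I \<subseteq> cspan (powr_preimage (dixmier_core I) r)"
proof
  fix x assume x: "x \<in> I"
  let ?K = "powr_preimage (dixmier_core I) r" and ?c = "x\<^sup>\<star> * x"
  have r1: "1 < r" by (simp add: r)
  \<comment> \<open>The midpoint of \<open>1 / (2 * r)\<close> and 1/2: small enough for
    factorisation, with \<open>s * r\<close> still above 1/2.\<close>
  define s where "s = (1 / r + 1) / 4"
  have s: "0 < s" "s < 1/2" "1/2 < s * r" using r1 by (simp_all add: s_def field_simps)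
  obtain w where w: "w * cstar_powr ?c s = x" using cstar_factorisation[of x ?c s] s by auto
  have "cstar_powr (cstar_powr ?c s) r \<in> dixmier_core I"
    using powr_mem_dixmier_core[OF I x s(3)] s r1 by (simp add: powr_powr_positive)
  then have "cstar_powr ?c s \<in> ?K" using s by (simp add: powr_preimage_def positive_powr)
  moreover have "dixmier_ideal (cspan ?K)"
    using order_ideal_dixmier_core[OF I] strongly_invariant_dixmier_core[OF I] r r1
    by (intro dixmier_ideal_cspan order_ideal_powr_preimage strongly_invariant_powr_preimage)
  ultimately have "w * cstar_powr ?c s \<in> cspan ?K"
    unfolding dixmier_ideal_def cstar_ideal_def using complex_space.span_base by blast
  then show "x \<in> cspan ?K" by (simp add: w)
qed

theorem theorem4p4:
  fixes I :: "'a::cstar_algebra set"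
  assumes "cstar_ideal I"
  shows "(\<forall>x\<in>I. \<forall>\<epsilon>>0. cstar_powr (cstar_abs x) (1 + \<epsilon>) \<in> dixmier_interior I) \<and>
    (\<forall>\<epsilon>>0. \<forall>\<delta>\<in>{0<..<1}.
       ideal_powr (dixmier_closure I) (1 + \<epsilon>) \<subseteq> dixmier_interior I \<and>
       dixmier_interior I \<subseteq> I \<and>
       I \<subseteq> dixmier_closure I \<and>
       dixmier_closure I \<subseteq> ideal_powr (dixmier_interior I) (1 - \<delta>))"
proof (intro conjI ballI allI impI)
  define N where "N = dixmier_core I"
  have N: "order_ideal N" "strongly_invariant N"
    unfolding N_def using assms by (simp_all add: order_ideal_dixmier_core strongly_invariant_dixmier_core)
  \<comment> \<open>One-element sums suffice, since \<open>cspan N\<close> is itself a Dixmier ideal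
    inside \<open>I\<close>.\<close>
  have J: "cspan N \<subseteq> dixmier_interior I"
  proof
    fix x assume "x \<in> cspan N"
    then have "set [x] \<subseteq> \<Union> {J. dixmier_ideal J \<and> J \<subseteq> I}" "sum_list [x] = x"
      using dixmier_ideal_cspan[OF N] cspan_dixmier_core_subset[OF assms] unfolding N_def by auto
    then show "x \<in> dixmier_interior I"
      unfolding dixmier_interior_def family_sum_def by (metis (mono_tags, lifting) mem_Collect_eq)
  qed
  have N_J: "x \<in> dixmier_interior I" if "x \<in> N" for x using that J complex_space.span_base by blast
  have exponent: "\<exists>j. 1 + (1/2) ^ j \<le> 1 + e" if "e > 0" for e :: real
    using real_arch_pow_inv[of e "1/2"] that by (auto intro: less_imp_le)
  have closure: "dixmier_closure I \<subseteq> cspan (powr_preimage N (1 + (1/2) ^ j))" for j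
    using dixmier_ideal_cspan[OF order_ideal_powr_preimage[OF N refl, of j]
        strongly_invariant_powr_preimage[OF N(2)]]
      ideal_subset_cspan_powr_preimage[OF assms refl, of j]
    unfolding dixmier_closure_def N_def by auto
  \<comment> \<open>A larger power lies below a multiple of a smaller one, which releases the
    exponents from being dyadic.\<close>
  have powr_N: "cstar_powr a q \<in> N" if a: "a \<in> powr_preimage N (1 + (1/2) ^ j)" and q: "1 + (1/2) ^ j \<le> q" for a j q
  proof -
    have p: "a \<in> positive_elements" "cstar_powr a (1 + (1/2) ^ j) \<in> N" using a by (auto simp: powr_preimage_def)
    have r0: "0 < 1 + (1/2::real) ^ j" by (simp add: add_pos_pos)
    obtain C where "0 \<le> C" "cstar_le (cstar_powr a q) (C *\<^sub>R cstar_powr a (1 + (1/2) ^ j))"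
      using powr_le_scaleR_powr[OF p(1) r0 q] by blast
    moreover have "cstar_powr a q \<in> positive_elements" using p(1) r0 q by (intro positive_powr) auto
    ultimately show ?thesis using order_ideal_mono[OF N(1)] order_ideal_scaleR[OF N(1) p(2)] by blast
  qed
  {
    fix x and \<epsilon> :: real assume x: "x \<in> I" and e: "0 < \<epsilon>"
    have "cstar_powr (x\<^sup>\<star> * x) ((1 + \<epsilon>) / 2) \<in> N"
      unfolding N_def using powr_mem_dixmier_core[OF assms x] e by simp
    moreover have "cstar_powr (cstar_abs x) (1 + \<epsilon>) = cstar_powr (x\<^sup>\<star> * x) ((1 + \<epsilon>) / 2)"
      unfolding cstar_abs_def using e by (simp add: powr_powr_positive)
    ultimately show "cstar_powr (cstar_abs x) (1 + \<epsilon>) \<in> dixmier_interior I" using N_J by simp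
  }
  {
    fix \<epsilon> :: real assume e: "0 < \<epsilon>"
    obtain j where j: "1 + (1/2) ^ j \<le> 1 + \<epsilon>" using exponent[OF e] by blast
    have "cstar_powr a (1 + \<epsilon>) \<in> N" if "a \<in> positive_part (dixmier_closure I)" for a
    proof -
      \<comment> \<open>Positive elements of the span belong to the spanning set, so the power of
        \<open>a\<close> itself is controlled.\<close>
      have "a \<in> positive_part (cspan (powr_preimage N (1 + (1/2) ^ j)))"
        using that closure[of j] by (auto simp: positive_part_def)
      then have "a \<in> powr_preimage N (1 + (1/2) ^ j)"
        by (simp only: positive_part_cspan[OF order_ideal_powr_preimage[OF N refl]])
      then show ?thesis using powr_N j by blast
    qed
    then have "ideal_powr (dixmier_closure I) (1 + \<epsilon>) \<subseteq> cspan N"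
      unfolding ideal_powr_def by (intro complex_space.span_mono) blast
    then show "ideal_powr (dixmier_closure I) (1 + \<epsilon>) \<subseteq> dixmier_interior I" using J by blast
  }
  have "sum_list xs \<in> I" if "set xs \<subseteq> I" for xs
    using that by (induction xs) (use assms in \<open>auto simp: cstar_ideal_def\<close>)
  then show "dixmier_interior I \<subseteq> I"
    unfolding dixmier_interior_def family_sum_def by blast
  show "I \<subseteq> dixmier_closure I" unfolding dixmier_closure_def by blast
  fix \<delta> :: real assume "\<delta> \<in> {0<..<1}"
  then have d: "0 < \<delta>" "\<delta> < 1" by auto
  \<comment> \<open>Then \<open>a = (a^q)^(1 - \<delta>)\<close>, and \<open>q > 1\<close> leaves
    room for an exponent \<open>1 + (1/2)^j\<close> up to \<open>q\<close>.\<close>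
  define q where "q = 1 / (1 - \<delta>)"
  have q: "1 < q" "q * (1 - \<delta>) = 1" using d by (simp_all add: q_def field_simps)
  obtain j where j: "1 + (1/2) ^ j \<le> q" using exponent[of "q - 1"] q by auto
  have "a \<in> (\<lambda>b. cstar_powr b (1 - \<delta>)) ` positive_part (dixmier_interior I)"
    if a: "a \<in> powr_preimage N (1 + (1/2) ^ j)" for a
  proof
    have p: "a \<in> positive_elements" using a by (simp add: powr_preimage_def)
    show "a = cstar_powr (cstar_powr a q) (1 - \<delta>)"
      using q d p by (simp add: powr_powr_positive powr_one_positive)
    show "cstar_powr a q \<in> positive_part (dixmier_interior I)"
      using N_J[OF powr_N[OF a j]] positive_powr[OF p, of q] q by (simp add: positive_part_def)
  qed
  then show "dixmier_closure I \<subseteq> ideal_powr (dixmier_interior I) (1 - \<delta>)"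
    using closure[of j] complex_space.span_mono unfolding ideal_powr_def by blast
qed

end
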